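(* Let $\pi:E\to G$ be a Fell line bundle, and $A$ a localizable completion. The associated semiopen map $p:\operatorname{Max}A\to\Omega(G)$ is weakly open.
   Context: Groupoids. A groupoid $G$ is a topological groupoid with unit space $G_0\subset G$, $d(g)=g^{-1}g$, $r(g)=gg^{-1}$, $G_2=\{(g,h): d(g)=r(h)\}$. Every groupoid is assumed étale ($d$ is a local homeomorphism) with $G_0$ locally compact Hausdorff; $G$ need not be Hausdorff. A local bisection is an open $U\subset G$ on which $d$ and $r$ are injective; $\mathcal I(G)$ is the set of local bisections. Quantales. An involutive quantale is a complete lattice with an associative product distributing over arbitrary joins on both sides and a join-preserving involution with $(ab)^*=b^*a^*$. A map $p:Q\to X$ of involutive quantales is a map $p^*:X\to Q$ preserving arbitrary joins, products and involution; it is semiopen if $p^*$ has a left adjoint $p_!:Q\to X$ ($p_!(a)\le x\iff a\le p^*(x)$), and weakly open if moreover $p_!(p^*(x)a)=x\,p_!(a)$ for all $a\in Q$, $x\in X$. $\Omega(G)$, the topology of $G$, is an involutive quantale under pointwise product and $U\mapsto U^{-1}$. $\operatorname{Max}A$ is the involutive quantale of closed linear subspaces of a C*-algebra $A$ with inclusion order, pointwise involution, and product $VW=\overline{\operatorname{span}}\{ab:a\in V,b\in W\}$. Fell bundles. A Banach bundle over a locally Hausdorff space $X$ is a continuous open surjection $\pi:E\to X$ with complex Banach space fibres $E_x=\pi^{-1}(\{x\})$ such that: $\pi^{-1}(U)$ is Hausdorff for each Hausdorff open $U\subset X$; addition $E\times_XE\to E$ and scalar multiplication by each $\lambda\in\mathbb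 C$ are continuous; $e\mapsto\|e\|$ is upper semicontinuous; for each $x$ and open $V\ni 0_x$ there are $\varepsilon>0$ and an open $U\ni x$ with $\{e\in\pi^{-1}(U):\|e\|<\varepsilon\}\subset V$. A Fell bundle on $G$ is a Banach bundle $\pi:E\to G$ with a continuous associative multiplication $(e,f)\mapsto ef$ defined when $(\pi(e),\pi(f))\in G_2$ and a continuous involution $e\mapsto e^*$, such that $\pi(ef)=\pi(e)\pi(f)$, $\pi(e^* )=\pi(e)^{-1}$, multiplication is fibrewise bilinear, the involution is fibrewise conjugate-linear, $e^{**}=e$, $(ef)^*=f^*e^*$, $\|ef\|\le\|e\|\|f\|$, $\|e^*\|=\|e\|$, $\|e^*e\|=\|e\|^2$, and $e^*e\ge0$ in the C*-algebra over $d(\pi(e))$. A Fell line bundle is one all of whose fibres have complex dimension $1$ (it is automatically saturated: $E_gE_h=E_{gh}$ for $(g,h)\in G_2$). Convolution algebra. For a Hausdorff open $U\subset G$, $C_c(U,E)$ is the space of sections $s:G\to E$ of $\pi$ (not necessarily continuous on $G$) that vanish outside $U$, are continuous on $U$, and satisfy $\{g:s(g)\ne0\}\subset K\subset U$ for some compact $K$. $\Gamma_c(G,E)$ is the linear span of $\bigcup_{U\in\mathcal I(G)}C_c(U,E)$, a $*$-algebra with $st(g)=\sum_{g=hk}s(h)t(k)$ and $s^*(g)=s(g^{-1})^*$. Let $\|s\|_\infty=\sup_g\|s(g)\|$. A compatible norm is a C*-norm $\|\cdot\|$ on $\Gamma_c(G,E)$ with $\|s\|_\infty\le\|s\|$ for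 all $s$ and $\|s\|_\infty=\|s\|$ if $s\in C_c(U,E)$ for some $U\in\mathcal I(G)$; the C*-completion $A$ in it is a compatible completion. For $g\in G$, $s\mapsto s(g)$ extends to a continuous linear map $\operatorname{eval}_g:A\to E_g$. The associated map $p:\operatorname{Max}A\to\Omega(G)$ of involutive quantales is given by $p^*(V)=\overline{\operatorname{span}}\bigcup\{C_c(U,E):U\in\mathcal I(G),\ U\subset V\}$. Localizability. For $a\in A$ let $\sigma(\langle a\rangle)=\operatorname{int}\{g\in G:\operatorname{eval}_g(a)\ne0\}$, and for $V\in\Omega(G)$ let $\gamma(V)=\overline{\operatorname{span}}\{a\in A:\sigma(\langle a\rangle)\subset V\}$. A localizable completion is a compatible completion $A$ with $p^*=\gamma$; in this case $p$ is semiopen with $p_!(V)=\bigcup_{a\in V}\operatorname{int}\{g:\operatorname{eval}_g(a)\neq0\}$. *)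

theory Defs
  imports "HOL-Analysis.Analysis" "HOL-Algebra.Complete_Lattice" "HOL-Algebra.FiniteProduct"
begin

section \<open>Groupoids\<close>

text \<open>A groupoid has the whole type as its set of arrows. \<^term>\<open>gcomp\<close> is a total function, of which
  only the values at composable pairs are meaningful.\<close>

record 'g groupoid_str =
  gcomp :: "'g \<Rightarrow> 'g \<Rightarrow> 'g"  (infixl \<open>\<cdot>\<index>\<close> 70)
  ginv :: "'g \<Rightarrow> 'g"

definition gdom :: "('g, 'm) groupoid_str_scheme \<Rightarrow> 'g \<Rightarrow> 'g" where
  "gdom G g = ginv G g \<cdot>\<^bsub>G\<^esub> g"

definition grng :: "('g, 'm) groupoid_str_scheme \<Rightarrow> 'g \<Rightarrow> 'g" where
  "grng G g = g \<cdot>\<^bsub>G\<^esub> ginv G g"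

definition gunits :: "('g, 'm) groupoid_str_scheme \<Rightarrow> 'g set" where
  "gunits G = range (gdom G)"

definition composable :: "('g, 'm) groupoid_str_scheme \<Rightarrow> ('g \<times> 'g) set" where
  "composable G = {(g, h). gdom G g = grng G h}"

locale groupoid =
  fixes G :: "('g, 'm) groupoid_str_scheme" (structure)
  assumes inv_inv: "ginv G (ginv G g) = g"
    and dom_comp: "(g, h) \<in> composable G \<Longrightarrow> gdom G (g \<cdot> h) = gdom G h"
    and rng_comp: "(g, h) \<in> composable G \<Longrightarrow> grng G (g \<cdot> h) = grng G g"
    and comp_assoc: "(g, h) \<in> composable G \<Longrightarrow> (h, k) \<in> composable G \<Longrightarrow> (g \<cdot> h) \<cdot> k = g \<cdot> (h \<cdot> k)"
    and comp_dom: "g \<cdot> gdom G g = g"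
    and rng_comp_self: "grng G g \<cdot> g = g"

locale topological_groupoid = groupoid G
  for G :: "('g::topological_space, 'm) groupoid_str_scheme" (structure) +
  assumes continuous_comp: "continuous_on (composable G) (\<lambda>(g, h). g \<cdot> h)"
    and continuous_inv: "continuous_on UNIV (ginv G)"

definition local_homeomorphism ::
    "('a::topological_space \<Rightarrow> 'b::topological_space) \<Rightarrow> 'b set \<Rightarrow> bool" where
  "local_homeomorphism f Y \<longleftrightarrow> range f \<subseteq> Y \<and>
     (\<forall>x. \<exists>U. open U \<and> x \<in> U \<and> openin (top_of_set Y) (f ` U) \<and> (\<exists>f'. homeomorphism U (f ` U) f f'))"

locale etale_groupoid = topological_groupoid G
  for G :: "('g::topological_space, 'm) groupoid_str_scheme" (structure) +
  assumes dom_local_homeo: "local_homeomorphism (gdom G) (gunits G)"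
    and units_locally_compact: "locally_compact_space (top_of_set (gunits G))"
    and units_Hausdorff: "Hausdorff_space (top_of_set (gunits G))"

definition local_bisections :: "('g::topological_space, 'm) groupoid_str_scheme \<Rightarrow> 'g set set" where
  "local_bisections G = {U. open U \<and> inj_on (gdom G) U \<and> inj_on (grng G) U}"

section \<open>Involutive quantales\<close>

record 'q quantale_str = "'q gorder" +
  qmult :: "'q \<Rightarrow> 'q \<Rightarrow> 'q"
  qstar :: "'q \<Rightarrow> 'q"

locale involutive_quantale = complete_lattice Q
  for Q :: "('q, 'm) quantale_str_scheme" (structure) +
  assumes qmult_closed: "a \<in> carrier Q \<Longrightarrow> b \<in> carrier Q \<Longrightarrow> qmult Q a b \<in> carrier Q"
    and qstar_closed: "a \<in> carrier Q \<Longrightarrow> qstar Q a \<in> carrier Q"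
    and qmult_assoc: "a \<in> carrier Q \<Longrightarrow> b \<in> carrier Q \<Longrightarrow> c \<in> carrier Q \<Longrightarrow>
          qmult Q (qmult Q a b) c = qmult Q a (qmult Q b c)"
    and qmult_Sup_right: "a \<in> carrier Q \<Longrightarrow> B \<subseteq> carrier Q \<Longrightarrow>
          qmult Q a (\<Squnion>B) = \<Squnion>(qmult Q a ` B)"
    and qmult_Sup_left: "a \<in> carrier Q \<Longrightarrow> B \<subseteq> carrier Q \<Longrightarrow>
          qmult Q (\<Squnion>B) a = \<Squnion>((\<lambda>b. qmult Q b a) ` B)"
    and qstar_qstar: "a \<in> carrier Q \<Longrightarrow> qstar Q (qstar Q a) = a"
    and qstar_Sup: "B \<subseteq> carrier Q \<Longrightarrow> qstar Q (\<Squnion>B) = \<Squnion>(qstar Q ` B)"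
    and qstar_qmult: "a \<in> carrier Q \<Longrightarrow> b \<in> carrier Q \<Longrightarrow>
          qstar Q (qmult Q a b) = qmult Q (qstar Q b) (qstar Q a)"

text \<open>A map \<open>p : Q \<rightarrow> X\<close> of involutive quantales is represented by its inverse image homomorphism
  \<open>p\<^sup>* : X \<rightarrow> Q\<close>, the parameter \<open>p\<close> below.\<close>

locale quantale_map = Q: involutive_quantale Q + X: involutive_quantale X
  for Q :: "('q, 'm) quantale_str_scheme" and X :: "('x, 'n) quantale_str_scheme"
    and p :: "'x \<Rightarrow> 'q" +
  assumes map_closed: "x \<in> carrier X \<Longrightarrow> p x \<in> carrier Q"
    and map_Sup: "S \<subseteq> carrier X \<Longrightarrow> p (\<Squnion>\<^bsub>X\<^esub>S) = \<Squnion>\<^bsub>Q\<^esub>(p ` S)"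
    and map_qmult: "x \<in> carrier X \<Longrightarrow> y \<in> carrier X \<Longrightarrow> p (qmult X x y) = qmult Q (p x) (p y)"
    and map_qstar: "x \<in> carrier X \<Longrightarrow> p (qstar X x) = qstar Q (p x)"

definition is_left_adjoint ::
    "('q, 'm) quantale_str_scheme \<Rightarrow> ('x, 'n) quantale_str_scheme \<Rightarrow> ('x \<Rightarrow> 'q) \<Rightarrow> ('q \<Rightarrow> 'x) \<Rightarrow> bool" where
  "is_left_adjoint Q X p l \<longleftrightarrow> (\<forall>a\<in>carrier Q. l a \<in> carrier X) \<and>
     (\<forall>a\<in>carrier Q. \<forall>x\<in>carrier X. l a \<sqsubseteq>\<^bsub>X\<^esub> x \<longleftrightarrow> a \<sqsubseteq>\<^bsub>Q\<^esub> p x)"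

definition semiopen ::
    "('q, 'm) quantale_str_scheme \<Rightarrow> ('x, 'n) quantale_str_scheme \<Rightarrow> ('x \<Rightarrow> 'q) \<Rightarrow> bool" where
  "semiopen Q X p \<longleftrightarrow> quantale_map Q X p \<and> (\<exists>l. is_left_adjoint Q X p l)"

definition weakly_open ::
    "('q, 'm) quantale_str_scheme \<Rightarrow> ('x, 'n) quantale_str_scheme \<Rightarrow> ('x \<Rightarrow> 'q) \<Rightarrow> bool" where
  "weakly_open Q X p \<longleftrightarrow> semiopen Q X p \<and>
     (\<forall>l. is_left_adjoint Q X p l \<longrightarrow>
        (\<forall>a\<in>carrier Q. \<forall>x\<in>carrier X. l (qmult Q (p x) a) = qmult X x (l a)))"

definition Omega :: "('g::topological_space, 'm) groupoid_str_scheme \<Rightarrow> 'g set quantale_str" where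
  "Omega G = \<lparr>carrier = {U. open U}, eq = (=), le = (\<subseteq>),
     qmult = (\<lambda>U V. {g \<cdot>\<^bsub>G\<^esub> h |g h. g \<in> U \<and> h \<in> V \<and> (g, h) \<in> composable G}),
     qstar = (\<lambda>U. ginv G ` U)\<rparr>"

section \<open>C*-algebras\<close>

text \<open>Not necessarily unital.\<close>

class cstar_algebra = banach + real_normed_algebra +
  fixes scaleC :: "complex \<Rightarrow> 'a \<Rightarrow> 'a"  (infixr \<open>*\<^sub>C\<close> 75)
    and adj :: "'a \<Rightarrow> 'a"
  assumes scaleC_of_real: "scaleC (complex_of_real r) a = scaleR r a"
    and scaleC_add_right: "scaleC c (a + b) = scaleC c a + scaleC c b"
    and scaleC_add_left: "scaleC (c + d) a = scaleC c a + scaleC d a"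
    and scaleC_scaleC: "scaleC c (scaleC d a) = scaleC (c * d) a"
    and norm_scaleC: "norm (scaleC c a) = cmod c * norm a"
    and mult_scaleC_left: "scaleC c a * b = scaleC c (a * b)"
    and mult_scaleC_right: "a * scaleC c b = scaleC c (a * b)"
    and adj_add: "adj (a + b) = adj a + adj b"
    and adj_scaleC: "adj (scaleC c a) = scaleC (cnj c) (adj a)"
    and adj_mult: "adj (a * b) = adj b * adj a"
    and adj_adj: "adj (adj a) = a"
    and norm_adj_mult: "norm (adj a * a) = (norm a)\<^sup>2"

global_interpretation cvec: vector_space "scaleC :: complex \<Rightarrow> 'a \<Rightarrow> 'a::cstar_algebra"
  defines cspan = cvec.span and csubspace = cvec.subspace
proof
  fix c d :: complex and a b :: 'a
  show "c *\<^sub>C (a + b) = c *\<^sub>C a + c *\<^sub>C b" by (rule scaleC_add_right)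
  show "(c + d) *\<^sub>C a = c *\<^sub>C a + d *\<^sub>C a" by (rule scaleC_add_left)
  show "c *\<^sub>C d *\<^sub>C a = (c * d) *\<^sub>C a" by (rule scaleC_scaleC)
  show "1 *\<^sub>C a = a" using scaleC_of_real[of 1 a] by simp
qed

definition Max_quantale :: "'a::cstar_algebra set quantale_str" where
  "Max_quantale = \<lparr>carrier = {V. closed V \<and> csubspace V}, eq = (=), le = (\<subseteq>),
     qmult = (\<lambda>V W. closure (cspan {a * b |a b. a \<in> V \<and> b \<in> W})),
     qstar = (\<lambda>V. adj ` V)\<rparr>"

section \<open>Fell bundles\<close>

text \<open>The total space of a bundle is the whole type \<^typ>\<open>'e\<close>; \<^term>\<open>badd\<close> is meaningful only on pairs in
  the same fibre, and \<^term>\<open>bmult\<close> only over composable pairs.\<close>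

record ('x, 'e) banach_bundle_str =
  proj :: "'e \<Rightarrow> 'x"
  badd :: "'e \<Rightarrow> 'e \<Rightarrow> 'e"
  bscale :: "complex \<Rightarrow> 'e \<Rightarrow> 'e"
  bzero :: "'x \<Rightarrow> 'e"
  bnorm :: "'e \<Rightarrow> real"

record ('x, 'e) fell_bundle_str = "('x, 'e) banach_bundle_str" +
  bmult :: "'e \<Rightarrow> 'e \<Rightarrow> 'e"
  bstar :: "'e \<Rightarrow> 'e"

definition fibre :: "('x, 'e, 'm) banach_bundle_str_scheme \<Rightarrow> 'x \<Rightarrow> 'e set" where
  "fibre E x = {e. proj E e = x}"

text \<open>The additive group of a fibre, written as a monoid record of HOL-Algebra.\<close>

definition fibre_group :: "('x, 'e, 'm) banach_bundle_str_scheme \<Rightarrow> 'x \<Rightarrow> 'e monoid" where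
  "fibre_group E x = \<lparr>carrier = fibre E x, mult = badd E, one = bzero E x\<rparr>"

definition fibre_dist :: "('x, 'e, 'm) banach_bundle_str_scheme \<Rightarrow> 'e \<Rightarrow> 'e \<Rightarrow> real" where
  "fibre_dist E e f = bnorm E (badd E e (bscale E (- 1) f))"

locale banach_bundle =
  fixes E :: "('x::topological_space, 'e::topological_space, 'm) banach_bundle_str_scheme"
  assumes base_locally_Hausdorff: "\<And>x::'x. \<exists>U. open U \<and> x \<in> U \<and> Hausdorff_space (top_of_set U)"
    and proj_continuous: "continuous_on UNIV (proj E)"
    and proj_open: "open W \<Longrightarrow> open (proj E ` W)"
    and proj_surj: "surj (proj E)"
    and fibre_comm_group: "comm_group (fibre_group E x)"
    and scale_closed: "proj E (bscale E c e) = proj E e"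
    and scale_add_right: "proj E e = proj E f \<Longrightarrow>
          bscale E c (badd E e f) = badd E (bscale E c e) (bscale E c f)"
    and scale_add_left: "bscale E (c + d) e = badd E (bscale E c e) (bscale E d e)"
    and scale_scale: "bscale E c (bscale E d e) = bscale E (c * d) e"
    and scale_one: "bscale E 1 e = e"
    and norm_nonneg: "0 \<le> bnorm E e"
    and norm_eq_zero: "bnorm E e = 0 \<longleftrightarrow> e = bzero E (proj E e)"
    and norm_triangle: "proj E e = proj E f \<Longrightarrow> bnorm E (badd E e f) \<le> bnorm E e + bnorm E f"
    and norm_scale: "bnorm E (bscale E c e) = cmod c * bnorm E e"
    and fibre_complete: "Metric_space.mcomplete (fibre E x) (fibre_dist E)"
    and Hausdorff_over: "open U \<Longrightarrow> Hausdorff_space (top_of_set U) \<Longrightarrow>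
          Hausdorff_space (top_of_set (proj E -` U))"
    and add_continuous: "continuous_on {(e, f). proj E e = proj E f} (\<lambda>(e, f). badd E e f)"
    and scale_continuous: "continuous_on UNIV (bscale E c)"
    and norm_upper_semicontinuous: "open {e. bnorm E e < r}"
    and zero_neighbourhoods: "open V \<Longrightarrow> bzero E x \<in> V \<Longrightarrow>
          \<exists>\<epsilon>>0. \<exists>U. open U \<and> x \<in> U \<and> {e. proj E e \<in> U \<and> bnorm E e < \<epsilon>} \<subseteq> V"

text \<open>An element of the fibre over a unit \<open>x\<close> is positive if it has the form \<open>b\<^sup>*b\<close> with \<open>b\<close> in
  that fibre.\<close>

definition fibre_positive :: "('g, 'e, 'n) fell_bundle_str_scheme \<Rightarrow> 'g \<Rightarrow> 'e \<Rightarrow> bool" where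
  "fibre_positive E x a \<longleftrightarrow> (\<exists>b\<in>fibre E x. a = bmult E (bstar E b) b)"

locale fell_bundle = etale_groupoid G + banach_bundle E
  for G :: "('g::topological_space, 'm) groupoid_str_scheme"
    and E :: "('g, 'e::topological_space, 'n) fell_bundle_str_scheme" +
  assumes proj_mult: "(proj E e, proj E f) \<in> composable G \<Longrightarrow>
          proj E (bmult E e f) = proj E e \<cdot>\<^bsub>G\<^esub> proj E f"
    and proj_star: "proj E (bstar E e) = ginv G (proj E e)"
    and mult_continuous: "continuous_on {(e, f). (proj E e, proj E f) \<in> composable G}
          (\<lambda>(e, f). bmult E e f)"
    and star_continuous: "continuous_on UNIV (bstar E)"
    and mult_assoc: "(proj E d, proj E e) \<in> composable G \<Longrightarrow> (proj E e, proj E f) \<in> composable G \<Longrightarrow>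
          bmult E (bmult E d e) f = bmult E d (bmult E e f)"
    and mult_add_right: "(proj E d, proj E e) \<in> composable G \<Longrightarrow> proj E e = proj E f \<Longrightarrow>
          bmult E d (badd E e f) = badd E (bmult E d e) (bmult E d f)"
    and mult_add_left: "(proj E d, proj E f) \<in> composable G \<Longrightarrow> proj E d = proj E e \<Longrightarrow>
          bmult E (badd E d e) f = badd E (bmult E d f) (bmult E e f)"
    and mult_scale_left: "(proj E e, proj E f) \<in> composable G \<Longrightarrow>
          bmult E (bscale E c e) f = bscale E c (bmult E e f)"
    and mult_scale_right: "(proj E e, proj E f) \<in> composable G \<Longrightarrow>
          bmult E e (bscale E c f) = bscale E c (bmult E e f)"
    and star_add: "proj E e = proj E f \<Longrightarrow> bstar E (badd E e f) = badd E (bstar E e) (bstar E f)"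
    and star_scale: "bstar E (bscale E c e) = bscale E (cnj c) (bstar E e)"
    and star_star: "bstar E (bstar E e) = e"
    and star_mult: "(proj E e, proj E f) \<in> composable G \<Longrightarrow>
          bstar E (bmult E e f) = bmult E (bstar E f) (bstar E e)"
    and norm_mult: "(proj E e, proj E f) \<in> composable G \<Longrightarrow>
          bnorm E (bmult E e f) \<le> bnorm E e * bnorm E f"
    and norm_star: "bnorm E (bstar E e) = bnorm E e"
    and norm_star_mult: "bnorm E (bmult E (bstar E e) e) = (bnorm E e)\<^sup>2"
    and star_mult_positive: "fibre_positive E (gdom G (proj E e)) (bmult E (bstar E e) e)"

locale fell_line_bundle = fell_bundle +
  assumes one_dimensional:
    "\<exists>e\<in>fibre E x. e \<noteq> bzero E x \<and> (\<forall>f\<in>fibre E x. \<exists>c. f = bscale E c e)"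

section \<open>The convolution algebra\<close>

definition Cc :: "('g::topological_space, 'e::topological_space, 'n) fell_bundle_str_scheme \<Rightarrow>
    'g set \<Rightarrow> ('g \<Rightarrow> 'e) set" where
  "Cc E U = {s. (\<forall>g. proj E (s g) = g) \<and> (\<forall>g. g \<notin> U \<longrightarrow> s g = bzero E g) \<and> continuous_on U s \<and>
     (\<exists>K. compact K \<and> {g. s g \<noteq> bzero E g} \<subseteq> K \<and> K \<subseteq> U)}"

inductive_set Gamma_c :: "('g::topological_space, 'm) groupoid_str_scheme \<Rightarrow>
    ('g, 'e::topological_space, 'n) fell_bundle_str_scheme \<Rightarrow> ('g \<Rightarrow> 'e) set"
  for G :: "('g::topological_space, 'm) groupoid_str_scheme"
    and E :: "('g, 'e::topological_space, 'n) fell_bundle_str_scheme" where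
  zero: "bzero E \<in> Gamma_c G E"
| base: "U \<in> local_bisections G \<Longrightarrow> s \<in> Cc E U \<Longrightarrow> s \<in> Gamma_c G E"
| add: "s \<in> Gamma_c G E \<Longrightarrow> t \<in> Gamma_c G E \<Longrightarrow> (\<lambda>g. badd E (s g) (t g)) \<in> Gamma_c G E"
| scale: "s \<in> Gamma_c G E \<Longrightarrow> (\<lambda>g. bscale E c (s g)) \<in> Gamma_c G E"

text \<open>The sum defining the product is restricted to its nonzero terms, which are finitely many if
  both factors are in \<^term>\<open>Gamma_c G E\<close>.\<close>

definition conv :: "('g, 'm) groupoid_str_scheme \<Rightarrow> ('g, 'e, 'n) fell_bundle_str_scheme \<Rightarrow>
    ('g \<Rightarrow> 'e) \<Rightarrow> ('g \<Rightarrow> 'e) \<Rightarrow> 'g \<Rightarrow> 'e" where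
  "conv G E s t g = finprod (fibre_group E g) (\<lambda>(h, k). bmult E (s h) (t k))
     {(h, k) \<in> composable G. h \<cdot>\<^bsub>G\<^esub> k = g \<and> bmult E (s h) (t k) \<noteq> bzero E g}"

definition sect_star :: "('g, 'm) groupoid_str_scheme \<Rightarrow> ('g, 'e, 'n) fell_bundle_str_scheme \<Rightarrow>
    ('g \<Rightarrow> 'e) \<Rightarrow> 'g \<Rightarrow> 'e" where
  "sect_star G E s g = bstar E (s (ginv G g))"

definition sup_norm :: "('g, 'e, 'n) fell_bundle_str_scheme \<Rightarrow> ('g \<Rightarrow> 'e) \<Rightarrow> real" where
  "sup_norm E s = (SUP g. bnorm E (s g))"

locale cstar_norm =
  fixes G :: "('g::topological_space, 'm) groupoid_str_scheme"
    and E :: "('g, 'e::topological_space, 'n) fell_bundle_str_scheme"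
    and N :: "('g \<Rightarrow> 'e) \<Rightarrow> real"
  assumes N_nonneg: "s \<in> Gamma_c G E \<Longrightarrow> 0 \<le> N s"
    and N_eq_zero: "s \<in> Gamma_c G E \<Longrightarrow> N s = 0 \<longleftrightarrow> s = bzero E"
    and N_triangle: "s \<in> Gamma_c G E \<Longrightarrow> t \<in> Gamma_c G E \<Longrightarrow>
          N (\<lambda>g. badd E (s g) (t g)) \<le> N s + N t"
    and N_scale: "s \<in> Gamma_c G E \<Longrightarrow> N (\<lambda>g. bscale E c (s g)) = cmod c * N s"
    and N_mult: "s \<in> Gamma_c G E \<Longrightarrow> t \<in> Gamma_c G E \<Longrightarrow> N (conv G E s t) \<le> N s * N t"
    and N_star_mult: "s \<in> Gamma_c G E \<Longrightarrow> N (conv G E (sect_star G E s) s) = (N s)\<^sup>2"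

locale compatible_norm = cstar_norm +
  assumes sup_norm_le: "s \<in> Gamma_c G E \<Longrightarrow> sup_norm E s \<le> N s"
    and sup_norm_eq: "U \<in> local_bisections G \<Longrightarrow> s \<in> Cc E U \<Longrightarrow> sup_norm E s = N s"

text \<open>The C*-completion of \<^term>\<open>Gamma_c G E\<close> in the norm \<open>N\<close> is a C*-algebra \<^typ>\<open>'a\<close> together with
  an isometric *-homomorphism \<open>\<iota>\<close> from \<^term>\<open>Gamma_c G E\<close> onto a dense subalgebra.\<close>

locale compatible_completion = compatible_norm G E N
  for G :: "('g::topological_space, 'm) groupoid_str_scheme"
    and E :: "('g, 'e::topological_space, 'n) fell_bundle_str_scheme"
    and N :: "('g \<Rightarrow> 'e) \<Rightarrow> real"
    and \<iota> :: "('g \<Rightarrow> 'e) \<Rightarrow> 'a::cstar_algebra" +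
  assumes \<iota>_add: "s \<in> Gamma_c G E \<Longrightarrow> t \<in> Gamma_c G E \<Longrightarrow> \<iota> (\<lambda>g. badd E (s g) (t g)) = \<iota> s + \<iota> t"
    and \<iota>_scale: "s \<in> Gamma_c G E \<Longrightarrow> \<iota> (\<lambda>g. bscale E c (s g)) = c *\<^sub>C \<iota> s"
    and \<iota>_mult: "s \<in> Gamma_c G E \<Longrightarrow> t \<in> Gamma_c G E \<Longrightarrow> \<iota> (conv G E s t) = \<iota> s * \<iota> t"
    and \<iota>_star: "s \<in> Gamma_c G E \<Longrightarrow> \<iota> (sect_star G E s) = adj (\<iota> s)"
    and \<iota>_norm: "s \<in> Gamma_c G E \<Longrightarrow> norm (\<iota> s) = N s"
    and \<iota>_dense: "closure (\<iota> ` Gamma_c G E) = UNIV"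

definition bounded_linear_to_fibre :: "('g, 'e, 'n) fell_bundle_str_scheme \<Rightarrow> 'g \<Rightarrow>
    ('a::cstar_algebra \<Rightarrow> 'e) \<Rightarrow> bool" where
  "bounded_linear_to_fibre E g f \<longleftrightarrow> (\<forall>a. f a \<in> fibre E g) \<and>
     (\<forall>a b. f (a + b) = badd E (f a) (f b)) \<and> (\<forall>c a. f (c *\<^sub>C a) = bscale E c (f a)) \<and>
     (\<exists>C. \<forall>a. bnorm E (f a) \<le> C * norm a)"

definition eval_at :: "('g::topological_space, 'm) groupoid_str_scheme \<Rightarrow>
    ('g, 'e::topological_space, 'n) fell_bundle_str_scheme \<Rightarrow> (('g \<Rightarrow> 'e) \<Rightarrow> 'a::cstar_algebra) \<Rightarrow>
    'g \<Rightarrow> 'a \<Rightarrow> 'e" where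
  "eval_at G E \<iota> g = (THE f. bounded_linear_to_fibre E g f \<and> (\<forall>s\<in>Gamma_c G E. f (\<iota> s) = s g))"

section \<open>The associated map and localizability\<close>

text \<open>The inverse image homomorphism \<open>p\<^sup>* : \<Omega>(G) \<rightarrow> Max A\<close> of the associated map.\<close>

definition assoc_map :: "('g::topological_space, 'm) groupoid_str_scheme \<Rightarrow>
    ('g, 'e::topological_space, 'n) fell_bundle_str_scheme \<Rightarrow> (('g \<Rightarrow> 'e) \<Rightarrow> 'a::cstar_algebra) \<Rightarrow>
    'g set \<Rightarrow> 'a set" where
  "assoc_map G E \<iota> V = closure (cspan (\<iota> ` (\<Union>U\<in>{U \<in> local_bisections G. U \<subseteq> V}. Cc E U)))"

definition open_support :: "('g::topological_space, 'm) groupoid_str_scheme \<Rightarrow>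
    ('g, 'e::topological_space, 'n) fell_bundle_str_scheme \<Rightarrow> (('g \<Rightarrow> 'e) \<Rightarrow> 'a::cstar_algebra) \<Rightarrow>
    'a \<Rightarrow> 'g set" where
  "open_support G E \<iota> a = interior {g. eval_at G E \<iota> g a \<noteq> bzero E g}"

definition supported_in :: "('g::topological_space, 'm) groupoid_str_scheme \<Rightarrow>
    ('g, 'e::topological_space, 'n) fell_bundle_str_scheme \<Rightarrow> (('g \<Rightarrow> 'e) \<Rightarrow> 'a::cstar_algebra) \<Rightarrow>
    'g set \<Rightarrow> 'a set" where
  "supported_in G E \<iota> V = closure (cspan {a. open_support G E \<iota> a \<subseteq> V})"

locale localizable_completion = compatible_completion +
  assumes localizable: "open V \<Longrightarrow> assoc_map G E \<iota> V = supported_in G E \<iota> V"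

end

theory Submission
  imports Defs
begin

text \<open>
Write \<open>p\<^sup>*\<close> for the associated map and \<open>\<sigma>(a)\<close> for the open support of \<open>a\<close>. Localizability says that
\<open>a \<in> p\<^sup>*(W)\<close> as soon as \<open>\<sigma>(a) \<subseteq> W\<close>; the converse always holds, because evaluation at a point outside
\<open>W\<close> is continuous and kills the generators of \<open>p\<^sup>*(W)\<close>. Hence \<open>p\<^sub>!(V) = \<Union>{\<sigma>(a) | a \<in> V}\<close> is the left
adjoint of \<open>p\<^sup>*\<close>, and weak openness is the equation \<open>p\<^sub>!(p\<^sup>*(U)V) = U p\<^sub>!(V)\<close>. The inclusion of the left
side in the right one is formal: \<open>V \<subseteq> p\<^sup>*(p\<^sub>!(V))\<close> and \<open>p\<^sup>*\<close> is multiplicative. For the other one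
let \<open>g \<in> U\<close> and \<open>h \<in> \<sigma>(a)\<close> with \<open>a \<in> V\<close> be composable, and let \<open>s\<close> be a section supported in a
bisection inside \<open>U\<close> with \<open>s(g) \<noteq> 0\<close>. Then \<open>eval\<^sub>x\<^sub>y(sa) = s(x) eval\<^sub>y(a)\<close> for \<open>x\<close> near \<open>g\<close> and \<open>y\<close> near
\<open>h\<close> (\<open>eval_at_mult\<close>), and this is nonzero since nonzero elements of a Fell line bundle have
nonzero products (\<open>bmult_nonzero\<close>). So \<open>gh\<close> has an open neighbourhood on which \<open>sa\<close> does not vanish.

Such an \<open>s\<close> exists because a Fell line bundle has local nonvanishing sections
(\<open>local_nonvanishing_section\<close>). They are obtained by averaging: first the norm, which is only assumed
to be upper semicontinuous, is shown to be continuous; then the elements of norm 1 over a compact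
part of a bisection form a compact Hausdorff space, a circle bundle; a Urysohn function on it,
averaged over the circle action against a character, becomes a function \<open>F\<close> with \<open>F(ze) = z F(e)\<close>,
and \<open>e \<mapsto> F(e)\<^sup>-\<^sup>1e\<close> is constant on fibres, hence a section. It is continuous because the projection is
open.

That \<open>p\<^sup>*\<close> is a map of quantales rests on two decompositions of sections. A partition of unity on a
bisection splits a section along an open cover, so \<open>p\<^sup>*\<close> preserves joins. If \<open>u\<close> is a nonvanishing
section over a bisection \<open>B\<close>, a section \<open>r\<close> supported in \<open>UB\<close> is \<open>(r (u/\<parallel>u\<parallel>\<^sup>2)\<^sup>*) u\<close>, with the first
factor supported in \<open>(UB)B\<^sup>-\<^sup>1 \<subseteq> U\<close>; since \<open>V\<close> is covered by such \<open>B\<close>, this gives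
\<open>p\<^sup>*(UV) = p\<^sup>*(U)p\<^sup>*(V)\<close>.
\<close>

section \<open>Algebra of groupoids\<close>

context groupoid
begin

lemma composable_iff: "(g, h) \<in> composable G \<longleftrightarrow> gdom G g = grng G h"
  by (simp add: composable_def)

lemma dom_inv [simp]: "gdom G (ginv G g) = grng G g"
  by (simp add: gdom_def grng_def inv_inv)

lemma rng_inv [simp]: "grng G (ginv G g) = gdom G g"
  by (simp add: gdom_def grng_def inv_inv)

lemma dom_dom [simp]: "gdom G (gdom G g) = gdom G g"
  and rng_dom [simp]: "grng G (gdom G g) = gdom G g"
proof -
  have "(ginv G g, g) \<in> composable G"
    by (simp add: composable_iff)
  from dom_comp[OF this] rng_comp[OF this]
  show "gdom G (gdom G g) = gdom G g" "grng G (gdom G g) = gdom G g"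
    by (simp_all add: gdom_def[of G g, symmetric])
qed

lemma dom_rng [simp]: "gdom G (grng G g) = grng G g"
  and rng_rng [simp]: "grng G (grng G g) = grng G g"
  using dom_dom[of "ginv G g"] rng_dom[of "ginv G g"] by simp_all

lemma dom_mult [simp]: "gdom G g = grng G h \<Longrightarrow> gdom G (g \<cdot> h) = gdom G h"
  using dom_comp composable_iff by blast

lemma rng_mult [simp]: "gdom G g = grng G h \<Longrightarrow> grng G (g \<cdot> h) = grng G g"
  using rng_comp composable_iff by blast

lemma mult_assoc_groupoid:
  "gdom G g = grng G h \<Longrightarrow> gdom G h = grng G k \<Longrightarrow> (g \<cdot> h) \<cdot> k = g \<cdot> (h \<cdot> k)"
  using comp_assoc composable_iff by blast

lemma inv_mult_self: "ginv G g \<cdot> g = gdom G g"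
  by (simp add: gdom_def)

lemma mult_inv_self: "g \<cdot> ginv G g = grng G g"
  by (simp add: grng_def)

lemma inv_mult_cancel: "gdom G g = grng G h \<Longrightarrow> ginv G g \<cdot> (g \<cdot> h) = h"
  using mult_assoc_groupoid[of "ginv G g" g h] by (simp add: inv_mult_self rng_comp_self)

lemma mult_inv_cancel: "grng G g = grng G h \<Longrightarrow> g \<cdot> (ginv G g \<cdot> h) = h"
  using mult_assoc_groupoid[of g "ginv G g" h] by (simp add: mult_inv_self rng_comp_self)

lemma cancel_mult_inv: "gdom G g = grng G h \<Longrightarrow> (g \<cdot> h) \<cdot> ginv G h = g"
  using mult_assoc_groupoid[of g h "ginv G h"] comp_dom[of g] by (simp add: mult_inv_self)

lemma cancel_inv_mult: "gdom G g = gdom G h \<Longrightarrow> (g \<cdot> ginv G h) \<cdot> h = g"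
  using mult_assoc_groupoid[of g "ginv G h" h] comp_dom[of g] by (simp add: inv_mult_self)

lemma inv_mult: assumes "gdom G g = grng G h" shows "ginv G (g \<cdot> h) = ginv G h \<cdot> ginv G g"
proof -
  let ?k = "ginv G h \<cdot> ginv G g"
  have "?k \<cdot> (g \<cdot> h) = gdom G h"
    using assms mult_assoc_groupoid[of "ginv G h" "ginv G g" "g \<cdot> h"]
    by (simp add: inv_mult_cancel inv_mult_self)
  then have "(?k \<cdot> (g \<cdot> h)) \<cdot> ginv G (g \<cdot> h) = ginv G (g \<cdot> h)"
    using rng_comp_self[of "ginv G (g \<cdot> h)"] assms by simp
  then show ?thesis
    using cancel_mult_inv[of ?k "g \<cdot> h"] assms by simp
qed

lemma inv_image: "ginv G ` U = ginv G -` U"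
  using inv_inv by (auto simp: image_iff) metis

lemma range_rng: "range (grng G) = gunits G"
proof -
  have "grng G g \<in> gunits G" for g
    by (metis dom_inv gunits_def rangeI)
  moreover have "gdom G g \<in> range (grng G)" for g
    by (metis rng_inv rangeI)
  ultimately show ?thesis by (auto simp: gunits_def)
qed

definition set_mult :: "'g set \<Rightarrow> 'g set \<Rightarrow> 'g set" where
  "set_mult U V = {g \<cdot> h |g h. g \<in> U \<and> h \<in> V \<and> gdom G g = grng G h}"

lemma set_multI: "g \<in> U \<Longrightarrow> h \<in> V \<Longrightarrow> gdom G g = grng G h \<Longrightarrow> g \<cdot> h \<in> set_mult U V"
  unfolding set_mult_def by blast

lemma set_multE:
  assumes "k \<in> set_mult U V"
  obtains g h where "k = g \<cdot> h" "g \<in> U" "h \<in> V" "gdom G g = grng G h"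
  using assms unfolding set_mult_def by blast

lemma set_mult_assoc: "set_mult (set_mult U V) W = set_mult U (set_mult V W)"
proof (intro equalityI subsetI)
  fix k assume "k \<in> set_mult (set_mult U V) W"
  then obtain g h w where *: "k = (g \<cdot> h) \<cdot> w" "g \<in> U" "h \<in> V" "w \<in> W"
    "gdom G g = grng G h" "gdom G (g \<cdot> h) = grng G w"
    by (auto elim!: set_multE)
  then have "k = g \<cdot> (h \<cdot> w)" "gdom G h = grng G w"
    using mult_assoc_groupoid by simp_all
  then show "k \<in> set_mult U (set_mult V W)"
    using * by (auto intro!: set_multI)
next
  fix k assume "k \<in> set_mult U (set_mult V W)"
  then obtain g h w where *: "k = g \<cdot> (h \<cdot> w)" "g \<in> U" "h \<in> V" "w \<in> W"
    "gdom G h = grng G w" "gdom G g = grng G (h \<cdot> w)"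
    by (auto elim!: set_multE)
  then have "k = (g \<cdot> h) \<cdot> w" "gdom G g = grng G h"
    using mult_assoc_groupoid by simp_all
  then show "k \<in> set_mult (set_mult U V) W"
    using * by (auto intro!: set_multI)
qed

lemma inv_set_mult: "ginv G ` set_mult U V = set_mult (ginv G ` V) (ginv G ` U)"
proof (intro equalityI subsetI)
  fix k assume "k \<in> ginv G ` set_mult U V"
  then obtain g h where "k = ginv G (g \<cdot> h)" "g \<in> U" "h \<in> V" "gdom G g = grng G h"
    by (auto elim!: set_multE)
  then show "k \<in> set_mult (ginv G ` V) (ginv G ` U)"
    by (auto simp: inv_mult intro!: set_multI)
next
  fix k assume "k \<in> set_mult (ginv G ` V) (ginv G ` U)"
  then obtain g h where "k = ginv G h \<cdot> ginv G g" "g \<in> U" "h \<in> V" "gdom G g = grng G h"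
    by (auto elim!: set_multE)
  then show "k \<in> ginv G ` set_mult U V"
    by (auto simp: inv_mult[symmetric] intro!: set_multI)
qed

text \<open>On a set \<open>B\<close> on which \<open>d\<close> is injective, right translation by \<open>B\<close> can be undone.\<close>

lemma set_mult_inv_subset:
  assumes "inj_on (gdom G) B" shows "set_mult (set_mult V B) (ginv G ` B) \<subseteq> V"
proof
  fix k assume "k \<in> set_mult (set_mult V B) (ginv G ` B)"
  then obtain v b c where *: "k = (v \<cdot> b) \<cdot> ginv G c" "v \<in> V" "b \<in> B" "c \<in> B"
    "gdom G v = grng G b" "gdom G (v \<cdot> b) = gdom G c"
    by (auto elim!: set_multE)
  then have "b = c"
    using assms by (auto dest: inj_onD)
  then show "k \<in> V"
    using * cancel_mult_inv by simp
qed

end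

section \<open>Topology of etale groupoids\<close>

context topological_groupoid
begin

lemma tendsto_comp:
  assumes "(f \<longlongrightarrow> a) F" "(h \<longlongrightarrow> b) F" "\<forall>\<^sub>F i in F. gdom G (f i) = grng G (h i)" "gdom G a = grng G b"
  shows "((\<lambda>i. f i \<cdot> h i) \<longlongrightarrow> a \<cdot> b) F"
proof -
  have "((\<lambda>i. (\<lambda>(g, h). g \<cdot> h) (f i, h i)) \<longlongrightarrow> (\<lambda>(g, h). g \<cdot> h) (a, b)) F"
    by (rule continuous_on_tendsto_compose[OF continuous_comp])
       (use assms in \<open>auto simp: composable_iff intro: tendsto_Pair\<close>)
  then show ?thesis by simp
qed

lemma tendsto_inv: "(f \<longlongrightarrow> a) F \<Longrightarrow> ((\<lambda>i. ginv G (f i)) \<longlongrightarrow> ginv G a) F"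
  using continuous_on_tendsto_compose[OF continuous_inv] by auto

lemma tendsto_dom: "(f \<longlongrightarrow> a) F \<Longrightarrow> ((\<lambda>i. gdom G (f i)) \<longlongrightarrow> gdom G a) F"
  unfolding gdom_def by (intro tendsto_comp tendsto_inv) auto

lemma tendsto_rng: "(f \<longlongrightarrow> a) F \<Longrightarrow> ((\<lambda>i. grng G (f i)) \<longlongrightarrow> grng G a) F"
  unfolding grng_def by (intro tendsto_comp tendsto_inv) auto

lemma continuous_dom: "continuous_on S (gdom G)" and continuous_rng: "continuous_on S (grng G)"
  unfolding continuous_on_def by (auto intro!: tendsto_dom tendsto_rng)

lemma open_inv_image: "open U \<Longrightarrow> open (ginv G ` U)"
  unfolding inv_image using continuous_inv by (simp add: continuous_on_open_vimage)

end

context etale_groupoid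
begin

text \<open>A local homeomorphism onto its image is an open map.\<close>

lemma openin_dom_image:
  assumes "open U" shows "openin (top_of_set (gunits G)) (gdom G ` U)"
proof (subst openin_subopen, rule ballI)
  fix y assume "y \<in> gdom G ` U"
  then obtain x where x: "x \<in> U" "y = gdom G x" by blast
  from dom_local_homeo obtain W f' where W: "open W" "x \<in> W"
    "openin (top_of_set (gunits G)) (gdom G ` W)" "homeomorphism W (gdom G ` W) (gdom G) f'"
    unfolding local_homeomorphism_def by blast
  have "openin (top_of_set W) (U \<inter> W)"
    using \<open>open U\<close> by (auto simp: openin_open)
  then have "openin (top_of_set (gdom G ` W)) (gdom G ` (U \<inter> W))"
    using homeomorphism_imp_open_map W(4) by blast
  then have "openin (top_of_set (gunits G)) (gdom G ` (U \<inter> W))"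
    using W(3) openin_trans by blast
  then show "\<exists>T. openin (top_of_set (gunits G)) T \<and> y \<in> T \<and> T \<subseteq> gdom G ` U"
    using x W(2) by blast
qed

lemma open_dom_vimage:
  assumes "openin (top_of_set (gunits G)) T" shows "open (gdom G -` T)"
proof -
  obtain W where "open W" "T = gunits G \<inter> W" using assms by (auto simp: openin_open)
  then have "gdom G -` T = gdom G -` W" by (auto simp: gunits_def)
  then show ?thesis using \<open>open W\<close> continuous_dom continuous_on_open_vimage open_UNIV by (metis Int_UNIV_right)
qed

lemma bisectionD:
  assumes "B \<in> local_bisections G"
  shows "open B" "inj_on (gdom G) B" "inj_on (grng G) B"
  using assms by (auto simp: local_bisections_def)

lemma bisection_subset:
  "B \<in> local_bisections G \<Longrightarrow> open U \<Longrightarrow> U \<subseteq> B \<Longrightarrow> U \<in> local_bisections G"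
  by (auto simp: local_bisections_def intro: inj_on_subset)

lemma bisection_inv:
  assumes "B \<in> local_bisections G" shows "ginv G ` B \<in> local_bisections G"
proof -
  have "inj_on (gdom G) (ginv G ` B)" "inj_on (grng G) (ginv G ` B)"
    using bisectionD[OF assms] by (auto simp: inj_on_def)
  then show ?thesis
    using bisectionD(1)[OF assms] open_inv_image by (simp add: local_bisections_def)
qed

lemma bisection_basis:
  assumes "open W" "g \<in> W"
  obtains B where "B \<in> local_bisections G" "g \<in> B" "B \<subseteq> W"
proof -
  from dom_local_homeo obtain W1 where W1: "open W1" "g \<in> W1" "inj_on (gdom G) W1"
    unfolding local_homeomorphism_def homeomorphism_def by (metis inj_on_inverseI)
  from dom_local_homeo obtain W2 where W2: "open W2" "ginv G g \<in> W2" "inj_on (gdom G) W2"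
    unfolding local_homeomorphism_def homeomorphism_def by (metis inj_on_inverseI)
  let ?B = "W \<inter> W1 \<inter> ginv G ` W2"
  have "inj_on (grng G) ?B"
    using W2(3) unfolding inj_on_def by (auto simp: inv_inv)
  moreover have "inj_on (gdom G) ?B"
    using W1(3) by (auto simp: inj_on_def)
  moreover have "g \<in> ginv G ` W2"
    using W2(2) inv_inv by (metis image_eqI)
  ultimately show ?thesis
    using that[of ?B] assms W1 W2 open_inv_image by (auto simp: local_bisections_def)
qed

lemma bisection_homeomorphism_dom:
  assumes "B \<in> local_bisections G"
  shows "homeomorphism B (gdom G ` B) (gdom G) (inv_into B (gdom G))"
proof -
  have "continuous_on (gdom G ` B) (inv_into B (gdom G))"
  proof (rule continuous_on_inverse_open_map[OF continuous_dom refl])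
    fix U assume U: "openin (top_of_set B) U"
    then have "open U" "U \<subseteq> B"
      using bisectionD(1)[OF assms] openin_open_eq by auto
    then show "openin (top_of_set (gdom G ` B)) (gdom G ` U)"
      using openin_subset_trans[OF openin_dom_image[of U], of "gdom G ` B"] by (auto simp: gunits_def)
  qed (use bisectionD[OF assms] in auto)
  then show ?thesis
    using bisectionD[OF assms] continuous_dom by (auto simp: homeomorphism_def)
qed

text \<open>On a bisection \<open>d\<close> is a homeomorphism onto its image, so that convergence inside it can be
  tested after applying \<open>d\<close>. The continuity of maps that solve \<open>d(b) = d(k)\<close> in \<open>B\<close> is proved in this way.\<close>

lemma tendsto_bisection_dom:
  assumes B: "B \<in> local_bisections G" and a: "a \<in> B" and ev: "\<forall>\<^sub>F i in F. f i \<in> B"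
    and lim: "((\<lambda>i. gdom G (f i)) \<longlongrightarrow> gdom G a) F"
  shows "(f \<longlongrightarrow> a) F"
proof -
  have "((\<lambda>i. inv_into B (gdom G) (gdom G (f i))) \<longlongrightarrow> inv_into B (gdom G) (gdom G a)) F"
    by (rule continuous_on_tendsto_compose[OF homeomorphism_cont2[OF bisection_homeomorphism_dom[OF B]] lim])
       (use a ev in \<open>auto elim: eventually_mono\<close>)
  moreover have "\<forall>\<^sub>F i in F. inv_into B (gdom G) (gdom G (f i)) = f i"
    using ev by eventually_elim (simp add: bisectionD[OF B])
  ultimately show ?thesis
    using a bisectionD[OF B] by (simp add: tendsto_cong)
qed

lemma tendsto_bisection_rng:
  assumes B: "B \<in> local_bisections G" and a: "a \<in> B" and ev: "\<forall>\<^sub>F i in F. f i \<in> B"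
    and lim: "((\<lambda>i. grng G (f i)) \<longlongrightarrow> grng G a) F"
  shows "(f \<longlongrightarrow> a) F"
proof -
  have "((\<lambda>i. ginv G (f i)) \<longlongrightarrow> ginv G a) F"
    by (rule tendsto_bisection_dom[OF bisection_inv[OF B]])
       (use a ev lim in \<open>auto elim: eventually_mono\<close>)
  from tendsto_inv[OF this] show ?thesis by (simp add: inv_inv)
qed

lemma bisection_locally_compact_Hausdorff:
  assumes "B \<in> local_bisections G" shows "Hausdorff_space (top_of_set B)"
  and "locally_compact_space (top_of_set B)"
proof -
  have *: "top_of_set (gdom G ` B) homeomorphic_space top_of_set B"
    unfolding homeomorphic_space_def homeomorphic_maps_def
    using bisection_homeomorphism_dom[OF assms]
    by (intro exI[of _ "inv_into B (gdom G)"] exI[of _ "gdom G"]) (auto simp: homeomorphism_def)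
  have o: "openin (top_of_set (gunits G)) (gdom G ` B)"
    using openin_dom_image bisectionD(1)[OF assms] by blast
  then have eq: "top_of_set (gdom G ` B) = subtopology (top_of_set (gunits G)) (gdom G ` B)"
    by (metis inf.absorb2 openin_subset subtopology_subtopology topspace_euclidean_subtopology)
  show "Hausdorff_space (top_of_set B)"
    using homeomorphic_Hausdorff_space[OF *] units_Hausdorff Hausdorff_space_subtopology eq by metis
  show "locally_compact_space (top_of_set B)"
    using homeomorphic_locally_compact_spaceD[OF _ *] eq o units_Hausdorff units_locally_compact
      locally_compact_space_open_subset by metis
qed

text \<open>Urysohn functions on bisections, which are locally compact Hausdorff although \<open>G\<close> need not be
  Hausdorff.\<close>

lemma bisection_Urysohn:
  assumes B: "B \<in> local_bisections G" and K: "compact K" "K \<subseteq> U" and U: "open U" "U \<subseteq> B"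
  obtains \<phi> :: "'g \<Rightarrow> real" and L where "continuous_on B \<phi>" "\<And>x. x \<in> K \<Longrightarrow> \<phi> x = 1"
    "compact L" "L \<subseteq> U" "\<And>x. x \<notin> L \<Longrightarrow> \<phi> x = 0"
proof -
  let ?X = "top_of_set U"
  have UB: "U \<in> local_bisections G"
    using bisection_subset B U by blast
  have "compactin ?X K"
    using K by (simp add: compactin_subtopology)
  then obtain W L where W: "openin ?X W" "compactin ?X L" "K \<subseteq> W" "W \<subseteq> L"
    using locally_compact_space_compact_closed_compact bisection_locally_compact_Hausdorff[OF UB] by metis
  have L: "compact L" "L \<subseteq> U"
    using W(2) by (auto simp: compactin_subtopology)
  have "open W"
    using W(1) U openin_open_eq by blast
  have "completely_regular_space (top_of_set B)"
    using bisection_locally_compact_Hausdorff[OF B] locally_compact_regular_imp_completely_regular_space by blast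
  moreover have "compactin (top_of_set B) K"
    using K U by (auto simp: compactin_subtopology)
  moreover have "closedin (top_of_set B) (B - W)"
    using \<open>open W\<close> by (simp add: Diff_Int_distrib closedin_def openin_open_Int Diff_Diff_Int)
  ultimately obtain f :: "'g \<Rightarrow> real" where f: "continuous_map (top_of_set B) euclideanreal f"
      "f ` (B - W) \<subseteq> {0}" "f ` K \<subseteq> {1}"
    using Urysohn_completely_regular_compact_closed_alt[of "top_of_set B" K "B - W" 0 1] W(3)
    by (auto simp: disjnt_def)
  let ?\<phi> = "\<lambda>x. if x \<in> B then f x else 0"
  have "continuous_on B ?\<phi>"
    using f(1) by (simp cong: continuous_on_cong)
  moreover have "?\<phi> x = 1" if "x \<in> K" for x
    using that K U f(3) by auto
  moreover have "?\<phi> x = 0" if "x \<notin> L" for x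
    using that W f(2) by auto
  ultimately show ?thesis
    using that L by blast
qed

subsection \<open>Products of open sets and of bisections\<close>

text \<open>A factor in a bisection is determined by the domain of the product. This describes \<open>VB\<close> as a preimage
  of \<open>V\<close> under a continuous map with open domain, which makes it open.\<close>

lemma set_mult_bisection_eq:
  assumes "B \<in> local_bisections G"
  shows "set_mult V B = {k \<in> gdom G -` gdom G ` B. k \<cdot> ginv G (inv_into B (gdom G) (gdom G k)) \<in> V}"
proof (intro equalityI subsetI)
  fix k assume "k \<in> set_mult V B"
  then obtain v b where *: "k = v \<cdot> b" "v \<in> V" "b \<in> B" "gdom G v = grng G b"
    by (auto elim!: set_multE)
  then show "k \<in> {k \<in> gdom G -` gdom G ` B. k \<cdot> ginv G (inv_into B (gdom G) (gdom G k)) \<in> V}"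
    using bisectionD(2)[OF assms] by (simp add: cancel_mult_inv)
next
  fix k assume *: "k \<in> {k \<in> gdom G -` gdom G ` B. k \<cdot> ginv G (inv_into B (gdom G) (gdom G k)) \<in> V}"
  then obtain b where b: "b \<in> B" "gdom G k = gdom G b" by auto
  then have "k \<cdot> ginv G b \<in> V"
    using * bisectionD(2)[OF assms] by simp
  then have "(k \<cdot> ginv G b) \<cdot> b \<in> set_mult V B"
    using b by (intro set_multI) auto
  then show "k \<in> set_mult V B"
    using cancel_inv_mult b by simp
qed

lemma open_set_mult_bisection:
  assumes B: "B \<in> local_bisections G" and "open V" shows "open (set_mult V B)"
proof -
  let ?b = "\<lambda>k. inv_into B (gdom G) (gdom G k)"
  let ?S = "gdom G -` gdom G ` B"
  have S: "open ?S"
    using open_dom_vimage openin_dom_image bisectionD(1)[OF B] by blast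
  have b: "?b k \<in> B" "gdom G (?b k) = gdom G k" if "k \<in> ?S" for k
    using that bisectionD(2)[OF B] by auto
  have "continuous_on ?S (\<lambda>k. k \<cdot> ginv G (?b k))"
    unfolding continuous_on_def
  proof (rule ballI, rule tendsto_comp)
    fix k assume k: "k \<in> ?S"
    have ev: "\<forall>\<^sub>F x in at k within ?S. x \<in> ?S"
      by (simp add: eventually_at_filter)
    show "((\<lambda>k. ginv G (?b k)) \<longlongrightarrow> ginv G (?b k)) (at k within ?S)"
    proof (rule tendsto_inv, rule tendsto_bisection_dom[OF B])
      have "\<forall>\<^sub>F i in at k within ?S. gdom G (?b i) = gdom G i"
        using ev by eventually_elim (use b in simp)
      then show "((\<lambda>i. gdom G (?b i)) \<longlongrightarrow> gdom G (?b k)) (at k within ?S)"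
        using tendsto_dom[OF tendsto_ident_at[of k ?S]] b(2)[OF k] by (simp only: tendsto_cong)
      show "\<forall>\<^sub>F i in at k within ?S. ?b i \<in> B"
        using ev by eventually_elim (use b in blast)
    qed (use b k in blast)
    show "\<forall>\<^sub>F i in at k within ?S. gdom G i = grng G (ginv G (?b i))"
      using ev by eventually_elim (use b in simp)
  qed (use b in \<open>simp_all add: tendsto_ident_at\<close>)
  then have "open ((\<lambda>k. k \<cdot> ginv G (?b k)) -` V \<inter> ?S)"
    using S \<open>open V\<close> continuous_on_open_vimage[OF S] by blast
  then show ?thesis
    unfolding set_mult_bisection_eq[OF B] by (rule back_subst[where P = "open"]) blast
qed

lemma set_mult_bisection_cover:
  assumes "\<And>g. g \<in> V \<Longrightarrow> g \<in> B g \<and> B g \<subseteq> V"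
  shows "set_mult U V = (\<Union>g\<in>V. set_mult U (B g))"
  using assms unfolding set_mult_def by blast

lemma open_set_mult:
  assumes "open U" "open V" shows "open (set_mult U V)"
proof -
  have "\<forall>g. \<exists>B. g \<in> V \<longrightarrow> B \<in> local_bisections G \<and> g \<in> B \<and> B \<subseteq> V"
    using bisection_basis[OF assms(2)] by metis
  then obtain B where B: "\<And>g. g \<in> V \<Longrightarrow> B g \<in> local_bisections G \<and> g \<in> B g \<and> B g \<subseteq> V"
    by metis
  then have "set_mult U V = (\<Union>g\<in>V. set_mult U (B g))"
    by (intro set_mult_bisection_cover) blast
  then show ?thesis
    using B open_set_mult_bisection assms(1) by auto
qed

lemma bisection_set_mult:
  assumes A: "A \<in> local_bisections G" and B: "B \<in> local_bisections G"
  shows "set_mult A B \<in> local_bisections G"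
proof -
  have "inj_on (gdom G) (set_mult A B)"
  proof (rule inj_onI)
    fix k l assume "k \<in> set_mult A B" "l \<in> set_mult A B" and eq: "gdom G k = gdom G l"
    then obtain a b a' b' where *: "k = a \<cdot> b" "a \<in> A" "b \<in> B" "gdom G a = grng G b"
        "l = a' \<cdot> b'" "a' \<in> A" "b' \<in> B" "gdom G a' = grng G b'"
      by (auto elim!: set_multE)
    with eq have "b = b'" using inj_onD[OF bisectionD(2)[OF B], of b b'] by simp
    with * have "a = a'" using inj_onD[OF bisectionD(2)[OF A], of a a'] by simp
    with \<open>b = b'\<close> * show "k = l" by simp
  qed
  moreover have "inj_on (grng G) (set_mult A B)"
  proof (rule inj_onI)
    fix k l assume "k \<in> set_mult A B" "l \<in> set_mult A B" and eq: "grng G k = grng G l"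
    then obtain a b a' b' where *: "k = a \<cdot> b" "a \<in> A" "b \<in> B" "gdom G a = grng G b"
        "l = a' \<cdot> b'" "a' \<in> A" "b' \<in> B" "gdom G a' = grng G b'"
      by (auto elim!: set_multE)
    with eq have "a = a'" using inj_onD[OF bisectionD(3)[OF A], of a a'] by simp
    with * have "b = b'" using inj_onD[OF bisectionD(3)[OF B], of b b'] by simp
    with \<open>a = a'\<close> * show "k = l" by simp
  qed
  ultimately show ?thesis
    using open_set_mult[OF bisectionD(1)[OF A] bisectionD(1)[OF B]] by (simp add: local_bisections_def)
qed

text \<open>The product of compact sets is the image of the set of composable pairs. This set is compact because
  the unit space is Hausdorff; as \<open>K\<close> lies in a bisection, a pair is determined by its second
  component, so that it suffices to work inside \<open>L\<close>.\<close>

lemma compact_set_mult: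
  assumes A: "A \<in> local_bisections G" and K: "compact K" "K \<subseteq> A" and L: "compact L"
  shows "compact (set_mult K L)"
proof -
  have "compact (gdom G ` K)"
    using K continuous_dom compact_continuous_image by blast
  then have "closedin (top_of_set (gunits G)) (gdom G ` K)"
    by (intro compactin_imp_closedin[OF units_Hausdorff]) (auto simp: compactin_subtopology gunits_def)
  then obtain T where T: "closed T" "gdom G ` K = gunits G \<inter> T"
    by (auto simp: closedin_closed)
  define M where "M = {y \<in> L. grng G y \<in> gdom G ` K}"
  have M_eq: "M = L \<inter> (grng G -` T)"
    using T(2) range_rng by (auto simp: M_def)
  have "closed (grng G -` T)"
    using T(1) continuous_rng[of UNIV] by (simp add: continuous_on_closed_vimage)
  then have "compact M"
    unfolding M_eq using L by (simp add: compact_Int_closed)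
  let ?a = "\<lambda>y. inv_into A (gdom G) (grng G y)"
  have a: "?a y \<in> K" "gdom G (?a y) = grng G y" if y: "y \<in> M" for y
  proof -
    obtain x where "x \<in> K" "grng G y = gdom G x" using y by (auto simp: M_def)
    then show "?a y \<in> K" "gdom G (?a y) = grng G y"
      using K(2) bisectionD(2)[OF A] by auto
  qed
  have ev: "\<forall>\<^sub>F x in at y within M. x \<in> M" for y
    by (simp add: eventually_at_filter)
  have "continuous_on M (\<lambda>y. ?a y \<cdot> y)"
    unfolding continuous_on_def
  proof (rule ballI, rule tendsto_comp)
    fix y assume y: "y \<in> M"
    show "(?a \<longlongrightarrow> ?a y) (at y within M)"
    proof (rule tendsto_bisection_dom[OF A])
      have "\<forall>\<^sub>F i in at y within M. gdom G (?a i) = grng G i"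
        using ev by eventually_elim (use a in simp)
      then show "((\<lambda>i. gdom G (?a i)) \<longlongrightarrow> gdom G (?a y)) (at y within M)"
        using tendsto_rng[OF tendsto_ident_at[of y M]] a(2)[OF y] by (simp only: tendsto_cong)
      show "\<forall>\<^sub>F i in at y within M. ?a i \<in> A"
        using ev by eventually_elim (use a K in blast)
    qed (use a y K in blast)
    show "\<forall>\<^sub>F i in at y within M. gdom G (?a i) = grng G i"
      using ev by eventually_elim (use a in simp)
    show "gdom G (?a y) = grng G y"
      using a(2)[OF y] .
  qed (simp add: tendsto_ident_at)
  moreover have "set_mult K L = (\<lambda>y. ?a y \<cdot> y) ` M"
  proof (intro equalityI subsetI)
    fix k assume "k \<in> set_mult K L"
    then obtain x y where xy: "k = x \<cdot> y" "x \<in> K" "y \<in> L" "gdom G x = grng G y"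
      by (auto elim!: set_multE)
    then have "y \<in> M" by (auto simp: M_def) (metis imageI)
    moreover have "?a y = x"
      using xy K(2) bisectionD(2)[OF A] by (metis inv_into_f_eq subsetD)
    ultimately show "k \<in> (\<lambda>y. ?a y \<cdot> y) ` M"
      using xy by blast
  next
    fix k assume "k \<in> (\<lambda>y. ?a y \<cdot> y) ` M"
    then show "k \<in> set_mult K L"
      using a by (auto intro!: set_multI simp: M_eq)
  qed
  ultimately show ?thesis
    using \<open>compact M\<close> compact_continuous_image by metis
qed

end

section \<open>Quantales of sets ordered by inclusion\<close>

text \<open>Infima exist as joins of lower bounds.\<close>

lemma inclusion_complete_lattice:
  fixes Q :: "('b set, 'm) gorder_scheme"
  assumes eq: "eq Q = (=)" and le: "le Q = (\<subseteq>)"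
    and join_closed: "\<And>A. A \<subseteq> carrier Q \<Longrightarrow> J A \<in> carrier Q"
    and join_upper: "\<And>A. A \<subseteq> carrier Q \<Longrightarrow> \<Union>A \<subseteq> J A"
    and join_least: "\<And>A c. A \<subseteq> carrier Q \<Longrightarrow> c \<in> carrier Q \<Longrightarrow> \<Union>A \<subseteq> c \<Longrightarrow> J A \<subseteq> c"
  shows "complete_lattice Q" and "A \<subseteq> carrier Q \<Longrightarrow> \<Squnion>\<^bsub>Q\<^esub>A = J A"
proof -
  interpret partial_order Q
    by standard (auto simp: eq le)
  have least: "least Q (J A) (Upper Q A)" if "A \<subseteq> carrier Q" for A
  proof (rule least_UpperI)
    show "x \<sqsubseteq>\<^bsub>Q\<^esub> J A" if "x \<in> A" for x
      using that join_upper[OF \<open>A \<subseteq> carrier Q\<close>] by (auto simp: le)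
    show "J A \<sqsubseteq>\<^bsub>Q\<^esub> c" if "c \<in> Upper Q A" for c
      using that join_least[OF \<open>A \<subseteq> carrier Q\<close>, of c] \<open>A \<subseteq> carrier Q\<close> by (auto simp: le Upper_def)
  qed (use that join_closed in auto)
  have greatest: "greatest Q (J {c \<in> carrier Q. \<forall>a\<in>A. c \<subseteq> a}) (Lower Q A)" if "A \<subseteq> carrier Q" for A
  proof -
    let ?C = "{c \<in> carrier Q. \<forall>a\<in>A. c \<subseteq> a}"
    have "J ?C \<subseteq> a" if "a \<in> A" for a
      using that \<open>A \<subseteq> carrier Q\<close> by (intro join_least) auto
    then show ?thesis
      using join_closed[of ?C] join_upper[of ?C] that by (auto simp: greatest_def Lower_def le) blast
  qed
  show L: "complete_lattice Q"
    by standard (use least greatest in blast)+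
  show "\<Squnion>\<^bsub>Q\<^esub>A = J A" if "A \<subseteq> carrier Q"
  proof -
    interpret complete_lattice Q by (rule L)
    show ?thesis
      using least_unique[OF sup_lub[OF that] least[OF that]] .
  qed
qed

context etale_groupoid
begin

lemma carrier_Omega [simp]: "U \<in> carrier (Omega G) \<longleftrightarrow> open U"
  and qmult_Omega: "qmult (Omega G) U V = set_mult U V"
  and qstar_Omega: "qstar (Omega G) U = ginv G ` U"
  and le_Omega: "le (Omega G) U V \<longleftrightarrow> U \<subseteq> V"
  by (simp_all add: Omega_def set_mult_def composable_iff)

lemma Omega_complete_lattice: "complete_lattice (Omega G)"
  and Sup_Omega: "S \<subseteq> carrier (Omega G) \<Longrightarrow> \<Squnion>\<^bsub>Omega G\<^esub>S = \<Union>S"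
proof -
  show "complete_lattice (Omega G)"
    by (rule inclusion_complete_lattice[of _ Union]) (auto simp: Omega_def)
  show "S \<subseteq> carrier (Omega G) \<Longrightarrow> \<Squnion>\<^bsub>Omega G\<^esub>S = \<Union>S"
    by (rule inclusion_complete_lattice[of _ Union]) (auto simp: Omega_def)
qed

lemma set_mult_Union_right: "set_mult U (\<Union>S) = \<Union>(set_mult U ` S)"
  and set_mult_Union_left: "set_mult (\<Union>S) U = \<Union>((\<lambda>V. set_mult V U) ` S)"
  unfolding set_mult_def by blast+

lemma Omega_involutive_quantale: "involutive_quantale (Omega G)"
proof -
  interpret complete_lattice "Omega G" by (rule Omega_complete_lattice)
  show ?thesis
  proof (standard, goal_cases)
    case (4 a B)
    then have "set_mult a ` B \<subseteq> carrier (Omega G)"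
      by (auto intro!: open_set_mult)
    then show ?case
      using 4 by (simp add: Sup_Omega qmult_Omega set_mult_Union_right)
  next
    case (5 a B)
    then have "(\<lambda>b. set_mult b a) ` B \<subseteq> carrier (Omega G)"
      by (auto intro!: open_set_mult)
    then show ?case
      using 5 by (simp add: Sup_Omega qmult_Omega set_mult_Union_left)
  next
    case (7 B)
    then have "image (ginv G) ` B \<subseteq> carrier (Omega G)"
      by (auto intro!: open_inv_image)
    then show ?case
      using 7 by (simp add: Sup_Omega qstar_Omega image_Union)
  qed (auto simp: qmult_Omega qstar_Omega set_mult_assoc inv_set_mult image_image inv_inv
        intro!: open_set_mult open_inv_image)
qed

end

section \<open>Closed subspaces of a C*-algebra\<close>

lemma scaleC_scaleR: "c *\<^sub>C (r *\<^sub>R a) = r *\<^sub>R (c *\<^sub>C a)" for a :: "'a::cstar_algebra"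
  by (metis mult.commute scaleC_of_real scaleC_scaleC)

lemma bounded_linear_scaleC: "bounded_linear (\<lambda>a::'a::cstar_algebra. c *\<^sub>C a)"
  by (rule bounded_linear_intro[where K = "cmod c"])
     (simp_all add: scaleC_add_right scaleC_scaleR norm_scaleC mult.commute)

lemma norm_adj: "norm (adj a) = norm (a::'a::cstar_algebra)"
proof -
  have le: "norm b \<le> norm (adj b)" for b :: 'a
  proof (cases "b = 0")
    case False
    have "norm b * norm b \<le> norm (adj b) * norm b"
      using norm_mult_ineq[of "adj b" b] norm_adj_mult[of b] by (simp add: power2_eq_square)
    then show ?thesis using False by simp
  qed simp
  show ?thesis
    using le[of a] le[of "adj a"] by (simp add: adj_adj)
qed

lemma adj_scaleR: "adj (r *\<^sub>R a) = r *\<^sub>R adj (a::'a::cstar_algebra)"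
  using adj_scaleC[of "complex_of_real r" a] by (simp add: scaleC_of_real)

lemma bounded_linear_adj: "bounded_linear (adj :: 'a::cstar_algebra \<Rightarrow> 'a)"
  by (rule bounded_linear_intro[where K = 1]) (simp_all add: adj_add adj_scaleR norm_adj)

lemma csubspace_closure:
  fixes S :: "'a::cstar_algebra set"
  assumes "csubspace S" shows "csubspace (closure S)"
  unfolding cvec.subspace_def
proof (intro conjI ballI allI)
  show "0 \<in> closure S"
    using assms closure_subset cvec.subspace_0 by blast
  show "a + b \<in> closure S" if "a \<in> closure S" "b \<in> closure S" for a b
  proof -
    have "(\<lambda>b. a + b) ` closure S \<subseteq> closure S" if "a \<in> S" for a
      using that assms closure_subset[of S]
      by (intro image_closure_subset) (auto intro!: continuous_intros dest: cvec.subspace_add)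
    then have "(\<lambda>a. a + b) ` closure S \<subseteq> closure S"
      using that(2) by (intro image_closure_subset) (auto intro!: continuous_intros)
    then show ?thesis
      using that(1) by blast
  qed
  show "c *\<^sub>C a \<in> closure S" if "a \<in> closure S" for c a
  proof -
    have "(\<lambda>a. c *\<^sub>C a) ` closure S \<subseteq> closure S"
      using assms closure_subset[of S]
      by (intro image_closure_subset linear_continuous_on[OF bounded_linear_scaleC])
         (auto dest: cvec.subspace_scale)
    then show ?thesis
      using that by blast
  qed
qed

definition clspan :: "'a::cstar_algebra set \<Rightarrow> 'a set" where
  "clspan X = closure (cspan X)"

lemma clspan_superset: "X \<subseteq> clspan X"
  unfolding clspan_def using closure_subset cvec.span_superset by blast

lemma clspan_closed [simp]: "closed (clspan X)" and clspan_subspace [simp]: "csubspace (clspan X)"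
  by (simp_all add: clspan_def csubspace_closure cvec.subspace_span)

lemma clspan_minimal: "X \<subseteq> W \<Longrightarrow> closed W \<Longrightarrow> csubspace W \<Longrightarrow> clspan X \<subseteq> W"
  by (simp add: clspan_def closure_minimal cvec.span_minimal)

lemma clspan_mono: "X \<subseteq> Y \<Longrightarrow> clspan X \<subseteq> clspan Y"
  using clspan_superset by (intro clspan_minimal) auto

lemma clspan_eq: "closed W \<Longrightarrow> csubspace W \<Longrightarrow> clspan W = W"
  by (simp add: clspan_minimal clspan_superset subset_antisym)

text \<open>Multiplication is separately linear and continuous, so that a bound on products of generators extends
  first in one factor and then in the other.\<close>

lemma clspan_mult_in:
  assumes XY: "\<And>x y. x \<in> X \<Longrightarrow> y \<in> Y \<Longrightarrow> x * y \<in> W" and W: "closed W" "csubspace W"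
    and a: "a \<in> clspan X" and b: "b \<in> clspan Y"
  shows "a * b \<in> W"
proof -
  have left: "a * y \<in> W" if "y \<in> Y" for y
  proof -
    have "closed ((\<lambda>a. a * y) -` W)"
      using W(1) by (intro closed_vimage continuous_intros) auto
    moreover have "csubspace ((\<lambda>a. a * y) -` W)"
      using W(2) by (auto simp: cvec.subspace_def distrib_right mult_scaleC_left)
    moreover have "X \<subseteq> (\<lambda>a. a * y) -` W"
      using XY that by auto
    ultimately show ?thesis
      using clspan_minimal a by blast
  qed
  have "closed ((\<lambda>b. a * b) -` W)"
    using W(1) by (intro closed_vimage continuous_intros) auto
  moreover have "csubspace ((\<lambda>b. a * b) -` W)"
    using W(2) by (auto simp: cvec.subspace_def distrib_left mult_scaleC_right)
  moreover have "Y \<subseteq> (\<lambda>b. a * b) -` W"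
    using left by auto
  ultimately show ?thesis
    using clspan_minimal b by blast
qed

lemma adj_clspan:
  fixes X :: "'a::cstar_algebra set"
  shows "adj ` clspan X = clspan (adj ` X)"
proof -
  have adj_0: "adj 0 = (0 :: 'a)"
    by (rule linear_simps(3)[OF bounded_linear_adj])
  have "adj ` clspan X \<subseteq> clspan (adj ` X)" for X :: "'a set"
  proof -
    have "closed (adj -` clspan (adj ` X))"
      by (intro closed_vimage linear_continuous_on[OF bounded_linear_adj]) simp
    moreover have "csubspace (adj -` clspan (adj ` X))"
      using clspan_subspace[of "adj ` X"] adj_0
      by (auto simp: cvec.subspace_def adj_add adj_scaleC)
    moreover have "X \<subseteq> adj -` clspan (adj ` X)"
      using clspan_superset[of "adj ` X"] by blast
    ultimately show ?thesis
      using clspan_minimal by blast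
  qed
  note le = this
  have "adj ` clspan (adj ` X) \<subseteq> clspan X"
    using le[of "adj ` X"] by (simp add: image_image adj_adj)
  then have "clspan (adj ` X) \<subseteq> adj ` clspan X"
    using image_mono[of "adj ` clspan (adj ` X)" "clspan X" adj] by (simp add: image_image adj_adj)
  with le show ?thesis by blast
qed

section \<open>The quantale of closed subspaces\<close>

lemma carrier_Max: "V \<in> carrier Max_quantale \<longleftrightarrow> closed V \<and> csubspace V"
  by (simp add: Max_quantale_def)

lemma clspan_in_Max [simp]: "clspan X \<in> carrier Max_quantale"
  by (simp add: carrier_Max)

lemma qmult_Max: "qmult Max_quantale V W = clspan {a * b |a b. a \<in> V \<and> b \<in> W}"
  by (simp add: Max_quantale_def clspan_def)

lemma qstar_Max: "qstar Max_quantale V = adj ` V"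
  by (simp add: Max_quantale_def)

text \<open>Products of closed spans can be computed on generators; the quantale laws follow from this.\<close>

lemma qmult_clspan: "qmult Max_quantale (clspan X) (clspan Y) = clspan {x * y |x y. x \<in> X \<and> y \<in> Y}"
proof -
  let ?P = "{x * y |x y. x \<in> X \<and> y \<in> Y}"
  have "x * y \<in> clspan ?P" if "x \<in> X" "y \<in> Y" for x y
    using that by (intro subsetD[OF clspan_superset]) blast
  then have "a * b \<in> clspan ?P" if "a \<in> clspan X" "b \<in> clspan Y" for a b
    using clspan_mult_in[of X Y "clspan ?P" a b] that by simp
  then have "{a * b |a b. a \<in> clspan X \<and> b \<in> clspan Y} \<subseteq> clspan ?P"
    by blast
  moreover have "?P \<subseteq> {a * b |a b. a \<in> clspan X \<and> b \<in> clspan Y}"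
    using clspan_superset[of X] clspan_superset[of Y] by blast
  ultimately show ?thesis
    unfolding qmult_Max by (intro equalityI clspan_minimal clspan_mono) simp_all
qed

lemma Max_complete_lattice: "complete_lattice (Max_quantale :: 'a::cstar_algebra set quantale_str)"
  by (rule inclusion_complete_lattice[of _ "\<lambda>S. clspan (\<Union>S)"])
     (simp_all add: Max_quantale_def clspan_superset clspan_minimal)

lemma Sup_Max: "S \<subseteq> carrier Max_quantale \<Longrightarrow> \<Squnion>\<^bsub>Max_quantale\<^esub>S = clspan (\<Union>S)"
  by (rule inclusion_complete_lattice[of _ "\<lambda>S. clspan (\<Union>S)"])
     (simp_all add: Max_quantale_def clspan_superset clspan_minimal)

lemma clspan_Union: "clspan (\<Union>i\<in>I. clspan (X i)) = clspan (\<Union>i\<in>I. X i)"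
proof (intro equalityI clspan_minimal clspan_mono)
  show "(\<Union>i\<in>I. clspan (X i)) \<subseteq> clspan (\<Union>i\<in>I. X i)"
    by (intro UN_least clspan_mono) blast
  show "(\<Union>i\<in>I. X i) \<subseteq> clspan (\<Union>i\<in>I. clspan (X i))"
    using clspan_superset[of "\<Union>i\<in>I. clspan (X i)"] clspan_superset[of "X _"] by blast
qed simp_all

lemma Sup_clspan: "\<Squnion>\<^bsub>Max_quantale\<^esub>((\<lambda>i. clspan (X i)) ` I) = clspan (\<Union>i\<in>I. X i)"
  by (simp add: Sup_Max clspan_Union image_subset_iff)

lemma Max_eq_clspan: "V \<in> carrier Max_quantale \<Longrightarrow> clspan V = V"
  by (simp add: carrier_Max clspan_eq)

lemma Max_involutive_quantale:
  "involutive_quantale (Max_quantale :: 'a::cstar_algebra set quantale_str)"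
proof -
  interpret complete_lattice "Max_quantale :: 'a set quantale_str" by (rule Max_complete_lattice)
  show ?thesis
  proof (standard, goal_cases)
    case (1 a b)
    then show ?case by (simp add: qmult_Max)
  next
    case (2 a)
    then show ?case
      using adj_clspan[of a] clspan_in_Max by (metis Max_eq_clspan qstar_Max)
  next
    case (3 a b c)
    have "qmult Max_quantale (qmult Max_quantale (clspan a) (clspan b)) (clspan c)
        = qmult Max_quantale (clspan a) (qmult Max_quantale (clspan b) (clspan c))"
      unfolding qmult_clspan
    proof (rule arg_cong[where f = clspan], intro equalityI subsetI)
      fix z assume "z \<in> {x * y |x y. x \<in> {x * y |x y. x \<in> a \<and> y \<in> b} \<and> y \<in> c}"
      then obtain x y w where "z = (x * y) * w" "x \<in> a" "y \<in> b" "w \<in> c" by blast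
      then show "z \<in> {x * y |x y. x \<in> a \<and> y \<in> {x * y |x y. x \<in> b \<and> y \<in> c}}"
        unfolding mult.assoc by blast
    next
      fix z assume "z \<in> {x * y |x y. x \<in> a \<and> y \<in> {x * y |x y. x \<in> b \<and> y \<in> c}}"
      then obtain x y w where "z = x * (y * w)" "x \<in> a" "y \<in> b" "w \<in> c" by blast
      then show "z \<in> {x * y |x y. x \<in> {x * y |x y. x \<in> a \<and> y \<in> b} \<and> y \<in> c}"
        unfolding mult.assoc[symmetric] by blast
    qed
    then show ?case using 3 by (simp add: Max_eq_clspan)
  next
    case (4 a B)
    have "qmult Max_quantale a ` B = (\<lambda>b. clspan {x * y |x y. x \<in> a \<and> y \<in> b}) ` B"
      by (simp add: qmult_Max)
    moreover have "qmult Max_quantale (clspan a) (clspan (\<Union>B)) = clspan (\<Union>b\<in>B. {x * y |x y. x \<in> a \<and> y \<in> b})"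
      unfolding qmult_clspan by (rule arg_cong[where f = clspan]) blast
    ultimately show ?case using 4 by (simp add: Max_eq_clspan Sup_clspan) (simp add: Sup_Max)
  next
    case (5 a B)
    have "(\<lambda>b. qmult Max_quantale b a) ` B = (\<lambda>b. clspan {x * y |x y. x \<in> b \<and> y \<in> a}) ` B"
      by (simp add: qmult_Max)
    moreover have "qmult Max_quantale (clspan (\<Union>B)) (clspan a) = clspan (\<Union>b\<in>B. {x * y |x y. x \<in> b \<and> y \<in> a})"
      unfolding qmult_clspan by (rule arg_cong[where f = clspan]) blast
    ultimately show ?case using 5 by (simp add: Max_eq_clspan Sup_clspan) (simp add: Sup_Max)
  next
    case (6 a)
    then show ?case by (simp add: qstar_Max image_image adj_adj)
  next
    case (7 B)
    have "qstar Max_quantale ` B \<subseteq> carrier Max_quantale"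
      using 7 adj_clspan clspan_in_Max by (metis (no_types, lifting) Max_eq_clspan image_subsetI qstar_Max subsetD)
    then show ?case
      using 7 by (simp add: Sup_Max) (simp add: qstar_Max adj_clspan image_Union)
  next
    case (8 a b)
    show ?case
      unfolding qmult_Max qstar_Max adj_clspan
      by (rule arg_cong[where f = clspan]) (force simp: adj_mult)
  qed
qed

section \<open>Banach bundles\<close>

lemma continuous_on_open_tendsto_nhds:
  assumes "continuous_on N f" "open N" "x \<in> N" shows "(f \<longlongrightarrow> f x) (nhds x)"
proof (rule topological_tendstoI)
  fix V assume "open V" "f x \<in> V"
  then have "open (f -` V \<inter> N)" "x \<in> f -` V \<inter> N"
    using assms continuous_on_open_vimage by blast+
  then show "\<forall>\<^sub>F y in nhds x. f y \<in> V"
    unfolding eventually_nhds by blast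
qed

context banach_bundle
begin

lemma fibre_group_simps [simp]:
  "carrier (fibre_group E x) = fibre E x" "mult (fibre_group E x) = badd E"
  "one (fibre_group E x) = bzero E x"
  by (simp_all add: fibre_group_def)

lemma proj_bzero [simp]: "proj E (bzero E x) = x"
proof -
  interpret comm_group "fibre_group E x" by (rule fibre_comm_group)
  show ?thesis using one_closed by (simp add: fibre_def)
qed

lemma proj_bscale [simp]: "proj E (bscale E c e) = proj E e"
  by (rule scale_closed)

lemma proj_badd [simp]: "proj E e = proj E f \<Longrightarrow> proj E (badd E e f) = proj E f"
proof -
  assume *: "proj E e = proj E f"
  interpret comm_group "fibre_group E (proj E f)" by (rule fibre_comm_group)
  show ?thesis using m_closed[of e f] * by (simp add: fibre_def)
qed

lemma badd_zero_right [simp]: "proj E e = x \<Longrightarrow> badd E e (bzero E x) = e"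
  and badd_zero_left [simp]: "proj E e = x \<Longrightarrow> badd E (bzero E x) e = e"
proof -
  interpret comm_group "fibre_group E (proj E e)" by (rule fibre_comm_group)
  show "proj E e = x \<Longrightarrow> badd E e (bzero E x) = e" "proj E e = x \<Longrightarrow> badd E (bzero E x) e = e"
    using r_one[of e] l_one[of e] by (auto simp: fibre_def)
qed

lemma bnorm_zero [simp]: "bnorm E (bzero E x) = 0"
  using norm_eq_zero[of "bzero E x"] by simp

lemma bnorm_eq_zero: "proj E e = x \<Longrightarrow> bnorm E e = 0 \<longleftrightarrow> e = bzero E x"
  by (metis norm_eq_zero)

lemma bnorm_pos: "0 < bnorm E e \<longleftrightarrow> e \<noteq> bzero E (proj E e)"
  by (metis less_le norm_eq_zero norm_nonneg)

lemma bscale_zero_left [simp]: "bscale E 0 e = bzero E (proj E e)"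
  using bnorm_eq_zero[of "bscale E 0 e" "proj E e"] by (simp add: norm_scale)

lemma bscale_zero_right [simp]: "bscale E c (bzero E x) = bzero E x"
  using bnorm_eq_zero[of "bscale E c (bzero E x)" x] by (simp add: norm_scale)

lemma bscale_eq_zero: "bscale E c e = bzero E (proj E e) \<longleftrightarrow> c = 0 \<or> e = bzero E (proj E e)"
  using bnorm_eq_zero[of "bscale E c e" "proj E e"] bnorm_eq_zero[of e "proj E e"]
  by (simp add: norm_scale)

lemma bscale_minus: "badd E e (bscale E (- 1) e) = bzero E (proj E e)"
  using scale_add_left[of 1 "- 1" e] by (simp add: scale_one)

lemma bscale_cancel:
  assumes "bscale E c e = bscale E d e" "e \<noteq> bzero E (proj E e)" shows "c = d"
proof -
  have "bscale E (c - d) e = badd E (bscale E d e) (bscale E (- 1) (bscale E d e))"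
    using scale_add_left[of c "- d" e] assms(1) by (simp add: scale_scale)
  then have "bscale E (c - d) e = bzero E (proj E e)"
    by (simp add: bscale_minus)
  then show ?thesis
    using assms(2) bscale_eq_zero by simp
qed

lemma tendsto_proj: "(f \<longlongrightarrow> e) F \<Longrightarrow> ((\<lambda>i. proj E (f i)) \<longlongrightarrow> proj E e) F"
  using continuous_on_tendsto_compose[OF proj_continuous] by auto

lemma tendsto_badd:
  assumes "(f \<longlongrightarrow> a) F" "(h \<longlongrightarrow> b) F" "\<forall>\<^sub>F i in F. proj E (f i) = proj E (h i)" "proj E a = proj E b"
  shows "((\<lambda>i. badd E (f i) (h i)) \<longlongrightarrow> badd E a b) F"
proof -
  have "((\<lambda>i. (\<lambda>(e, f). badd E e f) (f i, h i)) \<longlongrightarrow> (\<lambda>(e, f). badd E e f) (a, b)) F"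
    by (rule continuous_on_tendsto_compose[OF add_continuous])
       (use assms in \<open>auto intro: tendsto_Pair\<close>)
  then show ?thesis by simp
qed

lemma tendsto_bnorm_zero:
  assumes "(f \<longlongrightarrow> bzero E x) F" shows "((\<lambda>i. bnorm E (f i)) \<longlongrightarrow> 0) F"
proof (rule tendstoI)
  fix r :: real assume "0 < r"
  then have "\<forall>\<^sub>F i in F. f i \<in> {e. bnorm E e < r}"
    by (intro topological_tendstoD[OF assms] norm_upper_semicontinuous) simp
  then show "\<forall>\<^sub>F i in F. dist (bnorm E (f i)) 0 < r"
    by (simp add: norm_nonneg)
qed

lemma tendsto_bzeroI:
  assumes "((\<lambda>i. proj E (f i)) \<longlongrightarrow> x) F" "((\<lambda>i. bnorm E (f i)) \<longlongrightarrow> 0) F"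
  shows "(f \<longlongrightarrow> bzero E x) F"
proof (rule topological_tendstoI)
  fix V assume "open V" "bzero E x \<in> V"
  then obtain \<epsilon> U where U: "\<epsilon> > 0" "open U" "x \<in> U" "{e. proj E e \<in> U \<and> bnorm E e < \<epsilon>} \<subseteq> V"
    using zero_neighbourhoods by blast
  have "\<forall>\<^sub>F i in F. proj E (f i) \<in> U" "\<forall>\<^sub>F i in F. bnorm E (f i) < \<epsilon>"
    using topological_tendstoD[OF assms(1)] order_tendstoD(2)[OF assms(2)] U by auto
  then show "\<forall>\<^sub>F i in F. f i \<in> V"
    by eventually_elim (use U(4) in blast)
qed

text \<open>Scalar multiplication is jointly continuous, although only continuity in the vector is assumed:
  in \<open>c f = c\<^sub>0 f + (c - c\<^sub>0) f\<close> the last term tends to zero because the norm is locally bounded.\<close>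

lemma tendsto_bscale:
  assumes c: "(c \<longlongrightarrow> c0) F" and f: "(f \<longlongrightarrow> e) F"
  shows "((\<lambda>i. bscale E (c i) (f i)) \<longlongrightarrow> bscale E c0 e) F"
proof -
  have eq: "bscale E (c i) (f i) = badd E (bscale E c0 (f i)) (bscale E (c i - c0) (f i))" for i
    using scale_add_left[of c0 "c i - c0"] by simp
  have "((\<lambda>i. bscale E c0 (f i)) \<longlongrightarrow> bscale E c0 e) F"
    using continuous_on_tendsto_compose[OF scale_continuous f] by simp
  moreover have "((\<lambda>i. bscale E (c i - c0) (f i)) \<longlongrightarrow> bzero E (proj E e)) F"
  proof (rule tendsto_bzeroI)
    show "((\<lambda>i. proj E (bscale E (c i - c0) (f i))) \<longlongrightarrow> proj E e) F"
      using tendsto_proj[OF f] by simp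
    have "\<forall>\<^sub>F i in F. f i \<in> {a. bnorm E a < bnorm E e + 1}"
      by (intro topological_tendstoD[OF f] norm_upper_semicontinuous) simp
    then have "\<forall>\<^sub>F i in F. norm (bnorm E (bscale E (c i - c0) (f i))) \<le> cmod (c i - c0) * (bnorm E e + 1)"
      by eventually_elim (auto simp: norm_scale norm_nonneg intro!: mult_left_mono)
    moreover have "((\<lambda>i. cmod (c i - c0) * (bnorm E e + 1)) \<longlongrightarrow> 0) F"
      using c by (intro tendsto_mult_left_zero tendsto_norm_zero) (simp add: LIM_zero)
    ultimately show "((\<lambda>i. bnorm E (bscale E (c i - c0) (f i))) \<longlongrightarrow> 0) F"
      by (rule Lim_null_comparison)
  qed
  ultimately have "((\<lambda>i. badd E (bscale E c0 (f i)) (bscale E (c i - c0) (f i)))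
      \<longlongrightarrow> badd E (bscale E c0 e) (bzero E (proj E e))) F"
    by (rule tendsto_badd) simp_all
  then show ?thesis
    using eq by simp
qed

lemma continuous_on_bscale:
  "continuous_on S c \<Longrightarrow> continuous_on S f \<Longrightarrow> continuous_on S (\<lambda>x. bscale E (c x) (f x))"
  unfolding continuous_on_def by (auto intro: tendsto_bscale)

text \<open>The total space is Hausdorff over a Hausdorff open set, so that a nonzero element can be separated from
  zero, and neighbourhoods of zero are measured by the norm. Upper semicontinuity of the norm
  gives no such lower bound.\<close>

lemma bnorm_bounded_below:
  assumes "e \<noteq> bzero E (proj E e)"
  obtains \<epsilon> where "\<epsilon> > 0" "\<forall>\<^sub>F f in nhds e. \<epsilon> \<le> bnorm E f"
proof -
  obtain U where U: "open U" "proj E e \<in> U" "Hausdorff_space (top_of_set U)"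
    using base_locally_Hausdorff by blast
  let ?P = "proj E -` U"
  have P: "open ?P"
    using U(1) proj_continuous by (simp add: continuous_on_open_vimage)
  have "Hausdorff_space (top_of_set ?P)"
    using Hausdorff_over U by blast
  then obtain W1 W2 where W: "openin (top_of_set ?P) W1" "openin (top_of_set ?P) W2"
      "e \<in> W1" "bzero E (proj E e) \<in> W2" "disjnt W1 W2"
    unfolding Hausdorff_space_def using assms U(2) by (metis (no_types, lifting) proj_bzero topspace_euclidean_subtopology vimageI)
  then have o: "open W1" "open W2"
    using P openin_open_eq by blast+
  obtain \<epsilon> U' where U': "\<epsilon> > 0" "open U'" "proj E e \<in> U'" "{f. proj E f \<in> U' \<and> bnorm E f < \<epsilon>} \<subseteq> W2"
    using zero_neighbourhoods[OF o(2) W(4)] by blast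
  have "\<forall>\<^sub>F f in nhds e. f \<in> W1" "\<forall>\<^sub>F f in nhds e. proj E f \<in> U'"
    using o(1) W(3) topological_tendstoD[OF tendsto_proj[OF filterlim_ident] U'(2,3)]
    by (auto simp: eventually_nhds)
  then have "\<forall>\<^sub>F f in nhds e. \<epsilon> \<le> bnorm E f"
    by eventually_elim (use U'(4) W(5) in \<open>force simp: disjnt_iff\<close>)
  with U'(1) show ?thesis
    using that by blast
qed

text \<open>The projection is open: a function on the base is continuous if its composite with the projection is.\<close>

lemma tendsto_nhds_descend:
  assumes "((\<lambda>f. u (proj E f)) \<longlongrightarrow> l) (nhds e)" shows "(u \<longlongrightarrow> l) (nhds (proj E e))"
proof (rule topological_tendstoI)
  fix V assume "open V" "l \<in> V"
  then obtain S where "open S" "e \<in> S" "\<forall>f\<in>S. u (proj E f) \<in> V"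
    using topological_tendstoD[OF assms] by (auto simp: eventually_nhds)
  then show "\<forall>\<^sub>F x in nhds (proj E e). u x \<in> V"
    unfolding eventually_nhds using proj_open[of S] by (intro exI[of _ "proj E ` S"]) auto
qed

end

section \<open>Fell line bundles\<close>

context fell_bundle
begin

lemma proj_bmult [simp]:
  "gdom G (proj E e) = grng G (proj E f) \<Longrightarrow> proj E (bmult E e f) = proj E e \<cdot>\<^bsub>G\<^esub> proj E f"
  using proj_mult by (simp add: composable_iff)

lemma proj_bstar [simp]: "proj E (bstar E e) = ginv G (proj E e)"
  by (rule proj_star)

lemma bmult_zero_left [simp]:
  assumes "gdom G g = grng G (proj E f)"
  shows "bmult E (bzero E g) f = bzero E (g \<cdot>\<^bsub>G\<^esub> proj E f)"
  using norm_mult[of "bzero E g" f] norm_nonneg[of "bmult E (bzero E g) f"] assms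
  by (intro bnorm_eq_zero[THEN iffD1]) (auto simp: composable_iff)

lemma bmult_zero_right [simp]:
  assumes "gdom G (proj E f) = grng G g"
  shows "bmult E f (bzero E g) = bzero E (proj E f \<cdot>\<^bsub>G\<^esub> g)"
  using norm_mult[of f "bzero E g"] norm_nonneg[of "bmult E f (bzero E g)"] assms
  by (intro bnorm_eq_zero[THEN iffD1]) (auto simp: composable_iff)

lemma bstar_zero [simp]: "bstar E (bzero E g) = bzero E (ginv G g)"
  by (intro bnorm_eq_zero[THEN iffD1]) (auto simp: norm_star)

lemma tendsto_bmult:
  assumes "(f \<longlongrightarrow> a) F" "(h \<longlongrightarrow> b) F"
    "\<forall>\<^sub>F i in F. gdom G (proj E (f i)) = grng G (proj E (h i))" "gdom G (proj E a) = grng G (proj E b)"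
  shows "((\<lambda>i. bmult E (f i) (h i)) \<longlongrightarrow> bmult E a b) F"
proof -
  have "((\<lambda>i. (\<lambda>(e, f). bmult E e f) (f i, h i)) \<longlongrightarrow> (\<lambda>(e, f). bmult E e f) (a, b)) F"
    by (rule continuous_on_tendsto_compose[OF mult_continuous])
       (use assms in \<open>auto simp: composable_iff intro: tendsto_Pair\<close>)
  then show ?thesis by simp
qed

lemma tendsto_bstar: "(f \<longlongrightarrow> a) F \<Longrightarrow> ((\<lambda>i. bstar E (f i)) \<longlongrightarrow> bstar E a) F"
  using continuous_on_tendsto_compose[OF star_continuous] by auto

lemma bmult_assoc:
  "gdom G (proj E d) = grng G (proj E e) \<Longrightarrow> gdom G (proj E e) = grng G (proj E f) \<Longrightarrow>
    bmult E (bmult E d e) f = bmult E d (bmult E e f)"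
  using mult_assoc by (simp add: composable_iff)

lemma bmult_bscale_left:
  "gdom G (proj E e) = grng G (proj E f) \<Longrightarrow> bmult E (bscale E c e) f = bscale E c (bmult E e f)"
  using mult_scale_left by (simp add: composable_iff)

lemma bmult_bscale_right:
  "gdom G (proj E e) = grng G (proj E f) \<Longrightarrow> bmult E e (bscale E c f) = bscale E c (bmult E e f)"
  using mult_scale_right by (simp add: composable_iff)

end

context fell_line_bundle
begin

lemma fibre_spanned:
  assumes "proj E e = proj E f" "e \<noteq> bzero E (proj E e)"
  obtains c where "f = bscale E c e"
proof -
  obtain b where b: "proj E b = proj E e" "\<And>f. proj E f = proj E e \<Longrightarrow> \<exists>c. f = bscale E c b"
    using one_dimensional[of "proj E e"] by (auto simp: fibre_def)
  obtain c d where c: "e = bscale E c b" and d: "f = bscale E d b"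
    using b(2) assms(1) by metis
  have "c \<noteq> 0"
    using assms(2) c by auto
  then have "f = bscale E (d / c) e"
    by (simp add: c d scale_scale)
  then show ?thesis
    using that by blast
qed

text \<open>The fibre over a unit is the C*-algebra of complex numbers, and \<open>e\<^sup>*e\<close> is positive in it,
  hence \<open>\<parallel>e\<parallel>\<^sup>2\<close> times its unit.\<close>

lemma bmult_star_mult:
  assumes "gdom G (proj E f) = gdom G (proj E e)"
  shows "bmult E f (bmult E (bstar E e) e) = bscale E (complex_of_real ((bnorm E e)\<^sup>2)) f"
proof -
  define a where "a = bmult E (bstar E e) e"
  define x where "x = gdom G (proj E e)"
  have pa: "proj E a = x"
    by (simp add: a_def x_def inv_mult_self)
  have na: "bnorm E a = (bnorm E e)\<^sup>2"
    by (simp add: a_def norm_star_mult)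
  have sa: "bstar E a = a"
    unfolding a_def by (subst star_mult) (simp_all add: composable_iff star_star)
  have x [simp]: "gdom G x = x" "grng G x = x"
    by (simp_all add: x_def)
  have df: "gdom G (proj E f) = x"
    using assms by (simp add: x_def)
  consider "f = bzero E (proj E f)" | "e = bzero E (proj E e)"
    | "f \<noteq> bzero E (proj E f)" "e \<noteq> bzero E (proj E e)" by blast
  then show ?thesis
  proof cases
    case 1
    have "bmult E (bzero E (proj E f)) a = bzero E (proj E f \<cdot>\<^bsub>G\<^esub> x)"
      using df pa by simp
    also have "proj E f \<cdot>\<^bsub>G\<^esub> x = proj E f"
      using comp_dom[of "proj E f"] df by simp
    finally show ?thesis
      using 1 unfolding a_def by (metis bscale_zero_right)
  next
    case 2
    then have "bnorm E e = 0"
      using norm_eq_zero by blast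
    then have "a = bzero E x"
      using na bnorm_eq_zero[OF pa] by simp
    then have "bmult E f a = bzero E (proj E f)"
      using df comp_dom[of "proj E f"] by simp
    then show ?thesis
      unfolding a_def[symmetric] by (simp add: \<open>bnorm E e = 0\<close>)
  next
    case 3
    then have ne: "bnorm E e \<noteq> 0" and nf: "bnorm E f \<noteq> 0"
      using norm_eq_zero by blast+
    then have a0: "a \<noteq> bzero E (proj E a)"
      using na norm_eq_zero[of a] by simp
    obtain b where b: "proj E b = x" "a = bmult E (bstar E b) b"
      using star_mult_positive[of e] by (auto simp: fibre_positive_def fibre_def a_def x_def)
    obtain t where t: "b = bscale E t a"
      using fibre_spanned[of a b] a0 pa b(1) by auto
    \<comment> \<open>positivity makes the scalar in \<open>a\<^sup>2 = c a\<close> positive, hence equal to \<open>\<parallel>a\<parallel>\<close>\<close>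
    have aa: "a = bscale E (cnj t * t) (bmult E a a)"
      using b(2) pa unfolding t
      by (simp add: star_scale bmult_bscale_left bmult_bscale_right scale_scale sa mult.commute)
    have "bnorm E (bmult E a a) = (bnorm E a)\<^sup>2"
      using norm_star_mult[of a] by (simp add: sa)
    then have "bnorm E a = (cmod t)\<^sup>2 * (bnorm E a)\<^sup>2"
      using arg_cong[OF aa, of "bnorm E"] by (simp add: norm_scale Real_Vector_Spaces.norm_mult power2_eq_square)
    then have "1 = (cmod t)\<^sup>2 * (bnorm E e)\<^sup>2"
      using ne unfolding na by (simp add: power2_eq_square)
    moreover have "cnj t * t = complex_of_real ((cmod t)\<^sup>2)"
      by (metis complex_norm_square mult.commute of_real_power)
    ultimately have "complex_of_real ((bnorm E e)\<^sup>2) * (cnj t * t) = 1"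
      by (metis mult.commute of_real_1 of_real_mult)
    then have aa': "bmult E a a = bscale E (complex_of_real ((bnorm E e)\<^sup>2)) a"
      using arg_cong[OF aa, of "bscale E (complex_of_real ((bnorm E e)\<^sup>2))"]
      by (simp add: scale_scale scale_one)
    have pfa: "proj E (bmult E f a) = proj E f"
      using df pa comp_dom[of "proj E f"] by simp
    obtain c where c: "bmult E f a = bscale E c f"
      using fibre_spanned[of f "bmult E f a"] 3(1) pfa by auto
    define h where "h = bmult E (bstar E f) f"
    have ph: "proj E h = x"
      by (simp add: h_def df inv_mult_self)
    have h0: "h \<noteq> bzero E (proj E h)"
      using nf norm_eq_zero[of h] by (simp add: h_def norm_star_mult)
    obtain s where s: "a = bscale E s h"
      using fibre_spanned[of h a] h0 ph pa by auto
    have "s \<noteq> 0"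
      using s a0 by auto
    have "bmult E h a = bscale E c h"
      unfolding h_def using c df pa
      by (subst bmult_assoc) (simp_all add: bmult_bscale_right)
    have "bmult E a a = bmult E (bscale E s h) a"
      using s by simp
    also have "\<dots> = bscale E s (bscale E c h)"
      using ph pa \<open>bmult E h a = bscale E c h\<close> by (simp add: bmult_bscale_left)
    also have "\<dots> = bscale E c a"
      by (simp add: s scale_scale mult.commute)
    finally have "bmult E a a = bscale E c a" .
    then have "c = complex_of_real ((bnorm E e)\<^sup>2)"
      using aa' a0 bscale_cancel by metis
    then show ?thesis
      using c by (simp add: a_def)
  qed
qed

text \<open>If \<open>ef = 0\<close> then \<open>\<parallel>f\<parallel>\<^sup>2e = eff\<^sup>* = 0\<close>.\<close>

lemma bmult_nonzero:
  assumes "gdom G (proj E e) = grng G (proj E f)"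
    and "e \<noteq> bzero E (proj E e)" "f \<noteq> bzero E (proj E f)"
  shows "bmult E e f \<noteq> bzero E (proj E e \<cdot>\<^bsub>G\<^esub> proj E f)"
proof
  assume 0: "bmult E e f = bzero E (proj E e \<cdot>\<^bsub>G\<^esub> proj E f)"
  have "bmult E e (bmult E f (bstar E f)) = bscale E (complex_of_real ((bnorm E f)\<^sup>2)) e"
    using bmult_star_mult[of e "bstar E f"] assms(1) by (simp add: star_star norm_star)
  moreover have "bmult E e (bmult E f (bstar E f)) = bmult E (bmult E e f) (bstar E f)"
    using assms(1) by (subst bmult_assoc) simp_all
  moreover have "\<dots> = bzero E (proj E e)"
    using assms(1) by (simp add: 0 cancel_mult_inv)
  ultimately have "bscale E (complex_of_real ((bnorm E f)\<^sup>2)) e = bzero E (proj E e)"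
    by simp
  then show False
    using assms(2,3) bscale_eq_zero norm_eq_zero by auto
qed

text \<open>The norm of a Banach bundle is only upper semicontinuous. Here lower semicontinuity follows
  from the continuity of \<open>f \<mapsto> ff\<^sup>*f = \<parallel>f\<parallel>\<^sup>2f\<close>.\<close>

lemma bnorm_tendsto_nhds: "(bnorm E \<longlongrightarrow> bnorm E e) (nhds e)"
proof (cases "e = bzero E (proj E e)")
  case True
  have "((\<lambda>f. f) \<longlongrightarrow> bzero E (proj E e)) (nhds e)"
    using True filterlim_ident by metis
  then have "(bnorm E \<longlongrightarrow> 0) (nhds e)"
    by (rule tendsto_bnorm_zero)
  then show ?thesis
    using True bnorm_zero by metis
next
  case False
  obtain \<epsilon> where \<epsilon>: "\<epsilon> > 0" "\<forall>\<^sub>F f in nhds e. \<epsilon> \<le> bnorm E f"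
    using bnorm_bounded_below[OF False] .
  let ?n = "complex_of_real ((bnorm E e)\<^sup>2)"
  \<comment> \<open>\<open>D(f) = (\<parallel>f\<parallel>\<^sup>2 - \<parallel>e\<parallel>\<^sup>2) f\<close> tends to \<open>D(e) = 0\<close>, and \<open>\<parallel>f\<parallel>\<close> is bounded below\<close>
  let ?D = "\<lambda>f. badd E (bmult E f (bmult E (bstar E f) f)) (bscale E (- ?n) f)"
  have id: "((\<lambda>f. f) \<longlongrightarrow> e) (nhds e)"
    by (rule filterlim_ident)
  have "(?D \<longlongrightarrow> ?D e) (nhds e)"
    by (intro tendsto_badd tendsto_bmult tendsto_bstar tendsto_bscale id tendsto_const)
       (simp_all add: inv_mult_self comp_dom)
  moreover have D: "?D f = bscale E (complex_of_real ((bnorm E f)\<^sup>2 - (bnorm E e)\<^sup>2)) f" for f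
    by (simp add: bmult_star_mult flip: scale_add_left)
  ultimately have "(?D \<longlongrightarrow> bzero E (proj E e)) (nhds e)"
    by simp
  then have lim: "((\<lambda>f. bnorm E (?D f)) \<longlongrightarrow> 0) (nhds e)"
    by (rule tendsto_bnorm_zero)
  have "((\<lambda>f. (bnorm E f)\<^sup>2 - (bnorm E e)\<^sup>2) \<longlongrightarrow> 0) (nhds e)"
  proof (rule Lim_null_comparison)
    show "((\<lambda>f. bnorm E (?D f) / \<epsilon>) \<longlongrightarrow> 0) (nhds e)"
      using tendsto_divide[OF lim tendsto_const[of \<epsilon>]] \<epsilon>(1) by simp
    show "\<forall>\<^sub>F f in nhds e. norm ((bnorm E f)\<^sup>2 - (bnorm E e)\<^sup>2) \<le> bnorm E (?D f) / \<epsilon>"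
      using \<epsilon>(2)
    proof eventually_elim
      case (elim f)
      have "\<bar>(bnorm E f)\<^sup>2 - (bnorm E e)\<^sup>2\<bar> * \<epsilon> \<le> \<bar>(bnorm E f)\<^sup>2 - (bnorm E e)\<^sup>2\<bar> * bnorm E f"
        using elim by (intro mult_left_mono) auto
      also have "\<dots> = bnorm E (?D f)"
        unfolding D by (simp only: norm_scale norm_of_real)
      finally show ?case
        using \<epsilon>(1) by (simp add: field_simps)
    qed
  qed
  then have "((\<lambda>f. (bnorm E f)\<^sup>2) \<longlongrightarrow> (bnorm E e)\<^sup>2) (nhds e)"
    by (simp add: LIM_zero_iff)
  then have "((\<lambda>f. sqrt ((bnorm E f)\<^sup>2)) \<longlongrightarrow> sqrt ((bnorm E e)\<^sup>2)) (nhds e)"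
    by (rule tendsto_real_sqrt)
  then show ?thesis
    by (simp add: norm_nonneg)
qed

lemma tendsto_bnorm: "(f \<longlongrightarrow> e) F \<Longrightarrow> ((\<lambda>i. bnorm E (f i)) \<longlongrightarrow> bnorm E e) F"
  using filterlim_compose[OF bnorm_tendsto_nhds] .

lemma continuous_on_bnorm: "continuous_on S f \<Longrightarrow> continuous_on S (\<lambda>x. bnorm E (f x))"
  unfolding continuous_on_def by (auto intro: tendsto_bnorm)

end

section \<open>Local sections of Fell line bundles\<close>

lemma integral_periodic_shift:
  fixes h :: "real \<Rightarrow> complex"
  assumes cont: "continuous_on UNIV h" and per: "\<And>t. h (t + p) = h t" and s: "0 \<le> s" "s \<le> p"
  shows "integral {0..p} (\<lambda>t. h (t + s)) = integral {0..p} h"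
proof -
  have int: "h integrable_on {a..b}" for a b
    using cont continuous_on_subset integrable_continuous_real by blast
  have shift: "integral {a..b} (\<lambda>t. h (t + c)) = integral {a + c..b + c} h" for a b c
    using integral_shift[of a c b h] cont continuous_on_subset by (fastforce simp: o_def)
  have "integral {0..p} (\<lambda>t. h (t + s)) = integral {s..p + s} h"
    using shift[of 0 p s] by simp
  also have "\<dots> = integral {s..p} h + integral {p..p + s} h"
    using s by (intro Henstock_Kurzweil_Integration.integral_combine[symmetric] int) auto
  also have "integral {p..p + s} h = integral {0..s} h"
    using shift[of 0 s p] per by (simp add: add.commute)
  also have "integral {s..p} h + integral {0..s} h = integral {0..p} h"
    using s Henstock_Kurzweil_Integration.integral_combine[of 0 s p h] int by (simp add: add.commute)
  finally show ?thesis .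
qed

context fell_line_bundle
begin

definition unit_sphere_bundle :: "'a set \<Rightarrow> 'c set" where
  "unit_sphere_bundle L = {e. proj E e \<in> L \<and> bnorm E e = 1}"

text \<open>A proper map argument. The fibres are circles. An open set that contains the circle over \<open>x\<close> contains
  the circles over a neighbourhood of \<open>x\<close>, by the tube lemma for the action of the circle and because
  the projection is open; then compactness of \<open>L\<close> applies.\<close>

lemma compact_unit_sphere_bundle:
  assumes "compact L" shows "compact (unit_sphere_bundle L)"
proof (rule compactI)
  fix C assume C: "\<forall>T\<in>C. open T" "unit_sphere_bundle L \<subseteq> \<Union>C"
  let ?m = "\<lambda>(e, z). bscale E (z / complex_of_real (bnorm E e)) e"
  let ?N = "{e. 0 < bnorm E e} \<times> (UNIV :: complex set)"
  have N: "open ?N"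
  proof (intro open_Times open_UNIV)
    show "open {e. 0 < bnorm E e}"
      by (intro open_Collect_less continuous_on_bnorm continuous_intros)
  qed
  have m: "continuous_on ?N ?m"
    unfolding case_prod_unfold
    by (intro continuous_on_bscale continuous_intros continuous_on_bnorm) auto
  have "\<exists>V D. open V \<and> x \<in> V \<and> finite D \<and> D \<subseteq> C \<and> unit_sphere_bundle V \<subseteq> \<Union>D" if "x \<in> L" for x
  proof -
    obtain b where b: "proj E b = x" "b \<noteq> bzero E x"
      using one_dimensional[of x] by (auto simp: fibre_def)
    then have nb: "0 < bnorm E b"
      using bnorm_pos[of b] by simp
    let ?T = "sphere (0::complex) 1"
    have "compact ((\<lambda>z. ?m (b, z)) ` ?T)"
      using nb by (intro compact_continuous_image) (auto intro!: continuous_on_bscale continuous_intros)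
    moreover have "(\<lambda>z. ?m (b, z)) ` ?T \<subseteq> unit_sphere_bundle L"
      using nb b \<open>x \<in> L\<close> by (auto simp: unit_sphere_bundle_def norm_scale norm_divide)
    ultimately obtain D where D: "D \<subseteq> C" "finite D" "(\<lambda>z. ?m (b, z)) ` ?T \<subseteq> \<Union>D"
      using C by (meson compactE subset_trans)
    have "open (\<Union>D)"
      using D(1) C(1) by blast
    then have open_D: "open (?m -` \<Union>D \<inter> ?N)"
      using m continuous_on_open_vimage[OF N] by blast
    have sub_D: "{b} \<times> ?T \<subseteq> ?m -` \<Union>D \<inter> ?N"
    proof
      fix p assume "p \<in> {b} \<times> ?T"
      then obtain z where z: "p = (b, z)" "z \<in> ?T" by blast
      then have "?m p \<in> \<Union>D"
        using D(3) by (metis (no_types, lifting) imageI subsetD)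
      then show "p \<in> ?m -` \<Union>D \<inter> ?N"
        using z(1) nb by simp
    qed
    obtain X where X: "b \<in> X" "open X" "X \<times> ?T \<subseteq> ?m -` \<Union>D \<inter> ?N"
      using Elementary_Topology.tube_lemma[OF compact_sphere open_D sub_D] by (elim exE conjE)
    have "unit_sphere_bundle (proj E ` X) \<subseteq> \<Union>D"
    proof
      fix e assume "e \<in> unit_sphere_bundle (proj E ` X)"
      then obtain w where w: "w \<in> X" "proj E e = proj E w" "bnorm E e = 1"
        by (auto simp: unit_sphere_bundle_def)
      have "(w, 1) \<in> X \<times> ?T" using w(1) by simp
      then have nw: "0 < bnorm E w" using X(3) by blast
      then obtain c where c: "e = bscale E c w"
        using fibre_spanned[of w e] w(2) bnorm_pos by metis
      have "cmod c * bnorm E w = 1"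
        using w(3) c by (simp add: norm_scale)
      then have "(w, c * complex_of_real (bnorm E w)) \<in> X \<times> ?T"
        using w(1) nw by (simp add: Real_Vector_Spaces.norm_mult)
      then have "?m (w, c * complex_of_real (bnorm E w)) \<in> \<Union>D"
        using X(3) by blast
      then show "e \<in> \<Union>D"
        using nw c by simp
    qed
    moreover have "open (proj E ` X)" "x \<in> proj E ` X"
      using X proj_open b by auto
    ultimately show ?thesis
      using D by blast
  qed
  then obtain V D where VD: "\<And>x. x \<in> L \<Longrightarrow> open (V x) \<and> x \<in> V x \<and> finite (D x) \<and> D x \<subseteq> C
      \<and> unit_sphere_bundle (V x) \<subseteq> \<Union>(D x)"
    by metis
  obtain L' where L': "L' \<subseteq> L" "finite L'" "L \<subseteq> (\<Union>x\<in>L'. V x)"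
    by (rule compactE_image[OF assms, of L V]) (use VD in blast)+
  have "unit_sphere_bundle L \<subseteq> \<Union>(\<Union>x\<in>L'. D x)"
  proof
    fix e assume e: "e \<in> unit_sphere_bundle L"
    then obtain x where "x \<in> L'" "proj E e \<in> V x"
      using L'(3) by (auto simp: unit_sphere_bundle_def)
    then have "e \<in> unit_sphere_bundle (V x)" "x \<in> L"
      using e L'(1) by (auto simp: unit_sphere_bundle_def)
    moreover have "unit_sphere_bundle (V x) \<subseteq> \<Union>(D x)"
      using VD[OF \<open>x \<in> L\<close>] by simp
    ultimately have "e \<in> \<Union>(D x)"
      by (metis subsetD)
    then show "e \<in> \<Union>(\<Union>x\<in>L'. D x)"
      using \<open>x \<in> L'\<close> by auto
  qed
  moreover have "finite (\<Union>x\<in>L'. D x)" "(\<Union>x\<in>L'. D x) \<subseteq> C"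
    using L' VD by auto
  ultimately show "\<exists>C'\<subseteq>C. finite C' \<and> unit_sphere_bundle L \<subseteq> \<Union>C'"
    by blast
qed

lemma bscale_unit_sphere_bundle:
  "e \<in> unit_sphere_bundle L \<Longrightarrow> cmod z = 1 \<Longrightarrow> bscale E z e \<in> unit_sphere_bundle L"
  by (simp add: unit_sphere_bundle_def norm_scale)

lemma unit_sphere_bundle_eq_bscale:
  assumes "e \<in> unit_sphere_bundle L" "f \<in> unit_sphere_bundle L" "proj E e = proj E f"
  obtains z where "cmod z = 1" "f = bscale E z e"
proof -
  have "e \<noteq> bzero E (proj E e)"
    using assms(1) bnorm_pos[of e] by (simp add: unit_sphere_bundle_def)
  then obtain z where "f = bscale E z e"
    using fibre_spanned assms(3) by metis
  moreover have "cmod z = 1"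
    using assms(1,2) calculation by (simp add: unit_sphere_bundle_def norm_scale)
  ultimately show ?thesis
    using that by blast
qed

text \<open>A Urysohn function \<open>\<phi>\<close> on the compact Hausdorff space of unit vectors is averaged against a character
  of the circle: \<open>F(e) = \<integral> \<phi>(exp(it) e) exp(-it) dt\<close> over one period. To make sure that \<open>F(e\<^sub>0) \<noteq> 0\<close>,
  \<open>\<phi>\<close> is 1 at \<open>e\<^sub>0\<close> and 0 on the opposite half circle, so that \<open>\<phi>(exp(it) e\<^sub>0) cos t \<ge> 0\<close>.\<close>

lemma equivariant_function:
  assumes B: "B \<in> local_bisections G" and L: "compact L" "L \<subseteq> B" and e0: "e0 \<in> unit_sphere_bundle L"
  obtains F :: "'c \<Rightarrow> complex" where "continuous_on (unit_sphere_bundle L) F" "F e0 \<noteq> 0"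
    "\<And>e z. e \<in> unit_sphere_bundle L \<Longrightarrow> cmod z = 1 \<Longrightarrow> F (bscale E z e) = z * F e"
proof -
  let ?S = "unit_sphere_bundle L"
  let ?X = "top_of_set ?S"
  have e0n: "proj E e0 \<in> L" "bnorm E e0 = 1" "e0 \<noteq> bzero E (proj E e0)"
    using e0 bnorm_pos[of e0] by (auto simp: unit_sphere_bundle_def)
  have "Hausdorff_space (top_of_set (proj E -` B))"
    using Hausdorff_over bisectionD(1)[OF B] bisection_locally_compact_Hausdorff(1)[OF B] by blast
  then have "Hausdorff_space (subtopology (top_of_set (proj E -` B)) ?S)"
    by (rule Hausdorff_space_subtopology)
  moreover have "proj E -` B \<inter> ?S = ?S"
    using L(2) by (auto simp: unit_sphere_bundle_def)
  ultimately have Haus: "Hausdorff_space ?X"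
    by (simp add: subtopology_subtopology)
  moreover have "compact_space ?X"
    using compact_unit_sphere_bundle[OF L(1)] by (simp add: compact_space_subtopology compactin_euclidean_iff)
  ultimately have normal: "normal_space ?X"
    using compact_Hausdorff_or_regular_imp_normal_space by blast
  let ?H = "sphere 0 1 \<inter> {z. Re z \<le> 0}"
  let ?Q = "(\<lambda>z. bscale E z e0) ` ?H"
  have "compact ?H"
    by (intro compact_Int_closed closed_Collect_le continuous_intros) auto
  then have "compact ?Q"
    by (intro compact_continuous_image continuous_on_bscale continuous_intros)
  moreover have "?Q \<subseteq> ?S"
    using bscale_unit_sphere_bundle[OF e0] by auto
  ultimately have closed_Q: "closedin ?X ?Q"
    by (intro compactin_imp_closedin[OF Haus]) (simp add: compactin_subtopology)
  have closed_e0: "closedin ?X {e0}"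
    using e0 by (intro compactin_imp_closedin[OF Haus]) (simp add: compactin_subtopology)
  have disj: "disjnt ?Q {e0}"
  proof -
    have False if "e0 = bscale E z e0" "Re z \<le> 0" for z
    proof -
      have "bscale E z e0 = bscale E 1 e0"
        unfolding scale_one by (rule that(1)[symmetric])
      then have "z = 1"
        using bscale_cancel e0n(3) by blast
      then show False using that(2) by simp
    qed
    then show ?thesis by (auto simp: disjnt_def)
  qed
  obtain \<phi> :: "'c \<Rightarrow> real" where \<phi>: "continuous_map ?X (top_of_set {0..1}) \<phi>"
      "\<phi> ` ?Q \<subseteq> {0}" "\<phi> ` {e0} \<subseteq> {1}"
    by (rule Urysohn_lemma[OF normal closed_Q closed_e0 disj, of 0 1]) simp_all
  have cont: "continuous_on ?S \<phi>" and range: "\<And>e. e \<in> ?S \<Longrightarrow> 0 \<le> \<phi> e"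
    using \<phi>(1) by (auto simp: continuous_map_in_subtopology image_subset_iff)
  define h where "h e t = complex_of_real (\<phi> (bscale E (cis t) e)) * cis (- t)" for e t
  define F where "F e = integral (cbox 0 (2 * pi)) (h e)" for e
  have cont_h: "continuous_on (?S \<times> T) (\<lambda>(e, t). h e t)" for T
  proof -
    have "continuous_on (?S \<times> T) (\<lambda>p. \<phi> (bscale E (cis (snd p)) (fst p)))"
      by (intro continuous_on_compose2[OF cont] continuous_on_bscale continuous_intros)
         (auto intro: bscale_unit_sphere_bundle)
    then show ?thesis
      unfolding h_def case_prod_unfold by (intro continuous_intros)
  qed
  have cont_h1: "continuous_on T (h e)" if "e \<in> ?S" for e T
  proof -
    have "continuous_on T (\<lambda>t. (e, t))"
      by (intro continuous_intros)
    from continuous_on_compose2[OF cont_h[of T] this] show ?thesis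
      using that by auto
  qed
  have F_cont: "continuous_on ?S F"
    unfolding F_def by (intro integral_continuous_on_param cont_h)
  have equiv: "F (bscale E z e) = z * F e" if e: "e \<in> ?S" and z: "cmod z = 1" for e z
  proof -
    define s where "s = Arg2pi z"
    have s: "0 \<le> s" "s \<le> 2 * pi" "z = cis s"
      using Arg2pi[of z] z by (auto simp: s_def cis_conv_exp is_Arg_def)
    have "h (bscale E z e) = (\<lambda>t. z * h e (t + s))"
      unfolding fun_eq_iff by (simp add: h_def s(3) scale_scale cis_mult cis_divide mult.assoc mult.left_commute)
    then have "F (bscale E z e) = z * integral {0..2 * pi} (\<lambda>t. h e (t + s))"
      by (simp add: F_def)
    also have "integral {0..2 * pi} (\<lambda>t. h e (t + s)) = integral {0..2 * pi} (h e)"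
      using s cont_h1[OF e]
      by (intro integral_periodic_shift) (auto simp: h_def cis_mult[symmetric] cis_divide[symmetric] simp flip: cis_inverse)
    finally show ?thesis by (simp add: F_def)
  qed
  have "F e0 \<noteq> 0"
  proof
    assume "F e0 = 0"
    have int: "h e0 integrable_on {0..2 * pi}"
      using cont_h1[OF e0] by (intro integrable_continuous_real)
    have "integral {0..2 * pi} (\<lambda>t. Re (h e0 t)) = Re (F e0)"
      using integral_linear[OF int bounded_linear_Re] by (simp add: F_def o_def)
    then have "integral {0..2 * pi} (\<lambda>t. Re (h e0 t)) = 0"
      using \<open>F e0 = 0\<close> by simp
    moreover have "0 \<le> Re (h e0 t)" for t
    proof (cases "cos t \<le> 0")
      case True
      then have "bscale E (cis t) e0 \<in> ?Q" by auto
      then have "\<phi> (bscale E (cis t) e0) = 0" using \<phi>(2) by blast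
      then show ?thesis by (simp add: h_def)
    next
      case False
      then show ?thesis
        using range[OF bscale_unit_sphere_bundle[OF e0, of "cis t"]] by (simp add: h_def)
    qed
    moreover have "continuous_on {0..2 * pi} (\<lambda>t. Re (h e0 t))"
      by (intro continuous_intros cont_h1 e0)
    ultimately have "Re (h e0 0) = 0"
      using integral_eq_0_iff[of 0 "2 * pi" "\<lambda>t. Re (h e0 t)"] by simp
    then show False
      using \<phi>(3) by (simp add: h_def scale_one)
  qed
  with F_cont equiv show ?thesis
    using that by blast
qed

text \<open>For \<open>F\<close> as above, the vector \<open>F(e)\<^sup>-\<^sup>1 e\<close> does not change when \<open>e\<close> is replaced by \<open>z e\<close> with \<open>\<bar>z\<bar> = 1\<close>.\<close>

lemma local_nonvanishing_section:
  assumes "open W" "g0 \<in> W"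
  obtains U u where "U \<in> local_bisections G" "g0 \<in> U" "U \<subseteq> W" "continuous_on U u"
    "\<And>g. g \<in> U \<Longrightarrow> proj E (u g) = g" "\<And>g. g \<in> U \<Longrightarrow> u g \<noteq> bzero E g"
proof -
  obtain B where B: "B \<in> local_bisections G" "g0 \<in> B" "B \<subseteq> W"
    using bisection_basis[OF assms] .
  obtain \<phi> :: "'a \<Rightarrow> real" and L where \<phi>: "continuous_on B \<phi>" "\<phi> g0 = 1" and L: "compact L" "L \<subseteq> B"
      and \<phi>L: "\<And>x. x \<notin> L \<Longrightarrow> \<phi> x = 0"
    using bisection_Urysohn[OF B(1), of "{g0}" B] B bisectionD(1)[OF B(1)] by auto
  define V where "V = \<phi> -` (- {0}) \<inter> B"
  have V: "open V" "g0 \<in> V" "V \<subseteq> L"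
    using \<phi> \<phi>L B(2) bisectionD(1)[OF B(1)] continuous_on_open_vimage[of B \<phi>] by (auto simp: V_def)
  let ?S = "unit_sphere_bundle L"
  define n where "n e = bscale E (complex_of_real (1 / bnorm E e)) e" for e
  define N0 where "N0 = {e. 0 < bnorm E e} \<inter> proj E -` V"
  have "open N0"
    unfolding N0_def
    by (intro open_Int open_Collect_less continuous_on_bnorm continuous_intros)
       (use V(1) proj_continuous in \<open>auto simp: continuous_on_open_vimage\<close>)
  have n_S: "n e \<in> ?S" "proj E (n e) = proj E e" if "e \<in> N0" for e
    using that V(3) by (auto simp: n_def N0_def unit_sphere_bundle_def norm_scale norm_divide)
  have n_cont: "continuous_on N0 n"
    unfolding n_def by (intro continuous_on_bscale continuous_intros continuous_on_bnorm) (auto simp: N0_def)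
  obtain b where b: "proj E b = g0" "b \<noteq> bzero E g0"
    using one_dimensional[of g0] by (auto simp: fibre_def)
  then have "b \<in> N0"
    using bnorm_pos[of b] V(2) by (simp add: N0_def)
  obtain F where F: "continuous_on ?S F" "F (n b) \<noteq> 0"
    "\<And>e z. e \<in> ?S \<Longrightarrow> cmod z = 1 \<Longrightarrow> F (bscale E z e) = z * F e"
    using equivariant_function[OF B(1) L n_S(1)[OF \<open>b \<in> N0\<close>]] by metis
  define N where "N = (\<lambda>e. F (n e)) -` (- {0}) \<inter> N0"
  have Fn: "continuous_on N0 (\<lambda>e. F (n e))"
    using continuous_on_compose2[OF F(1) n_cont] n_S(1) by blast
  then have "open N"
    unfolding N_def using \<open>open N0\<close> continuous_on_open_vimage[of N0 "\<lambda>e. F (n e)"] by blast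
  define H where "H e = bscale E (1 / F (n e)) (n e)" for e
  have H_cont: "continuous_on N H"
    unfolding H_def using Fn n_cont
    by (intro continuous_on_bscale continuous_intros) (auto simp: N_def elim: continuous_on_subset)
  have H_proj: "proj E (H e) = proj E e" for e
    by (simp add: H_def n_def)
  have H_nonzero: "H e \<noteq> bzero E (proj E e)" if "e \<in> N" for e
  proof -
    have "bnorm E (H e) \<noteq> 0"
      using that n_S(1)[of e] by (auto simp: H_def N_def norm_scale unit_sphere_bundle_def norm_divide)
    then show ?thesis
      by (metis bnorm_zero)
  qed
  \<comment> \<open>\<open>H\<close> is constant on the fibres of \<open>\<pi>\<close>, so that it descends to a section\<close>
  have H_const: "H e = H f" if "e \<in> N" "f \<in> N" "proj E e = proj E f" for e f
  proof -
    have ef: "n e \<in> ?S" "n f \<in> ?S" "proj E (n e) = proj E (n f)"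
      using that n_S by (auto simp: N_def)
    then obtain z where z: "cmod z = 1" "n f = bscale E z (n e)"
      using unit_sphere_bundle_eq_bscale by metis
    then have "F (n f) = z * F (n e)" "z \<noteq> 0"
      using F(3) ef(1) by auto
    then show ?thesis
      using z(2) by (simp add: H_def scale_scale)
  qed
  define u where "u g = H (SOME e. e \<in> N \<and> proj E e = g)" for g
  have u_proj: "u (proj E e) = H e" if "e \<in> N" for e
  proof -
    have "(SOME f. f \<in> N \<and> proj E f = proj E e) \<in> N \<and> proj E (SOME f. f \<in> N \<and> proj E f = proj E e) = proj E e"
      by (rule someI[of _ e]) (use that in simp)
    then show ?thesis
      unfolding u_def using H_const that by blast
  qed
  have "proj E ` N \<subseteq> B"
    using V(3) L(2) by (auto simp: N_def N0_def)
  then have "proj E ` N \<in> local_bisections G"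
    using bisection_subset[OF B(1)] proj_open \<open>open N\<close> by blast
  moreover have "b \<in> N"
    using \<open>b \<in> N0\<close> F(2) by (simp add: N_def)
  moreover have "continuous_on (proj E ` N) u"
    unfolding continuous_on_def
  proof
    fix g assume "g \<in> proj E ` N"
    then obtain e where e: "e \<in> N" "g = proj E e" by blast
    have "(H \<longlongrightarrow> H e) (nhds e)"
      using continuous_on_open_tendsto_nhds H_cont \<open>open N\<close> e(1) by blast
    moreover have "\<forall>\<^sub>F f in nhds e. H f = u (proj E f)"
      using \<open>open N\<close> e(1) u_proj by (auto simp: eventually_nhds)
    ultimately have "((\<lambda>f. u (proj E f)) \<longlongrightarrow> u g) (nhds e)"
      using e u_proj Lim_transform_eventually by fastforce
    then have "(u \<longlongrightarrow> u g) (nhds g)"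
      unfolding e(2) by (rule tendsto_nhds_descend)
    then show "(u \<longlongrightarrow> u g) (at g within proj E ` N)"
      by (rule tendsto_mono[rotated]) (simp add: at_within_def)
  qed
  moreover have "g0 \<in> proj E ` N" "proj E ` N \<subseteq> W"
    using \<open>b \<in> N\<close> b(1) \<open>proj E ` N \<subseteq> B\<close> B(3) by auto
  moreover have "proj E (u g) = g" "u g \<noteq> bzero E g" if "g \<in> proj E ` N" for g
    using that u_proj H_proj H_nonzero by auto
  ultimately show ?thesis
    using that[of "proj E ` N" u] by blast
qed

end

section \<open>Sections with compact support and convolution\<close>

context fell_bundle
begin

lemma CcD:
  assumes "s \<in> Cc E U"
  shows "proj E (s g) = g" "g \<notin> U \<Longrightarrow> s g = bzero E g" "continuous_on U s"
  using assms by (auto simp: Cc_def)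

lemma Cc_supportE:
  assumes "s \<in> Cc E U"
  obtains K where "compact K" "K \<subseteq> U" "\<And>g. g \<notin> K \<Longrightarrow> s g = bzero E g"
  using assms unfolding Cc_def by blast

lemma CcI:
  assumes "\<And>g. proj E (s g) = g" "continuous_on U s" "compact K" "K \<subseteq> U" "\<And>g. g \<notin> K \<Longrightarrow> s g = bzero E g"
  shows "s \<in> Cc E U"
  unfolding Cc_def using assms by blast

lemma Cc_cutoff:
  assumes u: "continuous_on U u" "\<And>g. g \<in> U \<Longrightarrow> proj E (u g) = g"
    and \<phi>: "continuous_on U \<phi>" and L: "compact L" "L \<subseteq> U" "\<And>g. g \<notin> L \<Longrightarrow> \<phi> g = 0"
  shows "(\<lambda>g. if g \<in> U then bscale E (\<phi> g) (u g) else bzero E g) \<in> Cc E U"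
proof (rule CcI[OF _ _ L(1,2)])
  show "continuous_on U (\<lambda>g. if g \<in> U then bscale E (\<phi> g) (u g) else bzero E g)"
    using continuous_on_bscale[OF \<phi> u(1)] by (simp cong: continuous_on_cong)
qed (use u(2) L(3) in auto)

lemma Gamma_c_proj: "s \<in> Gamma_c G E \<Longrightarrow> proj E (s g) = g"
  by (induction s arbitrary: g rule: Gamma_c.induct) (auto dest: CcD(1))

lemma finprod_fibre_singleton:
  assumes "proj E a = g" "p \<in> A \<Longrightarrow> f p = a" "A \<subseteq> {p}" "p \<notin> A \<Longrightarrow> a = bzero E g"
  shows "finprod (fibre_group E g) f A = a"
proof -
  interpret comm_group "fibre_group E g" by (rule fibre_comm_group)
  show ?thesis
  proof (cases "p \<in> A")
    case True
    then have "A = {p}" using assms(3) by blast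
    then show ?thesis
      using assms True finprod_insert[of "{}" p f] by (auto simp: fibre_def)
  next
    case False
    then have "A = {}" using assms(3) by blast
    then show ?thesis
      using assms False finprod_empty by simp
  qed
qed

text \<open>If the first factor is supported in a bisection, the sum that defines the convolution has at most
  one nonzero term: a factorization \<open>hk\<close> of \<open>g\<close> with \<open>h\<close> in a bisection is determined by \<open>r(g)\<close>.\<close>

lemma conv_bisection:
  assumes U: "U \<in> local_bisections G" and s: "\<And>g. proj E (s g) = g" "\<And>g. g \<notin> U \<Longrightarrow> s g = bzero E g"
    and t: "\<And>g. proj E (t g) = g" and x: "x \<in> U" "gdom G x = grng G y"
  shows "conv G E s t (x \<cdot>\<^bsub>G\<^esub> y) = bmult E (s x) (t y)"
  unfolding conv_def
proof (rule finprod_fibre_singleton[where p = "(x, y)"])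
  show "{(h, k) \<in> composable G. h \<cdot>\<^bsub>G\<^esub> k = x \<cdot>\<^bsub>G\<^esub> y \<and> bmult E (s h) (t k) \<noteq> bzero E (x \<cdot>\<^bsub>G\<^esub> y)} \<subseteq> {(x, y)}"
  proof clarify
    fix h k assume hk: "(h, k) \<in> composable G" "h \<cdot>\<^bsub>G\<^esub> k = x \<cdot>\<^bsub>G\<^esub> y"
        "bmult E (s h) (t k) \<noteq> bzero E (x \<cdot>\<^bsub>G\<^esub> y)"
    then have c: "gdom G h = grng G k" by (simp add: composable_iff)
    have "h \<in> U"
      using hk(2,3) s(2)[of h] t[of k] c by (cases "h \<in> U") auto
    moreover have "grng G h = grng G x"
      using c x(2) hk(2) by (metis rng_mult)
    ultimately have "h = x"
      using x(1) bisectionD(3)[OF U] by (auto dest: inj_onD)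
    then show "h = x \<and> k = y"
      using c x(2) hk(2) by (metis inv_mult_cancel)
  qed
qed (use s t x in \<open>auto simp: composable_iff\<close>)

lemma conv_bisection_outside:
  assumes s: "\<And>g. proj E (s g) = g" "\<And>g. g \<notin> U \<Longrightarrow> s g = bzero E g"
    and t: "\<And>g. proj E (t g) = g" and g: "grng G g \<notin> grng G ` U"
  shows "conv G E s t g = bzero E g"
  unfolding conv_def
proof (rule finprod_fibre_singleton[where p = "(g, g)"])
  have False if "(h, k) \<in> composable G" "h \<cdot>\<^bsub>G\<^esub> k = g" "bmult E (s h) (t k) \<noteq> bzero E g" for h k
  proof -
    have c: "gdom G h = grng G k"
      using that(1) by (simp add: composable_iff)
    then have "grng G h = grng G g"
      using that(2) by auto
    then have "h \<notin> U"
      using g by (metis imageI)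
    then show False
      using that(2,3) s(2)[of h] t[of k] c by auto
  qed
  then show "{(h, k) \<in> composable G. h \<cdot>\<^bsub>G\<^esub> k = g \<and> bmult E (s h) (t k) \<noteq> bzero E g} \<subseteq> {(g, g)}"
    and "(g, g) \<in> {(h, k) \<in> composable G. h \<cdot>\<^bsub>G\<^esub> k = g \<and> bmult E (s h) (t k) \<noteq> bzero E g} \<Longrightarrow>
      (case (g, g) of (h, k) \<Rightarrow> bmult E (s h) (t k)) = bzero E g"
    by blast+
qed simp_all

lemma factor_bisection:
  assumes "grng G g \<in> grng G ` U"
  obtains x y where "x \<in> U" "gdom G x = grng G y" "g = x \<cdot>\<^bsub>G\<^esub> y"
proof -
  obtain x where x: "x \<in> U" "grng G g = grng G x"
    using assms by blast
  then have "g = x \<cdot>\<^bsub>G\<^esub> (ginv G x \<cdot>\<^bsub>G\<^esub> g)" "gdom G x = grng G (ginv G x \<cdot>\<^bsub>G\<^esub> g)"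
    using mult_inv_cancel[of x g] by simp_all
  then show ?thesis
    using that x(1) by blast
qed

lemma conv_Cc_mult:
  assumes "U \<in> local_bisections G" "s \<in> Cc E U" "\<And>g. proj E (t g) = g" "x \<in> U" "gdom G x = grng G y"
  shows "conv G E s t (x \<cdot>\<^bsub>G\<^esub> y) = bmult E (s x) (t y)"
  using conv_bisection[of U s t x y] CcD[OF assms(2)] assms by blast

lemma conv_Cc_outside:
  assumes "s \<in> Cc E U" "\<And>g. proj E (t g) = g" "grng G g \<notin> grng G ` U"
  shows "conv G E s t g = bzero E g"
  using conv_bisection_outside[of s U t g] CcD[OF assms(1)] assms by blast

text \<open>On \<open>UV\<close> the two factors of \<open>g\<close> are continuous functions of \<open>g\<close>.\<close>

lemma conv_Cc:
  assumes U: "U \<in> local_bisections G" and V: "V \<in> local_bisections G"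
    and s: "s \<in> Cc E U" and t: "t \<in> Cc E V"
  shows "conv G E s t \<in> Cc E (set_mult U V)"
proof -
  obtain K where K: "compact K" "K \<subseteq> U" "\<And>g. g \<notin> K \<Longrightarrow> s g = bzero E g"
    using Cc_supportE[OF s] by metis
  obtain L where L: "compact L" "L \<subseteq> V" "\<And>g. g \<notin> L \<Longrightarrow> t g = bzero E g"
    using Cc_supportE[OF t] by metis
  note conv = conv_Cc_mult[OF U s CcD(1)[OF t]] conv_Cc_outside[OF s CcD(1)[OF t]]
  show ?thesis
  proof (rule CcI)
    show "proj E (conv G E s t g) = g" for g
    proof (cases "grng G g \<in> grng G ` U")
      case True
      then show ?thesis
        using factor_bisection[OF True] conv(1) CcD(1)[OF s] CcD(1)[OF t] by (metis proj_bmult)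
    next
      case False
      then show ?thesis by (simp add: conv(2))
    qed
    show "compact (set_mult K L)"
      using compact_set_mult[OF U K(1,2) L(1)] .
    show "set_mult K L \<subseteq> set_mult U V"
      using K(2) L(2) unfolding set_mult_def by blast
    show "conv G E s t g = bzero E g" if g: "g \<notin> set_mult K L" for g
    proof (cases "grng G g \<in> grng G ` U")
      case True
      then obtain x y where xy: "x \<in> U" "gdom G x = grng G y" "g = x \<cdot>\<^bsub>G\<^esub> y"
        by (rule factor_bisection)
      have "x \<notin> K \<or> y \<notin> L"
        using g xy set_multI by blast
      then have "bmult E (s x) (t y) = bzero E g"
        using xy K(3)[of x] L(3)[of y] CcD(1)[OF s, of x] CcD(1)[OF t, of y] by auto
      then show ?thesis
        using conv(1) xy by simp
    next
      case False
      then show ?thesis by (simp add: conv(2))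
    qed
    show "continuous_on (set_mult U V) (conv G E s t)"
      unfolding continuous_on_def
    proof
      fix g assume g: "g \<in> set_mult U V"
      let ?F = "at g within set_mult U V"
      let ?a = "\<lambda>h. inv_into U (grng G) (grng G h)"
      let ?b = "\<lambda>h. ginv G (?a h) \<cdot>\<^bsub>G\<^esub> h"
      have ev: "\<forall>\<^sub>F h in ?F. h \<in> set_mult U V"
        by (simp add: eventually_at_filter)
      have ab: "?a h \<in> U" "grng G (?a h) = grng G h" "?b h \<in> V"
          "gdom G (?a h) = grng G (?b h)" "h = ?a h \<cdot>\<^bsub>G\<^esub> ?b h" if h: "h \<in> set_mult U V" for h
      proof -
        obtain x y where xy: "x \<in> U" "y \<in> V" "gdom G x = grng G y" "h = x \<cdot>\<^bsub>G\<^esub> y"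
          using h by (auto elim!: set_multE)
        then have "?a h = x"
          using bisectionD(3)[OF U] by simp
        then show "?a h \<in> U" "grng G (?a h) = grng G h" "?b h \<in> V"
          "gdom G (?a h) = grng G (?b h)" "h = ?a h \<cdot>\<^bsub>G\<^esub> ?b h"
          using xy by (simp_all add: inv_mult_cancel)
      qed
      have lim_a: "(?a \<longlongrightarrow> ?a g) ?F"
      proof (rule tendsto_bisection_rng[OF U])
        have "\<forall>\<^sub>F h in ?F. grng G (?a h) = grng G h"
          using ev by eventually_elim (rule ab(2))
        then show "((\<lambda>h. grng G (?a h)) \<longlongrightarrow> grng G (?a g)) ?F"
          using tendsto_rng[OF tendsto_ident_at[of g "set_mult U V"]] ab(2)[OF g] by (simp only: tendsto_cong)
        show "\<forall>\<^sub>F h in ?F. ?a h \<in> U"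
          using ev by eventually_elim (rule ab(1))
      qed (rule ab(1)[OF g])
      have lim_b: "(?b \<longlongrightarrow> ?b g) ?F"
      proof (rule tendsto_comp[OF tendsto_inv[OF lim_a] tendsto_ident_at])
        show "\<forall>\<^sub>F h in ?F. gdom G (ginv G (?a h)) = grng G h"
          using ev by eventually_elim (use ab(2) in simp)
      qed (use ab(2)[OF g] in simp)
      have "((\<lambda>h. bmult E (s (?a h)) (t (?b h))) \<longlongrightarrow> bmult E (s (?a g)) (t (?b g))) ?F"
      proof (rule tendsto_bmult)
        show "((\<lambda>h. s (?a h)) \<longlongrightarrow> s (?a g)) ?F"
          by (rule continuous_on_tendsto_compose[OF CcD(3)[OF s] lim_a ab(1)[OF g]])
             (use ev in eventually_elim, rule ab(1))
        show "((\<lambda>h. t (?b h)) \<longlongrightarrow> t (?b g)) ?F"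
          by (rule continuous_on_tendsto_compose[OF CcD(3)[OF t] lim_b ab(3)[OF g]])
             (use ev in eventually_elim, rule ab(3))
        show "\<forall>\<^sub>F h in ?F. gdom G (proj E (s (?a h))) = grng G (proj E (t (?b h)))"
          using ev by eventually_elim (simp only: CcD(1)[OF s] CcD(1)[OF t] ab(4))
      qed (simp only: CcD(1)[OF s] CcD(1)[OF t] ab(4)[OF g])
      moreover have eq: "bmult E (s (?a h)) (t (?b h)) = conv G E s t h" if "h \<in> set_mult U V" for h
        using conv(1)[OF ab(1,4)[OF that]] ab(5)[OF that] by simp
      then have "\<forall>\<^sub>F h in ?F. bmult E (s (?a h)) (t (?b h)) = conv G E s t h"
        using ev by (rule eventually_mono[rotated])
      ultimately show "(conv G E s t \<longlongrightarrow> conv G E s t g) ?F"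
        unfolding eq[OF g] by (rule Lim_transform_eventually)
    qed
  qed
qed

text \<open>Linearity in the second factor reduces this to the product of two sections supported in bisections.\<close>

lemma conv_in_Gamma_c:
  assumes U: "U \<in> local_bisections G" and s: "s \<in> Cc E U" and t: "t \<in> Gamma_c G E"
  shows "conv G E s t \<in> Gamma_c G E"
  using t
proof induction
  note s' = CcD(1,2)[OF s]
  have pointwise: "f = f'"
    if "\<And>g. grng G g \<notin> grng G ` U \<Longrightarrow> f g = f' g"
      "\<And>x y. x \<in> U \<Longrightarrow> gdom G x = grng G y \<Longrightarrow> f (x \<cdot>\<^bsub>G\<^esub> y) = f' (x \<cdot>\<^bsub>G\<^esub> y)" for f f' :: "'g \<Rightarrow> 'e"
    using that factor_bisection by (metis ext)
  {
    case zero
    have "conv G E s (bzero E) = bzero E"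
      by (rule pointwise)
         (use s' in \<open>simp_all add: conv_Cc_mult[OF U s] conv_Cc_outside[OF s]\<close>)
    then show ?case by (simp add: Gamma_c.zero)
  next
    case (base V t)
    then show ?case
      using conv_Cc[OF U _ s] bisection_set_mult[OF U] Gamma_c.base by blast
  next
    case (add t t')
    have p: "proj E (t g) = g" "proj E (t' g) = g" for g
      using add Gamma_c_proj by blast+
    have "conv G E s (\<lambda>g. badd E (t g) (t' g)) = (\<lambda>g. badd E (conv G E s t g) (conv G E s t' g))"
      by (rule pointwise)
         (use s' p in \<open>simp_all add: conv_Cc_mult[OF U s] conv_Cc_outside[OF s]
            mult_add_right composable_iff\<close>)
    then show ?case by (simp add: Gamma_c.add add)
  next
    case (scale t c)
    have p: "proj E (t g) = g" for g
      using scale Gamma_c_proj by blast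
    have "conv G E s (\<lambda>g. bscale E c (t g)) = (\<lambda>g. bscale E c (conv G E s t g))"
      by (rule pointwise)
         (use s' p in \<open>simp_all add: conv_Cc_mult[OF U s] conv_Cc_outside[OF s]
            bmult_bscale_right\<close>)
    then show ?case by (simp add: Gamma_c.scale scale)
  }
qed

lemma sect_star_Cc:
  assumes "s \<in> Cc E U" shows "sect_star G E s \<in> Cc E (ginv G ` U)"
proof -
  obtain K where K: "compact K" "K \<subseteq> U" "\<And>g. g \<notin> K \<Longrightarrow> s g = bzero E g"
    using Cc_supportE[OF assms] by metis
  show ?thesis
  proof (rule CcI)
    show "proj E (sect_star G E s g) = g" for g
      by (simp add: sect_star_def CcD(1)[OF assms] inv_inv)
    show "compact (ginv G ` K)"
      using K(1) continuous_inv compact_continuous_image continuous_on_subset by blast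
    show "ginv G ` K \<subseteq> ginv G ` U"
      using K(2) by blast
    show "sect_star G E s g = bzero E g" if "g \<notin> ginv G ` K" for g
    proof -
      have "ginv G g \<notin> K"
        using that inv_inv by (metis imageI)
      then show ?thesis
        by (simp add: sect_star_def K(3) inv_inv)
    qed
    show "continuous_on (ginv G ` U) (sect_star G E s)"
      unfolding sect_star_def
      by (intro continuous_on_compose2[OF star_continuous] continuous_on_compose2[OF CcD(3)[OF assms]]
            continuous_on_subset[OF continuous_inv]) (auto simp: inv_inv)
  qed
qed

end

context fell_line_bundle
begin

lemma Gamma_c_bounded:
  assumes "s \<in> Gamma_c G E" shows "\<exists>M. \<forall>g. bnorm E (s g) \<le> M"
  using assms
proof induction
  case zero
  show ?case by (intro exI[of _ 0]) simp
next
  case (base U s)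
  obtain K where K: "compact K" "K \<subseteq> U" "\<And>g. g \<notin> K \<Longrightarrow> s g = bzero E g"
    using Cc_supportE[OF base(2)] by metis
  have "continuous_on K (\<lambda>g. bnorm E (s g))"
    using CcD(3)[OF base(2)] K(2) by (intro continuous_on_bnorm) (rule continuous_on_subset)
  then have "bounded ((\<lambda>g. bnorm E (s g)) ` K)"
    using K(1) compact_continuous_image compact_imp_bounded by blast
  then obtain M where M: "\<And>g. g \<in> K \<Longrightarrow> bnorm E (s g) \<le> M" "0 < M"
    unfolding bounded_pos by force
  then have "bnorm E (s g) \<le> M" for g
    by (cases "g \<in> K") (simp_all add: K(3))
  then show ?case by blast
next
  case (add s t)
  then obtain M M' where "\<And>g. bnorm E (s g) \<le> M" "\<And>g. bnorm E (t g) \<le> M'" by blast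
  then have "bnorm E (badd E (s g) (t g)) \<le> M + M'" for g
    using norm_triangle[of "s g" "t g"] Gamma_c_proj add.hyps by (metis add_mono order_trans)
  then show ?case by blast
next
  case (scale s c)
  then obtain M where "\<And>g. bnorm E (s g) \<le> M" by blast
  then have "bnorm E (bscale E c (s g)) \<le> cmod c * M" for g
    by (simp add: norm_scale mult_left_mono)
  then show ?case by blast
qed

end

section \<open>Evaluation\<close>

locale line_bundle_completion = fell_line_bundle G E + compatible_completion G E N \<iota>
  for G :: "('g::topological_space, 'm) groupoid_str_scheme"
    and E :: "('g, 'e::topological_space, 'n) fell_bundle_str_scheme"
    and N :: "('g \<Rightarrow> 'e) \<Rightarrow> real"
    and \<iota> :: "('g \<Rightarrow> 'e) \<Rightarrow> 'a::cstar_algebra"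
begin

lemma bnorm_le_N:
  assumes "s \<in> Gamma_c G E" shows "bnorm E (s g) \<le> N s"
proof -
  have "bdd_above (range (\<lambda>g. bnorm E (s g)))"
    using Gamma_c_bounded[OF assms] by (auto simp: bdd_above_def)
  then have "bnorm E (s g) \<le> sup_norm E s"
    unfolding sup_norm_def by (rule cSUP_upper[rotated]) simp
  then show ?thesis
    using sup_norm_le[OF assms] by simp
qed

lemma dense_induct:
  assumes "closed {a. P a}" "\<And>s. s \<in> Gamma_c G E \<Longrightarrow> P (\<iota> s)"
  shows "P a"
proof -
  have "closure (\<iota> ` Gamma_c G E) \<subseteq> {a. P a}"
    using assms by (intro closure_minimal) auto
  then show ?thesis
    using \<iota>_dense by auto
qed

lemma \<iota>_diff:
  assumes "s \<in> Gamma_c G E" "t \<in> Gamma_c G E"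
  shows "(\<lambda>g. badd E (s g) (bscale E (- 1) (t g))) \<in> Gamma_c G E"
    "\<iota> (\<lambda>g. badd E (s g) (bscale E (- 1) (t g))) = \<iota> s - \<iota> t"
proof -
  have "(- 1) *\<^sub>C \<iota> t = - \<iota> t"
    using scaleC_of_real[of "- 1" "\<iota> t"] by simp
  then show "(\<lambda>g. badd E (s g) (bscale E (- 1) (t g))) \<in> Gamma_c G E"
    "\<iota> (\<lambda>g. badd E (s g) (bscale E (- 1) (t g))) = \<iota> s - \<iota> t"
    using \<iota>_add[OF assms(1) Gamma_c.scale[OF assms(2), of "- 1"]] \<iota>_scale[OF assms(2), of "- 1"]
      Gamma_c.add[OF assms(1) Gamma_c.scale[OF assms(2), of "- 1"]] by simp_all
qed

text \<open>Fibres are lines, so that evaluation is a scalar functional up to the choice of a basis vector. It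
  is bounded by the compatible norm, and a bounded functional extends from a dense subspace.\<close>

lemma eval_coordinate_exists:
  assumes b: "proj E b = g" "b \<noteq> bzero E g"
  obtains \<xi> :: "'a \<Rightarrow> complex" where "bounded_linear \<xi>" "\<And>c a. \<xi> (c *\<^sub>C a) = c * \<xi> a"
    "\<And>s. s \<in> Gamma_c G E \<Longrightarrow> s g = bscale E (\<xi> (\<iota> s)) b"
proof -
  have nb: "0 < bnorm E b"
    using b bnorm_pos[of b] by simp
  have "\<exists>c. s g = bscale E c b" if "s \<in> Gamma_c G E" for s
    using fibre_spanned[of b "s g"] b Gamma_c_proj[OF that, of g] by metis
  then obtain \<kappa> where \<kappa>: "\<And>s. s \<in> Gamma_c G E \<Longrightarrow> s g = bscale E (\<kappa> s) b"
    by metis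
  have \<kappa>_unique: "\<kappa> s = c" if "s \<in> Gamma_c G E" "s g = bscale E c b" for s c
    using \<kappa>[OF that(1)] that(2) b bscale_cancel by metis
  have \<kappa>_add: "\<kappa> (\<lambda>g. badd E (s g) (t g)) = \<kappa> s + \<kappa> t" if "s \<in> Gamma_c G E" "t \<in> Gamma_c G E" for s t
    using that by (intro \<kappa>_unique Gamma_c.add Gamma_c.scale) (simp_all add: \<kappa> scale_add_left)
  have \<kappa>_scale: "\<kappa> (\<lambda>g. bscale E c (s g)) = c * \<kappa> s" if "s \<in> Gamma_c G E" for s c
    using that by (intro \<kappa>_unique Gamma_c.add Gamma_c.scale) (simp_all add: \<kappa> scale_scale)
  have \<kappa>_bound: "cmod (\<kappa> s) \<le> norm (\<iota> s) / bnorm E b" if "s \<in> Gamma_c G E" for s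
    using bnorm_le_N[OF that, of g] nb \<kappa>[OF that] by (simp add: norm_scale \<iota>_norm[OF that] field_simps)
  have \<kappa>_diff: "cmod (\<kappa> s - \<kappa> t) \<le> norm (\<iota> s - \<iota> t) / bnorm E b"
    if "s \<in> Gamma_c G E" "t \<in> Gamma_c G E" for s t
    using \<kappa>_bound[OF \<iota>_diff(1)[OF that]] \<kappa>_add[OF that(1) Gamma_c.scale[OF that(2)]] \<kappa>_scale[OF that(2)]
    by (simp add: \<iota>_diff(2)[OF that])
  define \<xi>0 where "\<xi>0 a = \<kappa> (SOME s. s \<in> Gamma_c G E \<and> \<iota> s = a)" for a
  have \<xi>0: "\<xi>0 (\<iota> s) = \<kappa> s" if "s \<in> Gamma_c G E" for s
  proof -
    let ?t = "SOME t. t \<in> Gamma_c G E \<and> \<iota> t = \<iota> s"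
    have t: "?t \<in> Gamma_c G E \<and> \<iota> ?t = \<iota> s"
      by (rule someI[of _ s]) (use that in simp)
    then show ?thesis
      using \<kappa>_diff[of ?t s] that by (simp add: \<xi>0_def)
  qed
  have "uniformly_continuous_on (\<iota> ` Gamma_c G E) \<xi>0"
    unfolding uniformly_continuous_on_def
  proof (intro allI impI)
    fix e :: real assume "0 < e"
    then show "\<exists>d>0. \<forall>x\<in>\<iota> ` Gamma_c G E. \<forall>x'\<in>\<iota> ` Gamma_c G E. dist x' x < d \<longrightarrow> dist (\<xi>0 x') (\<xi>0 x) < e"
    proof (intro exI[of _ "e * bnorm E b"] conjI ballI impI)
      fix x x' assume "x \<in> \<iota> ` Gamma_c G E" "x' \<in> \<iota> ` Gamma_c G E" and d: "dist x' x < e * bnorm E b"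
      then obtain s t where st: "s \<in> Gamma_c G E" "t \<in> Gamma_c G E" "x = \<iota> s" "x' = \<iota> t" by blast
      have "dist (\<xi>0 x') (\<xi>0 x) \<le> norm (\<iota> t - \<iota> s) / bnorm E b"
        using \<kappa>_diff st by (simp add: dist_norm \<xi>0)
      also have "\<dots> < e"
        using d nb st by (simp add: dist_norm field_simps)
      finally show "dist (\<xi>0 x') (\<xi>0 x) < e" .
    qed (use nb in simp)
  qed
  then obtain \<xi> where uc: "uniformly_continuous_on UNIV \<xi>" and ext: "\<And>a. a \<in> \<iota> ` Gamma_c G E \<Longrightarrow> \<xi>0 a = \<xi> a"
    using uniformly_continuous_on_extension_on_closure[of "\<iota> ` Gamma_c G E" \<xi>0] \<iota>_dense by metis
  have cont: "continuous_on A \<xi>" for A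
    using uniformly_continuous_imp_continuous[OF uc] continuous_on_subset by blast
  have comp: "continuous_on A (\<lambda>x. \<xi> (f x))" if "continuous_on A f" for A and f :: "'a \<Rightarrow> 'a"
    using continuous_on_compose2[OF cont that] by blast
  have \<xi>: "\<xi> (\<iota> s) = \<kappa> s" if "s \<in> Gamma_c G E" for s
    using ext \<xi>0[OF that] that by (metis imageI)
  have scale: "\<xi> (c *\<^sub>C a) = c * \<xi> a" for c a
  proof (induction a rule: dense_induct)
    case 1
    show ?case
      by (intro closed_Collect_eq comp continuous_intros cont linear_continuous_on bounded_linear_scaleC)
  next
    case (2 s)
    then show ?case
      using \<xi>[OF Gamma_c.scale[OF 2, of c]] by (simp add: \<xi> \<iota>_scale \<kappa>_scale)
  qed
  have add: "\<xi> (a + a') = \<xi> a + \<xi> a'" for a a'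
  proof (induction a rule: dense_induct)
    case 1
    show ?case
      by (intro closed_Collect_eq comp continuous_intros cont)
  next
    case (2 s)
    show ?case
    proof (induction a' rule: dense_induct)
      case 1
      show ?case
        by (intro closed_Collect_eq comp continuous_intros cont)
    next
      case (2 t)
      then show ?case
        using \<xi>[OF Gamma_c.add[OF \<open>s \<in> Gamma_c G E\<close> 2]] \<open>s \<in> Gamma_c G E\<close> by (simp add: \<xi> \<iota>_add \<kappa>_add)
    qed
  qed
  have bound: "cmod (\<xi> a) \<le> norm a * (1 / bnorm E b)" for a
  proof (induction a rule: dense_induct)
    case 1
    show ?case
      by (intro closed_Collect_le continuous_intros cont)
  next
    case (2 s)
    then show ?case using \<kappa>_bound \<xi> by simp
  qed
  have "bounded_linear \<xi>"
    using add scale bound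
    by (intro bounded_linear_intro[where K = "1 / bnorm E b"]) (auto simp: scaleC_of_real[symmetric] scaleR_conv_of_real)
  with scale show ?thesis
    using that \<xi> \<kappa> by simp
qed

text \<open>The extension is unique, so that it computes the evaluation map.\<close>

lemma eval_coordinate:
  assumes b: "proj E b = g" "b \<noteq> bzero E g"
  obtains \<xi> :: "'a \<Rightarrow> complex" where "bounded_linear \<xi>" "\<And>c a. \<xi> (c *\<^sub>C a) = c * \<xi> a"
    "\<And>a. eval_at G E \<iota> g a = bscale E (\<xi> a) b" "\<And>s. s \<in> Gamma_c G E \<Longrightarrow> s g = bscale E (\<xi> (\<iota> s)) b"
proof -
  have nb: "0 < bnorm E b"
    using b bnorm_pos[of b] by simp
  obtain \<xi> where \<xi>: "bounded_linear \<xi>" "\<And>c a. \<xi> (c *\<^sub>C a) = c * \<xi> a"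
    "\<And>s. s \<in> Gamma_c G E \<Longrightarrow> s g = bscale E (\<xi> (\<iota> s)) b"
    using eval_coordinate_exists[OF b] by metis
  let ?f = "\<lambda>a. bscale E (\<xi> a) b"
  have "eval_at G E \<iota> g = ?f"
    unfolding eval_at_def
  proof (rule the_equality)
    obtain C where C: "\<And>a. norm (\<xi> a) \<le> norm a * C"
      using bounded_linear.bounded[OF \<xi>(1)] by blast
    have "bnorm E (?f a) \<le> (C * bnorm E b) * norm a" for a
      using mult_right_mono[OF C[of a], of "bnorm E b"] nb by (simp add: norm_scale mult_ac)
    then show "bounded_linear_to_fibre E g ?f \<and> (\<forall>s\<in>Gamma_c G E. ?f (\<iota> s) = s g)"
      using \<xi> b unfolding bounded_linear_to_fibre_def
      by (auto simp: fibre_def linear_simps(1)[OF \<xi>(1)] scale_add_left scale_scale)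
  next
    fix f assume f: "bounded_linear_to_fibre E g f \<and> (\<forall>s\<in>Gamma_c G E. f (\<iota> s) = s g)"
    then have f_fib: "proj E (f a) = g" and f_add: "f (a + a') = badd E (f a) (f a')"
      and f_scale: "f (c *\<^sub>C a) = bscale E c (f a)" and f_ext: "s \<in> Gamma_c G E \<Longrightarrow> f (\<iota> s) = s g" for a a' c s
      unfolding bounded_linear_to_fibre_def by (auto simp: fibre_def)
    obtain C where C: "\<And>a. bnorm E (f a) \<le> C * norm a"
      using f unfolding bounded_linear_to_fibre_def by blast
    have "\<exists>c. f a = bscale E c b" for a
      using fibre_spanned[of b "f a"] b f_fib by metis
    then obtain \<psi> where \<psi>: "\<And>a. f a = bscale E (\<psi> a) b"
      by metis
    have cancel: "c = d" if "bscale E c b = bscale E d b" for c d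
      using bscale_cancel[OF that] b by simp
    have "bounded_linear \<psi>"
    proof (rule bounded_linear_intro)
      show "\<psi> (a + a') = \<psi> a + \<psi> a'" for a a'
        by (rule cancel) (use f_add[of a a'] in \<open>simp add: \<psi> scale_add_left\<close>)
      show "\<psi> (r *\<^sub>R a) = r *\<^sub>R \<psi> a" for r a
        by (rule cancel)
           (use f_scale[of "complex_of_real r" a] in \<open>simp add: \<psi> scale_scale scaleC_of_real scaleR_conv_of_real\<close>)
      show "norm (\<psi> a) \<le> norm a * (C / bnorm E b)" for a
        using C[of a] nb by (simp add: \<psi> norm_scale field_simps)
    qed
    have "\<psi> a = \<xi> a" for a
    proof (induction a rule: dense_induct)
      case 1
      show ?case
        by (intro closed_Collect_eq linear_continuous_on \<xi> \<open>bounded_linear \<psi>\<close>)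
    next
      case (2 s)
      then show ?case
        by (intro cancel) (metis \<xi>(3) \<psi> f_ext)
    qed
    then show "f = ?f"
      using \<psi> by auto
  qed
  then show ?thesis
    using that \<xi> by simp
qed

lemma fibre_basis:
  obtains b where "proj E b = g" "b \<noteq> bzero E g"
  using one_dimensional[of g] by (auto simp: fibre_def)

lemma eval_at_\<iota>: "s \<in> Gamma_c G E \<Longrightarrow> eval_at G E \<iota> g (\<iota> s) = s g"
  using fibre_basis eval_coordinate by metis

lemma proj_eval_at [simp]: "proj E (eval_at G E \<iota> g a) = g"
  by (metis fibre_basis eval_coordinate proj_bscale)

lemma eval_at_kernel: "closed {a. eval_at G E \<iota> g a = bzero E g}" "csubspace {a. eval_at G E \<iota> g a = bzero E g}"
proof -
  obtain b where b: "proj E b = g" "b \<noteq> bzero E g"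
    by (rule fibre_basis)
  obtain \<xi> :: "'a \<Rightarrow> complex" where \<xi>: "bounded_linear \<xi>" "\<And>c a. \<xi> (c *\<^sub>C a) = c * \<xi> a"
    "\<And>a. eval_at G E \<iota> g a = bscale E (\<xi> a) b"
    using eval_coordinate[OF b] by metis
  have eq: "{a. eval_at G E \<iota> g a = bzero E g} = {a. \<xi> a = 0}"
    using bscale_eq_zero[of _ b] b by (simp add: \<xi>(3))
  show "closed {a. eval_at G E \<iota> g a = bzero E g}"
    unfolding eq by (intro closed_Collect_eq linear_continuous_on \<xi> continuous_intros)
  show "csubspace {a. eval_at G E \<iota> g a = bzero E g}"
    unfolding eq cvec.subspace_def
    using linear_simps[OF \<xi>(1)] \<xi>(2) by simp
qed

text \<open>Both sides are continuous in \<open>a\<close>, and on the dense subalgebra the formula is the one for convolution.\<close>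

lemma eval_at_mult:
  assumes U: "U \<in> local_bisections G" and s: "s \<in> Cc E U" and x: "x \<in> U" "gdom G x = grng G y"
  shows "eval_at G E \<iota> (x \<cdot>\<^bsub>G\<^esub> y) (\<iota> s * a) = bmult E (s x) (eval_at G E \<iota> y a)"
proof -
  obtain b where b: "proj E b = y" "b \<noteq> bzero E y"
    by (rule fibre_basis)
  obtain \<xi> where \<xi>: "bounded_linear \<xi>" "\<And>a. eval_at G E \<iota> y a = bscale E (\<xi> a) b"
    using eval_coordinate[OF b] by metis
  obtain b' where b': "proj E b' = x \<cdot>\<^bsub>G\<^esub> y" "b' \<noteq> bzero E (x \<cdot>\<^bsub>G\<^esub> y)"
    by (rule fibre_basis)
  obtain \<xi>' where \<xi>': "bounded_linear \<xi>'" "\<And>a. eval_at G E \<iota> (x \<cdot>\<^bsub>G\<^esub> y) a = bscale E (\<xi>' a) b'"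
    using eval_coordinate[OF b'] by metis
  have comp: "gdom G (proj E (s x)) = grng G (proj E b)"
    using x b(1) CcD(1)[OF s] by simp
  obtain c where c: "bmult E (s x) b = bscale E c b'"
    using fibre_spanned[of b' "bmult E (s x) b"] b' comp b(1) CcD(1)[OF s] by auto
  have "\<xi>' (\<iota> s * a) = \<xi> a * c"
  proof (induction a rule: dense_induct)
    case 1
    show ?case
      by (intro closed_Collect_eq continuous_intros linear_continuous_on \<xi>
          continuous_on_compose2[OF linear_continuous_on[OF \<xi>'(1)]]) auto
  next
    case (2 t)
    have s\<Gamma>: "s \<in> Gamma_c G E"
      using Gamma_c.base[OF U s] .
    have "bscale E (\<xi>' (\<iota> s * \<iota> t)) b' = conv G E s t (x \<cdot>\<^bsub>G\<^esub> y)"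
      using eval_at_\<iota>[OF conv_in_Gamma_c[OF U s 2]] by (simp add: \<iota>_mult[OF s\<Gamma> 2] flip: \<xi>'(2))
    also have "\<dots> = bmult E (s x) (t y)"
      using conv_Cc_mult[OF U s _ x] Gamma_c_proj[OF 2] by blast
    also have "\<dots> = bmult E (s x) (bscale E (\<xi> (\<iota> t)) b)"
      using eval_at_\<iota>[OF 2, of y] \<xi>(2) by simp
    also have "\<dots> = bscale E (\<xi> (\<iota> t) * c) b'"
      using comp c by (simp add: bmult_bscale_right scale_scale)
    finally show ?case
      by (rule bscale_cancel) (use b' in simp)
  qed
  then show ?thesis
    using comp c by (simp add: \<xi>'(2) \<xi>(2) bmult_bscale_right scale_scale)
qed

end

section \<open>The associated map\<close>

context line_bundle_completion
begin

text \<open>The generators of the closed subspace \<open>p\<^sup>*(V)\<close>.\<close>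

definition local_elements :: "'g set \<Rightarrow> 'a set" where
  "local_elements V = \<iota> ` (\<Union>U\<in>{U \<in> local_bisections G. U \<subseteq> V}. Cc E U)"

lemma assoc_map_clspan: "assoc_map G E \<iota> V = clspan (local_elements V)"
  by (simp add: assoc_map_def clspan_def local_elements_def)

lemma local_elementsI:
  "U \<in> local_bisections G \<Longrightarrow> U \<subseteq> V \<Longrightarrow> s \<in> Cc E U \<Longrightarrow> \<iota> s \<in> local_elements V"
  unfolding local_elements_def by blast

lemma local_elementsE:
  assumes "a \<in> local_elements V"
  obtains U s where "U \<in> local_bisections G" "U \<subseteq> V" "s \<in> Cc E U" "a = \<iota> s"
  using assms unfolding local_elements_def by blast

lemma local_elements_mono: "V \<subseteq> W \<Longrightarrow> local_elements V \<subseteq> local_elements W"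
  unfolding local_elements_def by blast

lemma \<iota>_zero: "\<iota> (bzero E) = 0"
proof -
  have "\<iota> (\<lambda>g. bscale E 0 (bzero E g)) = 0 *\<^sub>C \<iota> (bzero E)"
    using \<iota>_scale[OF Gamma_c.zero] .
  then show ?thesis
    by simp
qed

text \<open>A partition of unity, one member of the cover at a time: the part of \<open>s\<close> near the points that only
  \<open>V\<close> covers is cut off, and the rest is supported in the remaining sets.\<close>

lemma \<iota>_finite_cover:
  assumes W: "csubspace W" and U: "U \<in> local_bisections G"
  shows "finite T \<Longrightarrow> (\<And>V. V \<in> T \<Longrightarrow> open V \<and> local_elements V \<subseteq> W) \<Longrightarrow>
    s \<in> Cc E U \<Longrightarrow> compact K \<Longrightarrow> K \<subseteq> U \<Longrightarrow> (\<And>g. g \<notin> K \<Longrightarrow> s g = bzero E g) \<Longrightarrow> K \<subseteq> \<Union>T \<Longrightarrow> \<iota> s \<in> W"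
proof (induction T arbitrary: s K rule: finite_induct)
  case empty
  then have "s = bzero E" by auto
  then show ?case
    using \<iota>_zero cvec.subspace_0[OF W] by simp
next
  case (insert V T)
  note s = insert.prems(2)
  have V: "open V" "local_elements V \<subseteq> W"
    using insert.prems(1) by auto
  have "open U"
    using bisectionD(1)[OF U] .
  have "compact (K - \<Union>T)"
    using insert.prems(1,3) by (intro compact_diff open_Union) auto
  moreover have "K - \<Union>T \<subseteq> U \<inter> V"
    using insert.prems(4,6) by auto
  ultimately obtain \<phi> :: "'g \<Rightarrow> real" and L where \<phi>: "continuous_on U \<phi>"
      "\<And>x. x \<in> K - \<Union>T \<Longrightarrow> \<phi> x = 1" "compact L" "L \<subseteq> U \<inter> V" "\<And>x. x \<notin> L \<Longrightarrow> \<phi> x = 0"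
    using bisection_Urysohn[OF U, of "K - \<Union>T" "U \<inter> V"] \<open>open U\<close> \<open>open V\<close> by (metis Int_lower1 open_Int)
  \<comment> \<open>a cut-off that equals 1 on a neighbourhood of \<open>K - \<Union>T\<close>\<close>
  define \<psi> where "\<psi> x = complex_of_real (min 1 (2 * \<phi> x))" for x
  have \<psi>_cont: "continuous_on U \<psi>"
    unfolding \<psi>_def by (intro continuous_intros \<phi>(1))
  define s1 where "s1 g = (if g \<in> U \<inter> V then bscale E (\<psi> g) (s g) else bzero E g)" for g
  define s2 where "s2 g = bscale E (1 - \<psi> g) (s g)" for g
  have s1: "s1 \<in> Cc E (U \<inter> V)"
    unfolding s1_def
    by (rule Cc_cutoff[OF _ _ _ \<phi>(3,4)])
       (use CcD[OF s] \<psi>_cont \<phi>(5) in \<open>auto simp: \<psi>_def elim: continuous_on_subset\<close>)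
  define K2 where "K2 = {x \<in> K. \<phi> x \<le> 1 / 2}"
  have "continuous_on K \<phi>"
    using \<phi>(1) insert.prems(4) by (rule continuous_on_subset)
  then have "closedin (top_of_set K) (K \<inter> \<phi> -` {..1 / 2})"
    by (intro continuous_closedin_preimage closed_atMost)
  then have "compact (K \<inter> \<phi> -` {..1 / 2})"
    using insert.prems(3) closedin_compact by blast
  moreover have "K \<inter> \<phi> -` {..1 / 2} = K2"
    by (auto simp: K2_def)
  ultimately have K2: "compact K2" by simp
  have K2_sub: "K2 \<subseteq> U"
    using insert.prems(4) by (auto simp: K2_def)
  have K2_cover: "K2 \<subseteq> \<Union>T"
  proof
    fix x assume x: "x \<in> K2"
    show "x \<in> \<Union>T"
    proof (rule ccontr)
      assume "x \<notin> \<Union>T"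
      then have "\<phi> x = 1"
        using x by (intro \<phi>(2)) (simp add: K2_def)
      then show False
        using x by (simp add: K2_def)
    qed
  qed
  have s2_zero: "s2 g = bzero E g" if "g \<notin> K2" for g
  proof (cases "g \<in> K")
    case True
    then have "\<psi> g = 1"
      using that by (simp add: K2_def \<psi>_def)
    then show ?thesis
      using CcD(1)[OF s] by (simp add: s2_def)
  qed (simp add: s2_def insert.prems(5))
  have s2: "s2 \<in> Cc E U"
    by (rule CcI[OF _ _ K2 K2_sub s2_zero])
       (auto simp: s2_def CcD(1)[OF s] intro!: continuous_on_bscale continuous_intros \<psi>_cont CcD(3)[OF s])
  have UV: "U \<inter> V \<in> local_bisections G"
    using bisection_subset[OF U] \<open>open U\<close> \<open>open V\<close> by blast
  have "\<iota> s1 \<in> W"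
    using local_elementsI[OF UV Int_lower2 s1] V(2) by (rule subsetD[rotated])
  moreover have "\<iota> s2 \<in> W"
    using insert.prems(1) by (intro insert.IH[OF _ s2 K2 K2_sub s2_zero K2_cover]) auto
  moreover have "s g = badd E (s1 g) (s2 g)" for g
  proof (cases "g \<in> U \<inter> V")
    case True
    then show ?thesis
      using scale_add_left[of "\<psi> g" "1 - \<psi> g" "s g"] by (simp add: s1_def s2_def scale_one)
  next
    case False
    then have "\<phi> g = 0"
      using \<phi>(4) by (intro \<phi>(5)) blast
    then have "\<psi> g = 0"
      by (simp add: \<psi>_def)
    then show ?thesis
      using False CcD(1)[OF s] by (simp add: s1_def s2_def scale_one)
  qed
  then have "s = (\<lambda>g. badd E (s1 g) (s2 g))" by (rule ext)
  then have "\<iota> s = \<iota> s1 + \<iota> s2"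
    using \<iota>_add[OF Gamma_c.base[OF UV s1] Gamma_c.base[OF U s2]] by simp
  ultimately show ?case
    using cvec.subspace_add[OF W] by simp
qed

lemma local_elements_Union_subset:
  assumes W: "csubspace W" and S: "\<And>V. V \<in> S \<Longrightarrow> open V \<and> local_elements V \<subseteq> W"
  shows "local_elements (\<Union>S) \<subseteq> W"
proof
  fix a assume "a \<in> local_elements (\<Union>S)"
  then obtain U s where U: "U \<in> local_bisections G" "U \<subseteq> \<Union>S" and s: "s \<in> Cc E U" "a = \<iota> s"
    by (rule local_elementsE)
  obtain K where K: "compact K" "K \<subseteq> U" "\<And>g. g \<notin> K \<Longrightarrow> s g = bzero E g"
    using Cc_supportE[OF s(1)] by metis
  have "K \<subseteq> \<Union>S"
    using K(2) U(2) by (rule subset_trans)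
  then obtain T where T: "T \<subseteq> S" "finite T" "K \<subseteq> \<Union>T"
    by (rule compactE[OF K(1)]) (use S in simp)
  have "\<iota> s \<in> W"
    using S T(1) by (intro \<iota>_finite_cover[OF W U(1) T(2) _ s(1) K T(3)]) auto
  then show "a \<in> W"
    using s(2) by simp
qed

lemma assoc_map_Union:
  assumes "\<And>V. V \<in> S \<Longrightarrow> open V"
  shows "assoc_map G E \<iota> (\<Union>S) = clspan (\<Union>V\<in>S. local_elements V)"
  unfolding assoc_map_clspan
proof (intro equalityI clspan_minimal local_elements_Union_subset conjI)
  show "local_elements V \<subseteq> clspan (\<Union>V\<in>S. local_elements V)" if "V \<in> S" for V
    using UN_upper[OF that, of local_elements] clspan_superset by (rule subset_trans)
  show "(\<Union>V\<in>S. local_elements V) \<subseteq> clspan (local_elements (\<Union>S))"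
  proof (rule UN_least)
    show "local_elements V \<subseteq> clspan (local_elements (\<Union>S))" if "V \<in> S" for V
      using local_elements_mono[OF Union_upper[OF that]] clspan_superset by (rule subset_trans)
  qed
qed (use assms in simp_all)

text \<open>This is division by a nonvanishing section \<open>u\<close>: if \<open>r\<close> is supported in \<open>UB\<close>, then
  \<open>r = (r (u/\<parallel>u\<parallel>\<^sup>2)\<^sup>*) u\<close>, where the first factor is supported in \<open>U\<close>.\<close>

lemma factor_through_section:
  assumes B: "B \<in> local_bisections G" and u: "continuous_on B u" "\<And>g. g \<in> B \<Longrightarrow> proj E (u g) = g"
      "\<And>g. g \<in> B \<Longrightarrow> u g \<noteq> bzero E g"
    and R: "R \<in> local_bisections G" "R \<subseteq> set_mult U B" and r: "r \<in> Cc E R"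
  obtains A s t where "A \<in> local_bisections G" "A \<subseteq> U" "s \<in> Cc E A" "t \<in> Cc E B" "r = conv G E s t"
proof -
  obtain K where K: "compact K" "K \<subseteq> R" "\<And>g. g \<notin> K \<Longrightarrow> r g = bzero E g"
    using Cc_supportE[OF r] by metis
  define b where "b g = inv_into B (gdom G) (gdom G g)" for g
  have b: "b g \<in> B" "gdom G (b g) = gdom G g" if g: "g \<in> R" for g
  proof -
    have "gdom G g \<in> gdom G ` B"
      using g R(2) by (auto elim!: set_multE)
    then show "b g \<in> B" "gdom G (b g) = gdom G g"
      unfolding b_def by (simp_all add: inv_into_into f_inv_into_f)
  qed
  have bK: "compact (b ` K)"
  proof (rule compact_continuous_image[OF _ K(1)])
    have "gdom G ` K \<subseteq> gdom G ` B"
    proof (rule image_subsetI)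
      fix g assume "g \<in> K"
      then show "gdom G g \<in> gdom G ` B"
        using b[of g] K(2) by (metis imageI subsetD)
    qed
    then show "continuous_on K b"
      unfolding b_def
      by (rule continuous_on_compose2[OF homeomorphism_cont2[OF bisection_homeomorphism_dom[OF B]] continuous_dom])
  qed
  have bK_sub: "b ` K \<subseteq> B"
    using b(1) K(2) by blast
  obtain \<phi> :: "'g \<Rightarrow> real" and L where \<phi>: "continuous_on B \<phi>"
      "\<And>x. x \<in> b ` K \<Longrightarrow> \<phi> x = 1" "compact L" "L \<subseteq> B" "\<And>x. x \<notin> L \<Longrightarrow> \<phi> x = 0"
    using bisection_Urysohn[OF B bK bK_sub bisectionD(1)[OF B] subset_refl] by metis
  have nu: "0 < bnorm E (u g)" if "g \<in> B" for g
    using u(2,3)[OF that] bnorm_pos[of "u g"] by simp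
  \<comment> \<open>\<open>u\<close> and \<open>u/\<parallel>u\<parallel>\<^sup>2\<close>, cut off away from the points \<open>b(g)\<close> with \<open>r(g) \<noteq> 0\<close>\<close>
  define t where "t g = (if g \<in> B then bscale E (complex_of_real (\<phi> g)) (u g) else bzero E g)" for g
  define t1 where "t1 g = (if g \<in> B then bscale E (complex_of_real (\<phi> g / (bnorm E (u g))\<^sup>2)) (u g)
      else bzero E g)" for g
  have t: "t \<in> Cc E B"
    unfolding t_def
    by (rule Cc_cutoff[OF u(1,2) _ \<phi>(3,4)]) (auto simp: \<phi>(5) intro!: continuous_intros \<phi>(1))
  have t1: "t1 \<in> Cc E B"
    unfolding t1_def
  proof (rule Cc_cutoff[OF u(1,2) _ \<phi>(3,4)])
    show "continuous_on B (\<lambda>g. complex_of_real (\<phi> g / (bnorm E (u g))\<^sup>2))"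
      using nu by (intro continuous_intros \<phi>(1) continuous_on_bnorm u(1)) fastforce
  qed (simp_all add: \<phi>(5))
  let ?B' = "ginv G ` B"
  note B' = bisection_inv[OF B]
  define A where "A = set_mult R ?B'"
  define s where "s = conv G E r (sect_star G E t1)"
  have star: "sect_star G E t1 \<in> Cc E ?B'"
    using sect_star_Cc[OF t1] .
  have A: "A \<in> local_bisections G"
    unfolding A_def using bisection_set_mult[OF R(1) B'] .
  have "A \<subseteq> set_mult (set_mult U B) ?B'"
    unfolding A_def using R(2) unfolding set_mult_def by blast
  also have "\<dots> \<subseteq> U"
    using set_mult_inv_subset bisectionD(2)[OF B] .
  finally have "A \<subseteq> U" .
  have s: "s \<in> Cc E A"
    unfolding s_def A_def using conv_Cc[OF R(1) B' r star] .
  have AB: "set_mult A B \<subseteq> R"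
    using set_mult_inv_subset[OF bisectionD(2)[OF B'], of R]
    by (simp add: A_def image_image inv_inv)
  have "r g = conv G E s t g" for g
  proof (cases "g \<in> R")
    case False
    then have "g \<notin> set_mult A B"
      using AB by (metis subsetD)
    then show ?thesis
      using CcD(2)[OF r False] CcD(2)[OF conv_Cc[OF A B s t], of g] by simp
  next
    case True
    note b = b[OF True]
    let ?x = "g \<cdot>\<^bsub>G\<^esub> ginv G (b g)"
    have x: "gdom G g = grng G (ginv G (b g))" "gdom G ?x = grng G (b g)" "?x \<cdot>\<^bsub>G\<^esub> b g = g"
      using b(2) by (simp_all add: cancel_inv_mult)
    have "?x \<in> A"
      unfolding A_def using True b x(1) by (intro set_multI) auto
    have "conv G E s t g = bmult E (s ?x) (t (b g))"
      using conv_Cc_mult[OF A s CcD(1)[OF t] \<open>?x \<in> A\<close> x(2)] x(3) by simp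
    also have "s ?x = bmult E (r g) (bstar E (t1 (b g)))"
      unfolding s_def conv_Cc_mult[OF R(1) r CcD(1)[OF star] True x(1)]
      by (simp add: sect_star_def inv_inv)
    also have "bmult E (bmult E (r g) (bstar E (t1 (b g)))) (t (b g))
        = bmult E (r g) (bmult E (bstar E (t1 (b g))) (t (b g)))"
      using b(2) by (intro bmult_assoc) (simp_all add: CcD(1)[OF r] CcD(1)[OF t1] CcD(1)[OF t])
    also have "\<dots> = bscale E (complex_of_real ((\<phi> (b g))\<^sup>2)) (r g)"
    proof -
      have n: "bnorm E (u (b g)) \<noteq> 0"
        using nu[OF b(1)] by simp
      have "bmult E (bstar E (t1 (b g))) (t (b g))
          = bscale E (complex_of_real ((\<phi> (b g))\<^sup>2 / (bnorm E (u (b g)))\<^sup>2)) (bmult E (bstar E (u (b g))) (u (b g)))"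
        using b(1) u(2)[OF b(1)]
        by (simp add: t_def t1_def star_scale bmult_bscale_left bmult_bscale_right scale_scale power2_eq_square mult_ac)
      then show ?thesis
        using b u(2)[OF b(1)] n
        by (simp add: bmult_bscale_right bmult_star_mult CcD(1)[OF r] scale_scale inv_mult_self flip: of_real_mult of_real_power of_real_divide)
    qed
    also have "\<dots> = r g"
    proof (cases "g \<in> K")
      case True
      then show ?thesis by (simp add: \<phi>(2) scale_one)
    next
      case False
      then show ?thesis by (simp add: K(3))
    qed
    finally show ?thesis by simp
  qed
  then have "r = conv G E s t" by (rule ext)
  then show ?thesis
    using that A \<open>A \<subseteq> U\<close> s t by blast
qed

text \<open>One inclusion holds on generators because convolution multiplies supports. The other one is checked
  on the sets \<open>UB\<close>, where \<open>B \<subseteq> V\<close> is a bisection with a nonvanishing section: they cover \<open>UV\<close>.\<close>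

lemma assoc_map_set_mult:
  assumes "open U" "open V"
  shows "assoc_map G E \<iota> (set_mult U V) = qmult Max_quantale (assoc_map G E \<iota> U) (assoc_map G E \<iota> V)"
proof -
  let ?P = "{x * y |x y. x \<in> local_elements U \<and> y \<in> local_elements V}"
  have "?P \<subseteq> local_elements (set_mult U V)"
  proof clarify
    fix x y assume "x \<in> local_elements U" "y \<in> local_elements V"
    then obtain A s B t where A: "A \<in> local_bisections G" "A \<subseteq> U" "s \<in> Cc E A" "x = \<iota> s"
        and B: "B \<in> local_bisections G" "B \<subseteq> V" "t \<in> Cc E B" "y = \<iota> t"
      by (auto elim!: local_elementsE)
    have "x * y = \<iota> (conv G E s t)"
      using \<iota>_mult[OF Gamma_c.base[OF A(1,3)] Gamma_c.base[OF B(1,3)]] A B by simp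
    moreover have "set_mult A B \<subseteq> set_mult U V"
      using A(2) B(2) unfolding set_mult_def by blast
    ultimately show "x * y \<in> local_elements (set_mult U V)"
      using local_elementsI[OF bisection_set_mult[OF A(1) B(1)] _ conv_Cc[OF A(1) B(1) A(3) B(3)]] by simp
  qed
  then have "clspan ?P \<subseteq> assoc_map G E \<iota> (set_mult U V)"
    unfolding assoc_map_clspan by (rule clspan_mono)
  moreover have "assoc_map G E \<iota> (set_mult U V) \<subseteq> clspan ?P"
  proof -
    define S where "S = {B \<in> local_bisections G. B \<subseteq> V \<and> (\<exists>u. continuous_on B u \<and>
        (\<forall>g\<in>B. proj E (u g) = g \<and> u g \<noteq> bzero E g))}"
    have "\<Union>S = V"
    proof (intro equalityI subsetI)
      fix g assume "g \<in> V"
      obtain B u where "B \<in> local_bisections G" "g \<in> B" "B \<subseteq> V" "continuous_on B u"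
          "\<And>g. g \<in> B \<Longrightarrow> proj E (u g) = g" "\<And>g. g \<in> B \<Longrightarrow> u g \<noteq> bzero E g"
        using local_nonvanishing_section[OF assms(2) \<open>g \<in> V\<close>] by metis
      then show "g \<in> \<Union>S"
        unfolding S_def by blast
    qed (auto simp: S_def)
    then have "set_mult U V = \<Union>(set_mult U ` S)"
      using set_mult_Union_right by metis
    moreover have "local_elements (\<Union>(set_mult U ` S)) \<subseteq> clspan ?P"
    proof (intro local_elements_Union_subset clspan_subspace conjI)
      fix W assume "W \<in> set_mult U ` S"
      then obtain B u where B: "W = set_mult U B" "B \<in> local_bisections G" "B \<subseteq> V"
          and u: "continuous_on B u" "\<And>g. g \<in> B \<Longrightarrow> proj E (u g) = g" "\<And>g. g \<in> B \<Longrightarrow> u g \<noteq> bzero E g"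
        unfolding S_def by blast
      show "open W"
        using B open_set_mult_bisection assms(1) by simp
      show "local_elements W \<subseteq> clspan ?P"
      proof
        fix a assume "a \<in> local_elements W"
        then obtain R r where R: "R \<in> local_bisections G" "R \<subseteq> set_mult U B" "r \<in> Cc E R" "a = \<iota> r"
          using B(1) by (auto elim!: local_elementsE)
        obtain A s t where A: "A \<in> local_bisections G" "A \<subseteq> U" "s \<in> Cc E A" and t: "t \<in> Cc E B"
            and r: "r = conv G E s t"
          using factor_through_section[OF B(2) u R(1,2,3)] by metis
        have "a = \<iota> s * \<iota> t"
          using \<iota>_mult[OF Gamma_c.base[OF A(1,3)] Gamma_c.base[OF B(2) t]] R(4) r by simp
        then have "a \<in> ?P"
          using local_elementsI[OF A] local_elementsI[OF B(2,3) t] by blast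
        then show "a \<in> clspan ?P"
          by (rule subsetD[OF clspan_superset])
      qed
    qed
    ultimately show ?thesis
      unfolding assoc_map_clspan by (simp add: clspan_minimal)
  qed
  ultimately show ?thesis
    unfolding assoc_map_clspan qmult_clspan by blast
qed

lemma assoc_map_inv: "assoc_map G E \<iota> (ginv G ` V) = adj ` assoc_map G E \<iota> V"
proof -
  have sub: "adj ` local_elements V \<subseteq> local_elements (ginv G ` V)" for V
  proof clarify
    fix a assume "a \<in> local_elements V"
    then obtain U s where U: "U \<in> local_bisections G" "U \<subseteq> V" "s \<in> Cc E U" "a = \<iota> s"
      by (rule local_elementsE)
    have "adj a = \<iota> (sect_star G E s)"
      using \<iota>_star[OF Gamma_c.base[OF U(1,3)]] U(4) by simp
    moreover have "ginv G ` U \<subseteq> ginv G ` V"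
      using U(2) by blast
    ultimately show "adj a \<in> local_elements (ginv G ` V)"
      using local_elementsI[OF bisection_inv[OF U(1)] _ sect_star_Cc[OF U(3)]] by simp
  qed
  have "adj ` adj ` local_elements (ginv G ` V) \<subseteq> adj ` local_elements V"
    using sub[of "ginv G ` V"] by (intro image_mono) (simp add: image_image inv_inv)
  then have "local_elements (ginv G ` V) \<subseteq> adj ` local_elements V"
    by (simp add: image_image adj_adj)
  with sub have "local_elements (ginv G ` V) = adj ` local_elements V"
    by blast
  then show ?thesis
    by (simp add: assoc_map_clspan adj_clspan)
qed

lemma assoc_map_quantale_map: "quantale_map Max_quantale (Omega G) (assoc_map G E \<iota>)"
proof -
  interpret Q: involutive_quantale "Max_quantale :: 'a set quantale_str" by (rule Max_involutive_quantale)
  interpret X: involutive_quantale "Omega G" by (rule Omega_involutive_quantale)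
  show ?thesis
  proof
    show "assoc_map G E \<iota> V \<in> carrier Max_quantale" for V
      by (simp add: assoc_map_clspan)
    show "assoc_map G E \<iota> (\<Squnion>\<^bsub>Omega G\<^esub>S) = \<Squnion>\<^bsub>Max_quantale\<^esub>(assoc_map G E \<iota> ` S)" if "S \<subseteq> carrier (Omega G)" for S
      using that by (subst Sup_Omega[OF that], subst assoc_map_Union)
        (auto simp: assoc_map_clspan Sup_clspan)
  qed (simp_all add: qmult_Omega qstar_Omega assoc_map_set_mult qstar_Max assoc_map_inv)
qed

lemma eval_at_outside:
  assumes "a \<in> assoc_map G E \<iota> V" "g \<notin> V"
  shows "eval_at G E \<iota> g a = bzero E g"
proof -
  have "assoc_map G E \<iota> V \<subseteq> {a. eval_at G E \<iota> g a = bzero E g}"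
    unfolding assoc_map_clspan
  proof (intro clspan_minimal eval_at_kernel subsetI CollectI)
    fix a assume "a \<in> local_elements V"
    then obtain U s where U: "U \<in> local_bisections G" "U \<subseteq> V" "s \<in> Cc E U" "a = \<iota> s"
      by (rule local_elementsE)
    then show "eval_at G E \<iota> g a = bzero E g"
      using eval_at_\<iota>[OF Gamma_c.base[OF U(1,3)]] CcD(2)[OF U(3), of g] assms(2) by auto
  qed
  then show ?thesis
    using assms(1) by blast
qed

lemma open_support_outside: "a \<in> assoc_map G E \<iota> V \<Longrightarrow> open_support G E \<iota> a \<subseteq> V"
  unfolding open_support_def using eval_at_outside interior_subset by blast

end

section \<open>Weak openness\<close>

locale localizable_line_bundle_completion =
  line_bundle_completion G E N \<iota> + localizable_completion G E N \<iota>
  for G :: "('g::topological_space, 'm) groupoid_str_scheme"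
    and E :: "('g, 'e::topological_space, 'n) fell_bundle_str_scheme"
    and N :: "('g \<Rightarrow> 'e) \<Rightarrow> real"
    and \<iota> :: "('g \<Rightarrow> 'e) \<Rightarrow> 'a::cstar_algebra"
begin

text \<open>The left adjoint \<open>p\<^sub>!\<close>.\<close>

definition direct_image :: "'a set \<Rightarrow> 'g set" where
  "direct_image V = (\<Union>a\<in>V. open_support G E \<iota> a)"

lemma open_direct_image: "open (direct_image V)"
  by (auto simp: direct_image_def open_support_def)

text \<open>From left to right this is localizability. Conversely, evaluation at a point outside \<open>W\<close> kills
  \<open>p\<^sup>*(W)\<close>, so that no element of it has a point outside \<open>W\<close> in its open support.\<close>

lemma direct_image_subset_iff:
  assumes "open W" shows "direct_image V \<subseteq> W \<longleftrightarrow> V \<subseteq> assoc_map G E \<iota> W"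
proof
  assume "direct_image V \<subseteq> W"
  then have "V \<subseteq> {a. open_support G E \<iota> a \<subseteq> W}"
    by (auto simp: direct_image_def)
  also have "\<dots> \<subseteq> supported_in G E \<iota> W"
    using clspan_superset by (simp add: supported_in_def clspan_def)
  finally show "V \<subseteq> assoc_map G E \<iota> W"
    using localizable[OF assms] by simp
next
  assume "V \<subseteq> assoc_map G E \<iota> W"
  then show "direct_image V \<subseteq> W"
    using open_support_outside unfolding direct_image_def by blast
qed

lemma direct_image_left_adjoint:
  "is_left_adjoint Max_quantale (Omega G) (assoc_map G E \<iota>) direct_image"
  unfolding is_left_adjoint_def
  using open_direct_image direct_image_subset_iff by (simp add: le_Omega Max_quantale_def)

lemma left_adjoint_eq:
  assumes l: "is_left_adjoint Max_quantale (Omega G) (assoc_map G E \<iota>) l" and V: "V \<in> carrier Max_quantale"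
  shows "l V = direct_image V"
proof -
  have "open (l V)" and iff: "\<And>W. open W \<Longrightarrow> l V \<subseteq> W \<longleftrightarrow> V \<subseteq> assoc_map G E \<iota> W"
    using l V unfolding is_left_adjoint_def by (auto simp: le_Omega Max_quantale_def)
  show ?thesis
  proof (rule subset_antisym)
    show "l V \<subseteq> direct_image V"
      unfolding iff[OF open_direct_image] direct_image_subset_iff[OF open_direct_image, symmetric]
      by (rule subset_refl)
    show "direct_image V \<subseteq> l V"
      unfolding direct_image_subset_iff[OF \<open>open (l V)\<close>] iff[OF \<open>open (l V)\<close>, symmetric]
      by (rule subset_refl)
  qed
qed

text \<open>Formal consequence of the adjunction and of \<open>p\<^sup>*\<close> being multiplicative.\<close>

lemma direct_image_mult_subset:
  assumes U: "open U"
  shows "direct_image (qmult Max_quantale (assoc_map G E \<iota> U) V) \<subseteq> set_mult U (direct_image V)"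
proof -
  have "V \<subseteq> assoc_map G E \<iota> (direct_image V)"
    using direct_image_subset_iff[OF open_direct_image] by blast
  then have "qmult Max_quantale (assoc_map G E \<iota> U) V
      \<subseteq> qmult Max_quantale (assoc_map G E \<iota> U) (assoc_map G E \<iota> (direct_image V))"
    unfolding qmult_Max by (intro clspan_mono) blast
  also have "\<dots> = assoc_map G E \<iota> (set_mult U (direct_image V))"
    using assoc_map_set_mult[OF U open_direct_image] by simp
  finally show ?thesis
    using direct_image_subset_iff open_set_mult U open_direct_image by blast
qed

text \<open>Multiplication by a section that does not vanish near \<open>g\<close> carries the open support of \<open>a\<close> to an open
  set on which the product does not vanish, because a line bundle has no zero divisors.\<close>

lemma set_mult_direct_image_subset:
  assumes U: "open U"
  shows "set_mult U (direct_image V) \<subseteq> direct_image (qmult Max_quantale (assoc_map G E \<iota> U) V)"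
proof
  fix k assume "k \<in> set_mult U (direct_image V)"
  then obtain g h a where k: "k = g \<cdot>\<^bsub>G\<^esub> h" "gdom G g = grng G h" and g: "g \<in> U"
      and a: "a \<in> V" and h: "h \<in> open_support G E \<iota> a"
    unfolding direct_image_def by (auto elim!: set_multE)
  obtain B u where B: "B \<in> local_bisections G" "g \<in> B" "B \<subseteq> U" and u: "continuous_on B u"
      "\<And>g. g \<in> B \<Longrightarrow> proj E (u g) = g" "\<And>g. g \<in> B \<Longrightarrow> u g \<noteq> bzero E g"
    using local_nonvanishing_section[OF U g] by metis
  obtain \<phi> :: "'g \<Rightarrow> real" and L where \<phi>: "continuous_on B \<phi>"
      "\<And>x. x \<in> {g} \<Longrightarrow> \<phi> x = 1" "compact L" "L \<subseteq> B" "\<And>x. x \<notin> L \<Longrightarrow> \<phi> x = 0"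
    using bisection_Urysohn[OF B(1), of "{g}" B] B(2) bisectionD(1)[OF B(1)] by auto
  define s where "s g = (if g \<in> B then bscale E (complex_of_real (\<phi> g)) (u g) else bzero E g)" for g
  have s: "s \<in> Cc E B"
    unfolding s_def
    by (rule Cc_cutoff[OF u(1,2) _ \<phi>(3,4)]) (auto simp: \<phi>(5) intro!: continuous_intros \<phi>(1))
  define O1 where "O1 = \<phi> -` (- {0}) \<inter> B"
  have O1: "open O1" "g \<in> O1"
    using \<phi>(1,2) B(2) continuous_on_open_vimage[OF bisectionD(1)[OF B(1)], of \<phi>] by (auto simp: O1_def)
  have nz: "s x \<noteq> bzero E x" if "x \<in> O1" for x
    using that bscale_eq_zero[of "complex_of_real (\<phi> x)" "u x"] u(2,3)[of x] by (auto simp: s_def O1_def)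
  let ?M = "qmult Max_quantale (assoc_map G E \<iota> U) V"
  have "\<iota> s \<in> assoc_map G E \<iota> U"
    using local_elementsI[OF B(1,3) s] clspan_superset by (auto simp: assoc_map_clspan)
  then have sa: "\<iota> s * a \<in> ?M"
    unfolding qmult_Max using a by (intro subsetD[OF clspan_superset]) blast
  have "set_mult O1 (open_support G E \<iota> a) \<subseteq> {k. eval_at G E \<iota> k (\<iota> s * a) \<noteq> bzero E k}"
  proof
    fix k assume "k \<in> set_mult O1 (open_support G E \<iota> a)"
    then obtain x y where xy: "k = x \<cdot>\<^bsub>G\<^esub> y" "x \<in> O1" "y \<in> open_support G E \<iota> a" "gdom G x = grng G y"
      by (rule set_multE)
    have "eval_at G E \<iota> k (\<iota> s * a) = bmult E (s x) (eval_at G E \<iota> y a)"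
      using eval_at_mult[OF B(1) s _ xy(4)] xy by (simp add: O1_def)
    moreover have "eval_at G E \<iota> y a \<noteq> bzero E y"
      using xy(3) interior_subset unfolding open_support_def by blast
    then have "bmult E (s x) (eval_at G E \<iota> y a) \<noteq> bzero E k"
      using bmult_nonzero[of "s x" "eval_at G E \<iota> y a"] nz[OF xy(2)] xy(1,4) CcD(1)[OF s] by simp
    ultimately show "k \<in> {k. eval_at G E \<iota> k (\<iota> s * a) \<noteq> bzero E k}"
      by simp
  qed
  moreover have "open (set_mult O1 (open_support G E \<iota> a))"
    by (intro open_set_mult O1(1)) (simp add: open_support_def)
  ultimately have "set_mult O1 (open_support G E \<iota> a) \<subseteq> open_support G E \<iota> (\<iota> s * a)"
    unfolding open_support_def by (rule interior_maximal)
  moreover have "k \<in> set_mult O1 (open_support G E \<iota> a)"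
    using k O1(2) h by (auto intro: set_multI)
  ultimately show "k \<in> direct_image ?M"
    using sa unfolding direct_image_def by blast
qed

lemma weakly_open_assoc_map: "weakly_open (Max_quantale :: 'a set quantale_str) (Omega G) (assoc_map G E \<iota>)"
  unfolding weakly_open_def semiopen_def
proof (intro conjI exI allI impI ballI)
  show "quantale_map (Max_quantale :: 'a set quantale_str) (Omega G) (assoc_map G E \<iota>)"
    by (rule assoc_map_quantale_map)
  show "is_left_adjoint Max_quantale (Omega G) (assoc_map G E \<iota>) direct_image"
    by (rule direct_image_left_adjoint)
  fix l :: "'a set \<Rightarrow> 'g set" and V :: "'a set" and U :: "'g set"
  assume l: "is_left_adjoint Max_quantale (Omega G) (assoc_map G E \<iota>) l" and V: "V \<in> carrier Max_quantale"
    and "U \<in> carrier (Omega G)"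
  then have U: "open U" by simp
  have "l (qmult Max_quantale (assoc_map G E \<iota> U) V) = direct_image (qmult Max_quantale (assoc_map G E \<iota> U) V)"
    using l by (rule left_adjoint_eq) (simp add: qmult_Max)
  also have "\<dots> = set_mult U (direct_image V)"
    using direct_image_mult_subset set_mult_direct_image_subset U by blast
  finally show "l (qmult Max_quantale (assoc_map G E \<iota> U) V) = qmult (Omega G) U (l V)"
    by (simp add: qmult_Omega left_adjoint_eq[OF l V])
qed

end

theorem theorem5p4:
  fixes G :: "'g::topological_space groupoid_str"
    and E :: "('g, 'e::topological_space) fell_bundle_str"
    and N :: "('g \<Rightarrow> 'e) \<Rightarrow> real"
    and \<iota> :: "('g \<Rightarrow> 'e) \<Rightarrow> 'a::cstar_algebra"
  assumes "fell_line_bundle G E"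
    and "localizable_completion G E N \<iota>"
  shows "weakly_open (Max_quantale :: 'a set quantale_str) (Omega G) (assoc_map G E \<iota>)"
proof -
  interpret fell_line_bundle G E by fact
  interpret localizable_completion G E N \<iota> by fact
  interpret localizable_line_bundle_completion G E N \<iota> ..
  show ?thesis
    by (rule weakly_open_assoc_map)
qed

end
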